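(* Let $\alpha>0$, and let $\rho_0(x)$ and $u_0(x)$ be two bounded measurable functions satisfying $\rho_0\ge0$. Consider the coupled Burgers system $$\partial_t\rho+\partial_x(\rho u)=0,\qquad \partial_tu+\partial_x\Big(\frac{u^2+\alpha\rho^2}{2}\Big)=0,\qquad x\in\mathbb{R},\ t>0.$$ Then: (i) There exists a unique entropy solution $(\rho(x,t),u(x,t))$ of the coupled Burgers system such that $\rho\ge0$ and $(\rho,u)|_{t=0}=(\rho_0,u_0)$. (ii) Let $(\tilde\rho,\tilde u)$ be another entropy solution of the coupled Burgers system subject to initial datum $(\tilde\rho_0(x),\tilde u_0(x))$ with $\tilde\rho_0\ge0$. If $u_0-\tilde u_0,\ \rho_0-\tilde\rho_0\in L^1(\mathbb{R})$, then $u(\cdot,t)-\tilde u(\cdot,t),\ \rho(\cdot,t)-\tilde\rho(\cdot,t)\in L^1(\mathbb{R})$ and $$\sqrt\alpha\,\|\rho(\cdot,t)-\tilde\rho(\cdot,t)\|_{L^1}+\|u(\cdot,t)-\tilde u(\cdot,t)\|_{L^1}\le2\big(\sqrt\alpha\,\|\rho_0-\tilde\rho_0\|_{L^1}+\|u_0-\tilde u_0\|_{L^1}\big).$$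
   Context: Entropy pairs: for convex functions $\psi_1,\psi_2\in C^2(\mathbb{R})$ and real numbers $k_1,k_2\ge0$, let $$\eta(\rho,u)=k_1\psi_1(u+\sqrt\alpha\rho)+k_2\psi_2(u-\sqrt\alpha\rho),\qquad q(\rho,u)=k_1\phi_1(u+\sqrt\alpha\rho)+k_2\phi_2(u-\sqrt\alpha\rho),$$ where $\phi_i'(v)=v\psi_i'(v)$ for $v\in\mathbb{R}$, $i=1,2$. Entropy solution: a couple $(\rho,u)$ is called an entropy solution of the coupled Burgers system if $\rho\ge0$ and $\partial_t\eta(\rho,u)+\partial_xq(\rho,u)\le0$ in the sense of distributions for every such pair $(\eta,q)$. *)

theory Defs
  imports "HOL-Analysis.Analysis"
begin

text \<open>Functions on the half-plane are written in the curried form \<open>rho x t\<close>, with \<open>x\<close> the space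
  and \<open>t\<close> the time variable; only the values for \<open>t > 0\<close> matter.\<close>

definition half_plane :: "(real \<times> real) set" where
  "half_plane = UNIV \<times> {0<..}"

definition ess_bounded :: "'a measure \<Rightarrow> ('a \<Rightarrow> real) \<Rightarrow> bool" where
  "ess_bounded M f \<longleftrightarrow> f \<in> borel_measurable M \<and> (\<exists>C. AE p in M. \<bar>f p\<bar> \<le> C)"

text \<open>Test functions: \<open>C\<^sup>\<infinity>\<close> with compact support inside the open half-plane.\<close>

primrec C_k :: "nat \<Rightarrow> (real \<times> real \<Rightarrow> real) \<Rightarrow> bool" where
  "C_k 0 f \<longleftrightarrow> continuous_on UNIV f"
| "C_k (Suc k) f \<longleftrightarrow>
    (\<exists>fx ft. (\<forall>p. (f has_derivative (\<lambda>h. fx p * fst h + ft p * snd h)) (at p)) \<and>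
             C_k k fx \<and> C_k k ft)"

definition test_function :: "(real \<times> real \<Rightarrow> real) \<Rightarrow> bool" where
  "test_function \<theta> \<longleftrightarrow>
    (\<forall>k. C_k k \<theta>) \<and> compact (closure {p. \<theta> p \<noteq> 0}) \<and> closure {p. \<theta> p \<noteq> 0} \<subseteq> half_plane"

text \<open>\<open>\<partial>\<^sub>t F + \<partial>\<^sub>x G \<le> 0\<close> in the sense of distributions on the half-plane. It is only applied to
  essentially bounded \<open>F\<close> and \<open>G\<close>, for which the integral exists.\<close>

definition distr_le_zero :: "(real \<Rightarrow> real \<Rightarrow> real) \<Rightarrow> (real \<Rightarrow> real \<Rightarrow> real) \<Rightarrow> bool" where
  "distr_le_zero F G \<longleftrightarrow>
    (\<forall>\<theta>. test_function \<theta> \<longrightarrow> (\<forall>p. 0 \<le> \<theta> p) \<longrightarrow>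
      - (LINT (x, t)|lebesgue_on half_plane.
          F x t * deriv (\<lambda>s. \<theta> (x, s)) t + G x t * deriv (\<lambda>y. \<theta> (y, t)) x) \<le> 0)"

definition C2 :: "(real \<Rightarrow> real) \<Rightarrow> bool" where
  "C2 \<psi> \<longleftrightarrow>
    (\<exists>\<psi>' \<psi>''. (\<forall>v. (\<psi> has_real_derivative \<psi>' v) (at v)) \<and>
             (\<forall>v. (\<psi>' has_real_derivative \<psi>'' v) (at v)) \<and> continuous_on UNIV \<psi>'')"

definition entropy_pair ::
    "real \<Rightarrow> (real \<Rightarrow> real \<Rightarrow> real) \<Rightarrow> (real \<Rightarrow> real \<Rightarrow> real) \<Rightarrow> bool" where
  "entropy_pair \<alpha> \<eta> q \<longleftrightarrow>
    (\<exists>\<psi>\<^sub>1 \<psi>\<^sub>2 \<phi>\<^sub>1 \<phi>\<^sub>2 k\<^sub>1 k\<^sub>2.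
      convex_on UNIV \<psi>\<^sub>1 \<and> C2 \<psi>\<^sub>1 \<and> convex_on UNIV \<psi>\<^sub>2 \<and> C2 \<psi>\<^sub>2 \<and> 0 \<le> k\<^sub>1 \<and> 0 \<le> k\<^sub>2 \<and>
      (\<forall>v. (\<phi>\<^sub>1 has_real_derivative v * deriv \<psi>\<^sub>1 v) (at v)) \<and>
      (\<forall>v. (\<phi>\<^sub>2 has_real_derivative v * deriv \<psi>\<^sub>2 v) (at v)) \<and>
      \<eta> = (\<lambda>r v. k\<^sub>1 * \<psi>\<^sub>1 (v + sqrt \<alpha> * r) + k\<^sub>2 * \<psi>\<^sub>2 (v - sqrt \<alpha> * r)) \<and>
      q = (\<lambda>r v. k\<^sub>1 * \<phi>\<^sub>1 (v + sqrt \<alpha> * r) + k\<^sub>2 * \<phi>\<^sub>2 (v - sqrt \<alpha> * r)))"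

text \<open>Solutions are \<open>L\<^sup>\<infinity>\<close> functions. Taking \<open>\<psi>\<^sub>1\<close> or \<open>\<psi>\<^sub>2\<close> to be \<open>v\<close> or \<open>- v\<close> shows that the entropy
  inequalities contain the system
  \<open>\<partial>\<^sub>t \<rho> + \<partial>\<^sub>x (\<rho> u) = 0\<close>, \<open>\<partial>\<^sub>t u + \<partial>\<^sub>x ((u\<^sup>2 + \<alpha> \<rho>\<^sup>2) / 2) = 0\<close> itself.\<close>

definition entropy_solution :: "real \<Rightarrow> (real \<Rightarrow> real \<Rightarrow> real) \<Rightarrow> (real \<Rightarrow> real \<Rightarrow> real) \<Rightarrow> bool" where
  "entropy_solution \<alpha> \<rho> u \<longleftrightarrow>
    ess_bounded (lebesgue_on half_plane) (\<lambda>(x, t). \<rho> x t) \<and>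
    ess_bounded (lebesgue_on half_plane) (\<lambda>(x, t). u x t) \<and>
    (AE (x, t) in lebesgue_on half_plane. 0 \<le> \<rho> x t) \<and>
    (\<forall>\<eta> q. entropy_pair \<alpha> \<eta> q \<longrightarrow>
      distr_le_zero (\<lambda>x t. \<eta> (\<rho> x t) (u x t)) (\<lambda>x t. q (\<rho> x t) (u x t)))"

text \<open>\<open>f(\<cdot>,0) = f\<^sub>0\<close> in the sense of Kruzkov: \<open>f(\<cdot>,t)\<close> tends to \<open>f\<^sub>0\<close> in \<open>L\<^sup>1\<^sub>l\<^sub>o\<^sub>c\<close> as \<open>t\<close> tends
  to \<open>0\<close> outside a null set of times. For an \<open>L\<^sup>\<infinity>\<close> function almost every time slice is
  measurable and bounded, so the integral is a genuine one for almost every \<open>t\<close>.\<close>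

definition has_initial_value :: "(real \<Rightarrow> real \<Rightarrow> real) \<Rightarrow> (real \<Rightarrow> real) \<Rightarrow> bool" where
  "has_initial_value f f\<^sub>0 \<longleftrightarrow>
    (\<forall>R>0. \<forall>\<epsilon>>0. \<exists>\<delta>>0. AE t in lebesgue. 0 < t \<and> t < \<delta> \<longrightarrow>
      (LINT x:{-R..R}|lebesgue. \<bar>f x t - f\<^sub>0 x\<bar>) < \<epsilon>)"

text \<open>\<open>f \<in> C((0,\<infinity>); L\<^sup>1\<^sub>l\<^sub>o\<^sub>c(\<real>))\<close>, which gives \<open>f(\<cdot>,t)\<close> a meaning for every \<open>t > 0\<close>.\<close>

definition L1_loc_continuous :: "(real \<Rightarrow> real \<Rightarrow> real) \<Rightarrow> bool" where
  "L1_loc_continuous f \<longleftrightarrow>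
    (\<forall>R>0. \<forall>s>0. set_integrable lebesgue {-R..R} (\<lambda>x. f x s) \<and>
      ((\<lambda>t. LINT x:{-R..R}|lebesgue. \<bar>f x t - f x s\<bar>) \<longlongrightarrow> 0) (at s))"

definition L1_norm :: "(real \<Rightarrow> real) \<Rightarrow> real" where
  "L1_norm f = (LINT x|lebesgue. \<bar>f x\<bar>)"

end

theory Submission
  imports Defs "HOL-Computational_Algebra.Polynomial"
begin

text \<open>The Riemann invariants \<open>w = u + \<surd>\<alpha> \<rho>\<close> and \<open>z = u - \<surd>\<alpha> \<rho>\<close> turn the system into two copies of the Burgers
  equation \<open>\<partial>\<^sub>t w + \<partial>\<^sub>x (w\<^sup>2 / 2) = 0\<close>, each with all its entropies, and \<open>\<rho> \<ge> 0\<close> means \<open>z \<le> w\<close>.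
  Two entropy solutions of the Burgers equation satisfy Kruzhkov's inequality for \<open>|w - v|\<close> by doubling
  of variables; testing it with trapezoids gives finite propagation up to an error that vanishes in the
  limit of infinitely wide trapezoids, hence \<open>L\<^sup>1\<close> contraction and uniqueness.
  Existence comes from the Hopf--Lax formula \<open>w = (x - y) / t\<close>, with \<open>y\<close> the minimizer of
  \<open>A y + (x - y)\<^sup>2 / (2 t)\<close> and \<open>A' = w\<^sub>0\<close>. Restricting the minimization to a finite grid and replacing the
  minimum by a Gibbs average of inverse temperature \<open>N\<close> gives exact smooth solutions of the viscous
  equation with viscosity \<open>1 / (2 N)\<close>, from which the entropy inequalities are inherited. The formula is
  monotone in \<open>A'\<close>, so \<open>z \<le> w\<close> is preserved, and pointwise convergence of minimizers gives the
  continuity in time, also at \<open>t = 0\<close>, where Lebesgue points of \<open>w\<^sub>0\<close> are used.\<close>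

section \<open>Smooth bumps and trapezoids\<close>

text \<open>The entropy condition speaks only of \<open>C2\<close> entropies and smooth test
  functions. On the uniqueness side every test function is a product a(x) b(t): for products the
  recursive \<open>C_k\<close> is easy to check, and with product mollifiers the doubling argument
  stays inside this class. A flux error proportional to the mass on scale R divided by R remains,
  and it vanishes only once those masses are bounded independently of R. On the existence side the
  finite grid keeps the Gibbs average elementary: a finite sum of Gaussians is differentiated
  termwise, and the viscous equation becomes an algebraic identity between the first three moments
  of the velocity. In the limit, convergence is pointwise because minimizers are unique at almost
  every point, and all derivatives fall on the test function. Solutions are determined only almost
  everywhere, so the contraction first holds at almost every time; continuity in time extends it to
  every time.\<close>

primrec Ck1 :: "nat \<Rightarrow> (real \<Rightarrow> real) \<Rightarrow> bool" where
  "Ck1 0 f \<longleftrightarrow> continuous_on UNIV f"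
| "Ck1 (Suc k) f \<longleftrightarrow> (\<exists>f'. (\<forall>x. (f has_real_derivative f' x) (at x)) \<and> Ck1 k f')"

definition smooth1 :: "(real \<Rightarrow> real) \<Rightarrow> bool" where
  "smooth1 f \<longleftrightarrow> (\<forall>k. Ck1 k f)"

lemma Ck1_continuous: "Ck1 k f \<Longrightarrow> continuous_on UNIV f"
proof (cases k)
  case (Suc m)
  assume "Ck1 k f"
  then obtain f' where "\<And>x. (f has_real_derivative f' x) (at x)"
    using Suc by auto
  then show ?thesis
    by (intro continuous_at_imp_continuous_on) (auto intro: DERIV_isCont)
qed auto

lemma Ck1_Suc_imp: "Ck1 (Suc k) f \<Longrightarrow> Ck1 k f"
proof (induction k arbitrary: f)
  case 0
  then have "continuous_on UNIV f" by (rule Ck1_continuous)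
  then show ?case by simp
next
  case (Suc k)
  from Suc.prems obtain f' where f': "\<And>x. (f has_real_derivative f' x) (at x)" "Ck1 (Suc k) f'"
    unfolding Ck1.simps(2)[of "Suc k"] by blast
  then show ?case using Suc.IH[OF f'(2)] by auto
qed

lemma Ck1_add: "Ck1 k f \<Longrightarrow> Ck1 k g \<Longrightarrow> Ck1 k (\<lambda>x. f x + g x)"
proof (induction k arbitrary: f g)
  case 0
  then show ?case by (auto intro: continuous_intros)
next
  case (Suc k)
  from Suc.prems obtain f' g' where "\<And>x. (f has_real_derivative f' x) (at x)" "Ck1 k f'"
    "\<And>x. (g has_real_derivative g' x) (at x)" "Ck1 k g'" by auto
  then show ?case
    using Suc.IH[of f' g'] by (auto intro!: exI[of _ "\<lambda>x. f' x + g' x"] derivative_intros)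
qed

lemma Ck1_mult: "Ck1 k f \<Longrightarrow> Ck1 k g \<Longrightarrow> Ck1 k (\<lambda>x. f x * g x)"
proof (induction k arbitrary: f g)
  case 0
  then show ?case by (auto intro: continuous_intros)
next
  case (Suc k)
  from Suc.prems obtain f' g' where d: "\<And>x. (f has_real_derivative f' x) (at x)" "Ck1 k f'"
    "\<And>x. (g has_real_derivative g' x) (at x)" "Ck1 k g'" by auto
  have "Ck1 k f" "Ck1 k g" using Suc.prems Ck1_Suc_imp by blast+
  then have "Ck1 k (\<lambda>x. f' x * g x + g' x * f x)"
    using Suc.IH d by (intro Ck1_add) auto
  then show ?case
    using d by (auto intro!: exI[of _ "\<lambda>x. f' x * g x + g' x * f x"] derivative_eq_intros)
qed

lemma Ck1_const: "Ck1 k (\<lambda>x. c)"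
proof (induction k arbitrary: c)
  case (Suc k)
  then show ?case by (auto intro!: exI[of _ "\<lambda>x. 0"])
qed auto

lemma Ck1_affine: "Ck1 k f \<Longrightarrow> Ck1 k (\<lambda>x. f (c * x + d))"
proof (induction k arbitrary: f)
  case 0
  then show ?case by (auto intro!: continuous_intros continuous_on_compose2[of UNIV f])
next
  case (Suc k)
  from Suc.prems obtain f' where d: "\<And>x. (f has_real_derivative f' x) (at x)" "Ck1 k f'" by auto
  have "((\<lambda>x. f (c * x + d)) has_real_derivative c * f' (c * x + d)) (at x)" for x
    by (rule DERIV_cong[OF DERIV_chain2[OF d(1)]]) (auto intro!: derivative_eq_intros)
  moreover have "Ck1 k (\<lambda>x. c * f' (c * x + d))"
    using Suc.IH[OF d(2)] by (intro Ck1_mult Ck1_const)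
  ultimately show ?case by (auto intro!: exI[of _ "\<lambda>x. c * f' (c * x + d)"])
qed

lemma smooth1_mult: "smooth1 f \<Longrightarrow> smooth1 g \<Longrightarrow> smooth1 (\<lambda>x. f x * g x)"
  and smooth1_add: "smooth1 f \<Longrightarrow> smooth1 g \<Longrightarrow> smooth1 (\<lambda>x. f x + g x)"
  and smooth1_const: "smooth1 (\<lambda>x. c)"
  and smooth1_affine: "smooth1 f \<Longrightarrow> smooth1 (\<lambda>x. f (c * x + d))"
  by (simp_all add: smooth1_def Ck1_mult Ck1_add Ck1_const Ck1_affine)

lemma smooth1_DERIV: "smooth1 f \<Longrightarrow> (f has_real_derivative deriv f x) (at x)"
proof -
  assume "smooth1 f"
  then have "Ck1 (Suc 0) f" by (simp only: smooth1_def)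
  then obtain f' where "\<And>x. (f has_real_derivative f' x) (at x)" by auto
  then show ?thesis by (metis DERIV_imp_deriv)
qed

lemma smooth1_deriv: "smooth1 f \<Longrightarrow> smooth1 (deriv f)"
  unfolding smooth1_def
proof
  fix k assume "\<forall>k. Ck1 k f"
  then have "Ck1 (Suc k) f" by blast
  then obtain f' where d: "\<And>x. (f has_real_derivative f' x) (at x)" "Ck1 k f'" by auto
  moreover have "deriv f = f'" using d by (auto intro: DERIV_imp_deriv)
  ultimately show "Ck1 k (deriv f)" by simp
qed

lemma smooth1_continuous: "smooth1 f \<Longrightarrow> continuous_on UNIV f"
  by (auto simp: smooth1_def dest: spec[of _ 0])

lemma smooth1_antideriv:
  assumes "\<And>x. (F has_real_derivative f x) (at x)" "smooth1 f" shows "smooth1 F"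
  unfolding smooth1_def
proof
  fix k
  have "Ck1 (Suc k) F" using assms by (auto simp: smooth1_def)
  then show "Ck1 k F" by (rule Ck1_Suc_imp)
qed

text \<open>The flat function exp(-1/x) with a polynomial in 1/x in front. The factor makes the
  family closed under differentiation, so that smoothness is a single induction over all
  \<open>P\<close>.\<close>

definition exp0 :: "real poly \<Rightarrow> real \<Rightarrow> real" where
  "exp0 P x = (if 0 < x then poly P (1 / x) * exp (- (1 / x)) else 0)"

lemma poly_exp_lim: "((\<lambda>y. poly P y * exp (- y)) \<longlongrightarrow> (0::real)) at_top"
proof -
  have "((\<lambda>y. \<Sum>i\<le>degree P. coeff P i * (y ^ i / exp y)) \<longlongrightarrow> (\<Sum>i\<le>degree P. coeff P i * 0)) (at_top :: real filter)"
    by (intro tendsto_intros tendsto_power_div_exp_0)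
  then show ?thesis
    by (simp add: poly_altdef sum_distrib_right exp_minus divide_inverse mult.assoc)
qed

lemma exp0_lim: "(exp0 P \<longlongrightarrow> 0) (at 0)"
proof -
  have "((\<lambda>x. poly P (1 / x) * exp (- (1 / x))) \<longlongrightarrow> (0::real)) (at_right 0)"
    using filterlim_compose[OF poly_exp_lim filterlim_inverse_at_top_right] by (simp add: divide_inverse)
  then have "(exp0 P \<longlongrightarrow> 0) (at_right 0)"
    by (rule Lim_transform_eventually) (auto simp: exp0_def eventually_at_right_less intro: eventually_mono[OF eventually_at_right_less])
  moreover have "(exp0 P \<longlongrightarrow> 0) (at_left 0)"
    by (rule Lim_transform_eventually[OF tendsto_const])
      (auto simp: exp0_def eventually_at_filter)
  ultimately show ?thesis by (simp add: filterlim_split_at)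
qed

text \<open>With y = 1/x, d/dx is -y^2 d/dy, and applied to P(y) exp(-y) this gives y^2 (P - P')(y)
  exp(-y).\<close>

lemma exp0_DERIV: "(exp0 P has_real_derivative exp0 ([:0,0,1:] * (P - pderiv P)) x) (at x)"
proof (cases x "0::real" rule: linorder_cases)
  case less
  have "((\<lambda>x. 0) has_real_derivative 0) (at x)" by simp
  then have "(exp0 P has_real_derivative 0) (at x)"
    by (rule has_field_derivative_transform_within_open[of _ _ _ "{..<0}"]) (use less in \<open>auto simp: exp0_def\<close>)
  then show ?thesis using less by (simp add: exp0_def)
next
  case greater
  have "((\<lambda>x. poly P (1 / x) * exp (- (1 / x))) has_real_derivative
     exp0 ([:0,0,1:] * (P - pderiv P)) x) (at x)"
    using greater
    by (auto intro!: derivative_eq_intros DERIV_chain2[OF poly_DERIV] simp: exp0_def field_simps power2_eq_square)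
  then show ?thesis
    by (rule has_field_derivative_transform_within_open[of _ _ _ "{0<..}"]) (use greater in \<open>auto simp: exp0_def\<close>)
next
  case equal
  \<comment> \<open>Dividing by h multiplies \<open>P\<close> by its variable 1/h, so the difference
    quotient at 0 is again a member of the family and \<open>exp0_lim\<close> applies to it.\<close>
  have "(\<lambda>h. exp0 P h / h) = exp0 ([:0,1:] * P)"
    by (auto simp: exp0_def)
  then have "((\<lambda>h. (exp0 P (0 + h) - exp0 P 0) / h) \<longlongrightarrow> 0) (at 0)"
    using exp0_lim[of "[:0,1:] * P"] by (simp add: exp0_def[of P 0])
  then show ?thesis using equal by (simp add: DERIV_def exp0_def[of _ 0])
qed

lemma smooth1_exp0: "smooth1 (exp0 P)"
proof -
  have "Ck1 k (exp0 P)" for k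
  proof (induction k arbitrary: P)
    case 0
    have "isCont (exp0 P) x" for x using exp0_DERIV[of P x] by (rule DERIV_isCont)
    then show ?case by (auto intro: continuous_at_imp_continuous_on)
  next
    case (Suc k)
    then show ?case using exp0_DERIV[of P] by auto
  qed
  then show ?thesis by (simp add: smooth1_def)
qed

text \<open>For x in (a, b) this is exp(-1/(n(x - a))) exp(-1/(n(b - x))). The parameter
  \<open>n\<close> steepens the flanks while the support stays fixed; as n grows the indicator of
  the open interval results.\<close>

definition bump :: "real \<Rightarrow> real \<Rightarrow> real \<Rightarrow> real \<Rightarrow> real" where
  "bump n a b x = exp0 1 (n * x + - n * a) * exp0 1 (- n * x + n * b)"

lemma smooth1_bump: "smooth1 (bump n a b)"
  unfolding bump_def by (intro smooth1_mult smooth1_affine smooth1_exp0)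

lemma bump_eq: "n > 0 \<Longrightarrow> bump n a b x =
   (if a < x \<and> x < b then exp (- (1 / (n * (x - a)))) * exp (- (1 / (n * (b - x)))) else 0)"
  by (auto simp: bump_def exp0_def algebra_simps)

lemma bump_bounds: "n > 0 \<Longrightarrow> 0 \<le> bump n a b x" "n > 0 \<Longrightarrow> bump n a b x \<le> 1"
  by (auto simp: bump_eq mult_le_one)

lemma bump_outside: "n > 0 \<Longrightarrow> x \<notin> {a<..<b} \<Longrightarrow> bump n a b x = 0"
  by (auto simp: bump_eq)

lemma bump_lim: "(\<lambda>n. bump (real (Suc n)) a b x) \<longlonglongrightarrow> indicator {a<..<b} x"
proof (cases "x \<in> {a<..<b}")
  case True
  have "(\<lambda>n. exp (- (inverse (real (Suc n)) * (1 / (x - a)))) * exp (- (inverse (real (Suc n)) * (1 / (b - x)))))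
    \<longlonglongrightarrow> exp (- (0 * (1 / (x - a)))) * exp (- (0 * (1 / (b - x))))"
    by (intro tendsto_intros LIMSEQ_inverse_real_of_nat)
  then show ?thesis using True by (simp add: bump_eq divide_inverse)
next
  case False
  then show ?thesis by (simp add: bump_outside)
qed

text \<open>The induction keeps both factors general: a partial derivative of a product is again a
  product, of one differentiated factor and one whose order is lowered by
  \<open>Ck1_Suc_imp\<close>.\<close>

lemma C_k_product: "Ck1 k a \<Longrightarrow> Ck1 k b \<Longrightarrow> C_k k (\<lambda>p. a (fst p) * b (snd p))"
proof (induction k arbitrary: a b)
  case 0
  then show ?case
    by (auto intro!: continuous_intros continuous_on_compose2[of UNIV a] continuous_on_compose2[of UNIV b])
next
  case (Suc k)
  from Suc.prems obtain a' b' where d: "\<And>x. (a has_real_derivative a' x) (at x)" "Ck1 k a'"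
    "\<And>x. (b has_real_derivative b' x) (at x)" "Ck1 k b'" by auto
  have k: "Ck1 k a" "Ck1 k b" using Suc.prems Ck1_Suc_imp by blast+
  have "((\<lambda>p. a (fst p) * b (snd p)) has_derivative
     (\<lambda>h. (a' (fst p) * b (snd p)) * fst h + (a (fst p) * b' (snd p)) * snd h)) (at p)" for p
  proof -
    have "((\<lambda>p. a (fst p)) has_derivative (\<lambda>h. a' (fst p) * fst h)) (at p)"
      by (rule has_derivative_compose[OF has_derivative_fst[OF has_derivative_ident] d(1)[unfolded has_field_derivative_def]])
    moreover have "((\<lambda>p. b (snd p)) has_derivative (\<lambda>h. b' (snd p) * snd h)) (at p)"
      by (rule has_derivative_compose[OF has_derivative_snd[OF has_derivative_ident] d(3)[unfolded has_field_derivative_def]])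
    ultimately have "((\<lambda>p. a (fst p) * b (snd p)) has_derivative
       (\<lambda>h. a (fst p) * (b' (snd p) * snd h) + (a' (fst p) * fst h) * b (snd p))) (at p)"
      by (rule has_derivative_mult)
    then show ?thesis by (simp add: algebra_simps)
  qed
  then show ?case
    unfolding C_k.simps(2) using Suc.IH[OF d(2) k(2)] Suc.IH[OF k(1) d(4)]
    by (intro exI[of _ "\<lambda>p. a' (fst p) * b (snd p)"] exI[of _ "\<lambda>p. a (fst p) * b' (snd p)"] conjI allI)
qed

text \<open>One factor of a product test function together with a named derivative. \<open>S\<close>
  is \<open>UNIV\<close> in space and \<open>{0<..}\<close> in time, where a compact interval keeps
  away from t = 0. The interval may be empty, which admits the zero function.\<close>

definition bump_fun :: "real set \<Rightarrow> (real \<Rightarrow> real) \<Rightarrow> (real \<Rightarrow> real) \<Rightarrow> bool" where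
  "bump_fun S a a' \<longleftrightarrow> smooth1 a \<and> (\<forall>x. (a has_real_derivative a' x) (at x)) \<and> (\<forall>x. 0 \<le> a x) \<and>
     (\<exists>l r. {l..r} \<subseteq> S \<and> (\<forall>x. x \<notin> {l..r} \<longrightarrow> a x = 0 \<and> a' x = 0))"

lemma bump_funI:
  assumes "smooth1 a" "\<And>x. (a has_real_derivative a' x) (at x)" "\<And>x. 0 \<le> a x" "{l..r} \<subseteq> S"
    "\<And>x. x \<notin> {l..r} \<Longrightarrow> a x = 0" "\<And>x. x \<notin> {l..r} \<Longrightarrow> a' x = 0"
  shows "bump_fun S a a'"
  using assms unfolding bump_fun_def by blast

text \<open>The support is contained in a product of two compact intervals, the second of which lies
  in the positive times.\<close>

lemma test_function_product:
  assumes "bump_fun UNIV a a'" "bump_fun {0<..} b b'"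
  shows "test_function (\<lambda>p. a (fst p) * b (snd p))"
proof -
  obtain l r where lr: "\<And>x. x \<notin> {l..r} \<Longrightarrow> a x = 0" using assms(1) unfolding bump_fun_def by meson
  obtain l' r' where lr': "{l'..r'} \<subseteq> {0<..}" "\<And>x. x \<notin> {l'..r'} \<Longrightarrow> b x = 0"
    using assms(2) unfolding bump_fun_def by meson
  let ?S = "{p. a (fst p) * b (snd p) \<noteq> 0}"
  have "?S \<subseteq> {l..r} \<times> {l'..r'}" using lr(1) lr'(2) by force
  then have sub: "closure ?S \<subseteq> {l..r} \<times> {l'..r'}"
    by (intro closure_minimal closed_Times) auto
  moreover have "compact ({l..r} \<times> {l'..r'})" by (intro compact_Times) auto
  ultimately have "compact (closure ?S)"
    by (meson closed_closure compact_Int_closed inf.absorb_iff2 compact_closure bounded_subset closure_subset compact_imp_bounded order_trans)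
  moreover have "closure ?S \<subseteq> half_plane"
    using sub lr'(1) by (fastforce simp: half_plane_def)
  moreover have "C_k k (\<lambda>p. a (fst p) * b (snd p))" for k
    using assms by (intro C_k_product) (auto simp: bump_fun_def smooth1_def)
  ultimately show ?thesis by (simp add: test_function_def)
qed


text \<open>Starting at \<open>a - 1\<close>, strictly left of the support, makes every x \<ge> a an
  interior point of the interval used in \<open>bump_int_DERIV\<close>; for x < a - 1 the integral
  runs over an empty set and is 0.\<close>

definition bump_int :: "real \<Rightarrow> real \<Rightarrow> real \<Rightarrow> real \<Rightarrow> real" where
  "bump_int n a b x = integral {a - 1..x} (bump n a b)"

lemma bump_integrable: "bump n a b integrable_on {c..x}"
  by (intro integrable_continuous_interval continuous_on_subset[OF smooth1_continuous[OF smooth1_bump]]) auto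

lemma bump_int_left: "n > 0 \<Longrightarrow> x \<le> a \<Longrightarrow> bump_int n a b x = 0"
  unfolding bump_int_def by (subst integral_cong[where g="\<lambda>_. 0"]) (auto simp: bump_outside)

lemma bump_int_right: assumes "n > 0" "a \<le> b" "b \<le> x" shows "bump_int n a b x = bump_int n a b b"
proof -
  have "bump_int n a b x = bump_int n a b b + integral {b..x} (bump n a b)"
    unfolding bump_int_def by (rule Henstock_Kurzweil_Integration.integral_combine[symmetric, OF _ _ bump_integrable]) (use assms in auto)
  moreover have "integral {b..x} (bump n a b) = 0"
    using assms by (subst integral_cong[where g="\<lambda>_. 0"]) (auto simp: bump_outside)
  ultimately show ?thesis by linarith
qed

lemma bump_int_DERIV: assumes "n > 0" shows "(bump_int n a b has_real_derivative bump n a b x) (at x)"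
proof (cases "x < a")
  case True
  have "((\<lambda>x. 0) has_real_derivative 0) (at x)" by simp
  then have "(bump_int n a b has_real_derivative 0) (at x)"
    by (rule has_field_derivative_transform_within_open[of _ _ _ "{..<a}"]) (use True assms in \<open>auto simp: bump_int_left\<close>)
  then show ?thesis using True assms by (simp add: bump_outside)
next
  case False
  then have "((\<lambda>x. integral {a - 1..x} (bump n a b)) has_real_derivative bump n a b x) (at x within {a - 1..x + 1})"
    by (intro integral_has_real_derivative continuous_on_subset[OF smooth1_continuous[OF smooth1_bump]]) auto
  moreover have "x \<in> interior {a - 1..x + 1}" using False by (simp add: interior_atLeastAtMost_real)
  ultimately have "((\<lambda>x. integral {a - 1..x} (bump n a b)) has_real_derivative bump n a b x) (at x)"
    by (metis at_within_interior)
  moreover have "bump_int n a b = (\<lambda>x. integral {a - 1..x} (bump n a b))" by (rule ext) (rule bump_int_def)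
  ultimately show ?thesis by (simp only:)
qed

lemma bump_int_mono: assumes "n > 0" "x \<le> y" shows "bump_int n a b x \<le> bump_int n a b y"
  by (rule DERIV_nonneg_imp_nondecreasing[OF assms(2)])
    (intro exI conjI, rule bump_int_DERIV[OF assms(1)], rule bump_bounds(1)[OF assms(1)])

lemma bump_int_nonneg: assumes "n > 0" shows "0 \<le> bump_int n a b x"
  unfolding bump_int_def using assms by (intro integral_nonneg bump_integrable bump_bounds)

lemma bump_int_le: assumes "n > 0" "a \<le> b" shows "bump_int n a b x \<le> b - a"
proof -
  have "bump_int n a b x \<le> bump_int n a b b"
    using assms bump_int_mono[of n x b a b] bump_int_right[of n a b x] by linarith
  also have "bump_int n a b b = bump_int n a b a + integral {a..b} (bump n a b)"
    unfolding bump_int_def by (rule Henstock_Kurzweil_Integration.integral_combine[symmetric, OF _ _ bump_integrable]) (use assms in auto)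
  also have "integral {a..b} (bump n a b) \<le> integral {a..b} (\<lambda>_. 1)"
    using assms by (intro integral_le bump_integrable bump_bounds) auto
  finally show ?thesis using assms by (simp add: bump_int_left)
qed

definition ramp :: "real \<Rightarrow> real \<Rightarrow> real \<Rightarrow> real" where
  "ramp a b x = max 0 (min x b - a)"

text \<open>Dominated convergence with majorant 1: the bumps tend to the indicator of (a, b), whose
  integral is the ramp.\<close>

lemma bump_int_lim: assumes "a \<le> b" shows "(\<lambda>n. bump_int (real (Suc n)) a b x) \<longlonglongrightarrow> ramp a b x"
proof -
  have "(\<lambda>n. bump_int (real (Suc n)) a b x) \<longlonglongrightarrow> integral {a-1..x} (indicator {a<..<b})"
    unfolding bump_int_def
  proof (rule dominated_convergence(2)[where h="\<lambda>_. 1"])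
    show "norm (bump (real (Suc k)) a b t) \<le> 1" for k t
      using bump_bounds[of "real (Suc k)" a b t] by simp
  qed (use bump_lim[of a b] in \<open>auto intro: bump_integrable\<close>)
  also have "integral {a-1..x} (indicator {a<..<b}) = integral {a-1..x} (indicat_real {a..b})"
    by (rule integral_spike[of "{a,b}"]) (auto simp: indicator_def)
  also have "\<dots> = integral ({a..b} \<inter> {a-1..x}) (\<lambda>_. 1 :: real)"
    unfolding integral_restrict_Int[symmetric] by (rule integral_cong) (auto simp: indicator_def)
  also have "{a..b} \<inter> {a-1..x} = {a..min x b}" by auto
  also have "integral {a..min x b} (\<lambda>_. 1 :: real) = ramp a b x"
    using assms by (auto simp: ramp_def max_def min_def)
  finally show ?thesis .
qed

text \<open>A smoothed ramp minus its translate by \<open>d\<close> rises over [s, s + h] and falls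
  back over [s + d, s + h + d]. Monotonicity of \<open>bump_int\<close> gives the sign; to the right
  of the support both ramps have reached the same total and cancel.\<close>

lemma bump_fun_trapezoid:
  assumes "n > 0" "h > 0" "d > 0" "{s..s+h+d} \<subseteq> S"
  shows "bump_fun S (\<lambda>x. bump_int n s (s+h) x - bump_int n s (s+h) (x - d))
    (\<lambda>x. bump n s (s+h) x - bump n s (s+h) (x - d))"
proof -
  have D: "((\<lambda>x. bump_int n s (s+h) x - bump_int n s (s+h) (x - d)) has_real_derivative
     bump n s (s+h) x - bump n s (s+h) (x - d)) (at x)" for x
  proof -
    have "((\<lambda>x. x - d) has_real_derivative 1) (at x)" by (auto intro!: derivative_eq_intros)
    from DERIV_diff[OF bump_int_DERIV[OF assms(1)] DERIV_chain2[OF bump_int_DERIV[OF assms(1)] this]]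
    show ?thesis by simp
  qed
  have "smooth1 (\<lambda>x. bump n s (s+h) x + (-1) * bump n s (s+h) (1 * x + - d))"
    by (intro smooth1_add smooth1_mult smooth1_const smooth1_affine smooth1_bump)
  then have sm: "smooth1 (\<lambda>x. bump n s (s+h) x - bump n s (s+h) (x - d))" by simp
  show ?thesis
  proof (rule bump_funI[where l=s and r="s+h+d"])
    show "smooth1 (\<lambda>x. bump_int n s (s+h) x - bump_int n s (s+h) (x - d))"
      by (rule smooth1_antideriv[OF D sm])
    show "0 \<le> bump_int n s (s+h) x - bump_int n s (s+h) (x - d)" for x
      using bump_int_mono[of n "x - d" x] assms by simp
    show "bump_int n s (s+h) x - bump_int n s (s+h) (x - d) = 0" if "x \<notin> {s..s+h+d}" for x
    proof (cases "x < s")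
      case True
      then show ?thesis using assms by (simp add: bump_int_left)
    next
      case False
      then show ?thesis
        using that assms bump_int_right[of n s "s+h" x] bump_int_right[of n s "s+h" "x - d"] by simp
    qed
    show "bump n s (s+h) x - bump n s (s+h) (x - d) = 0" if "x \<notin> {s..s+h+d}" for x
      using that assms by (auto simp: bump_outside)
  qed (rule D, rule assms(4))
qed

section \<open>Kruzhkov inequalities\<close>

definition burgers_entropy_solution :: "(real \<Rightarrow> real \<Rightarrow> real) \<Rightarrow> bool" where
  "burgers_entropy_solution w \<longleftrightarrow>
    (\<forall>\<psi> \<phi>. convex_on UNIV \<psi> \<longrightarrow> C2 \<psi> \<longrightarrow> (\<forall>v. (\<phi> has_real_derivative v * deriv \<psi> v) (at v)) \<longrightarrow>
      distr_le_zero (\<lambda>x t. \<psi> (w x t)) (\<lambda>x t. \<phi> (w x t)))"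

text \<open>\<open>ess_bounded\<close> provides only a Lebesgue measurable function that is bounded
  almost everywhere, and its values below the half-plane are arbitrary. A Borel representative
  bounded everywhere fits product sigma-algebras and allows pointwise estimates.\<close>

definition borel_version :: "(real \<Rightarrow> real \<Rightarrow> real) \<Rightarrow> real \<Rightarrow> (real \<times> real \<Rightarrow> real) \<Rightarrow> bool" where
  "borel_version w K g \<longleftrightarrow> g \<in> borel_measurable borel \<and> (\<forall>p. \<bar>g p\<bar> \<le> K) \<and>
     (AE p in lborel. p \<in> half_plane \<longrightarrow> g p = w (fst p) (snd p))"

lemma half_plane_borel [measurable]: "half_plane \<in> sets borel"
  unfolding half_plane_def by (intro borel_open open_Times) auto

lemma AE_lebesgue_on_iff:
  fixes S :: "'a::euclidean_space set"
  assumes "S \<in> sets borel"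
  shows "(AE p in lebesgue_on S. P p) \<longleftrightarrow> (AE p in lborel. p \<in> S \<longrightarrow> P p)"
  using assms by (subst AE_restrict_space_iff) (auto simp: AE_completion_iff)

lemma borel_version_exists:
  assumes "ess_bounded (lebesgue_on half_plane) (\<lambda>(x, t). w x t)"
  shows "\<exists>K g. borel_version w K g"
proof -
  let ?f = "\<lambda>p. w (fst p) (snd p)"
  from assms obtain C where f: "?f \<in> borel_measurable (lebesgue_on half_plane)"
    and C: "AE p in lebesgue_on half_plane. \<bar>?f p\<bar> \<le> C"
    by (auto simp: ess_bounded_def case_prod_unfold)
  have "(\<lambda>p. if p \<in> half_plane then ?f p else 0) \<in> borel_measurable lebesgue"
    using f by (subst borel_measurable_if_I) (auto intro: borel_measurable_if_I)
  then obtain g where g: "g \<in> borel_measurable lborel"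
    "AE p in lborel. (if p \<in> half_plane then ?f p else 0) = g p"
    using completion_ex_borel_measurable_real by blast
  have [measurable]: "g \<in> borel_measurable borel" using g by simp
  \<comment> \<open>Clipping at the essential bound changes \<open>g\<close> only on a null set of
    the half-plane and makes the bound hold everywhere.\<close>
  have "AE p in lborel. p \<in> half_plane \<longrightarrow> max (- \<bar>C\<bar>) (min \<bar>C\<bar> (g p)) = ?f p"
    using g(2) C[unfolded AE_lebesgue_on_iff[OF half_plane_borel]]
    by eventually_elim (auto split: if_splits)
  then have "borel_version w \<bar>C\<bar> (\<lambda>p. max (- \<bar>C\<bar>) (min \<bar>C\<bar> (g p)))"
    unfolding borel_version_def by auto
  then show ?thesis by blast
qed

lemma borel_version_mono: "borel_version w K g \<Longrightarrow> K \<le> L \<Longrightarrow> borel_version w L g"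
  unfolding borel_version_def by (blast intro: order_trans)

lemma integrable_box:
  fixes f :: "'a::euclidean_space \<Rightarrow> real"
  assumes "f \<in> borel_measurable borel" "\<And>p. \<bar>f p\<bar> \<le> C" "bounded S" "\<And>p. p \<notin> S \<Longrightarrow> f p = 0"
  shows "integrable lborel f"
proof -
  obtain a where a: "S \<subseteq> cbox (-a) a"
    using bounded_subset_cbox_symmetric[OF assms(3)] by blast
  show ?thesis
    by (rule integrableI_bounded_set[where A="cbox (-a) a" and B=C])
      (use assms a in \<open>auto simp: emeasure_lborel_cbox_eq\<close>)
qed

text \<open>This is sgn(v - k)(v^2 - k^2)/2, the flux that belongs to the Kruzhkov entropy |v - k|
  of the Burgers equation. In this form its symmetry and its vanishing at v = k are visible.\<close>

definition kflux :: "real \<Rightarrow> real \<Rightarrow> real" where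
  "kflux v k = \<bar>v - k\<bar> * (v + k) / 2"

text \<open>The Kruzhkov entropy |v - k| is not \<open>C2\<close>. For e > 0 this hyperbola is, and
  it lies between |v - k| and |v - k| + e.\<close>

definition kpsi :: "real \<Rightarrow> real \<Rightarrow> real \<Rightarrow> real" where
  "kpsi e k v = sqrt ((v - k)\<^sup>2 + e\<^sup>2)"

text \<open>An antiderivative of v times the derivative of \<open>kpsi\<close>. With s = v - k, the
  part with factor k integrates to k \<open>kpsi\<close>, and s^2/sqrt(s^2 + e^2) integrates to the
  half bracket with \<open>arsinh\<close>. The constant of integration is such that the limit for e
  to 0 is exactly \<open>kflux\<close>.\<close>

definition kphi :: "real \<Rightarrow> real \<Rightarrow> real \<Rightarrow> real" where
  "kphi e k v = k * kpsi e k v + ((v - k) * kpsi e k v - e\<^sup>2 * arsinh ((v - k) / e)) / 2"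

lemma kpsi_pos: "e > 0 \<Longrightarrow> kpsi e k v > 0"
  unfolding kpsi_def by (simp add: add_nonneg_pos)

lemma kpsi_sq: "(kpsi e k v)\<^sup>2 = (v - k)\<^sup>2 + e\<^sup>2"
  unfolding kpsi_def by (simp add: add_nonneg_nonneg)

lemma kpsi_DERIV: assumes "e > 0" shows "(kpsi e k has_real_derivative (v - k) / kpsi e k v) (at v)"
proof -
  have "(v - k)\<^sup>2 + e\<^sup>2 > 0" using assms by (simp add: add_nonneg_pos)
  then show ?thesis unfolding kpsi_def by (auto intro!: derivative_eq_intros simp: divide_simps)
qed

lemma kpsi_DERIV2: assumes "e > 0"
  shows "((\<lambda>v. (v - k) / kpsi e k v) has_real_derivative e\<^sup>2 / (kpsi e k v) ^ 3) (at v)"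
proof -
  have p: "kpsi e k v > 0" using assms by (rule kpsi_pos)
  have "((\<lambda>v. (v - k) / kpsi e k v) has_real_derivative
     (1 * kpsi e k v - (v - k) * ((v - k) / kpsi e k v)) / (kpsi e k v * kpsi e k v)) (at v)"
    using p by (intro DERIV_divide kpsi_DERIV assms) (auto intro!: derivative_eq_intros)
  also have "(1 * kpsi e k v - (v - k) * ((v - k) / kpsi e k v)) / (kpsi e k v * kpsi e k v)
     = ((kpsi e k v)\<^sup>2 - (v - k)\<^sup>2) / (kpsi e k v) ^ 3"
    using p by (simp add: field_simps power2_eq_square power3_eq_cube)
  finally show ?thesis by (simp add: kpsi_sq)
qed

lemma kpsi_C2: assumes "e > 0" shows "C2 (kpsi e k)"
  unfolding C2_def
proof (intro exI conjI allI)
  show "continuous_on UNIV (\<lambda>v. e\<^sup>2 / (kpsi e k v) ^ 3)"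
  proof (intro continuous_intros ballI)
    show "continuous_on UNIV (kpsi e k)"
      using kpsi_DERIV[OF assms] DERIV_isCont by (blast intro: continuous_at_imp_continuous_on)
    show "kpsi e k v ^ 3 \<noteq> 0" for v using kpsi_pos[OF assms, of k v] by simp
  qed
qed (rule kpsi_DERIV kpsi_DERIV2 assms)+

lemma kpsi_convex: assumes "e > 0" shows "convex_on UNIV (kpsi e k)"
  by (rule f''_ge0_imp_convex[OF convex_UNIV kpsi_DERIV[OF assms] kpsi_DERIV2[OF assms]])
    (use kpsi_pos[OF assms] in \<open>simp add: less_imp_le\<close>)

lemma kphi_DERIV: assumes "e > 0"
  shows "(kphi e k has_real_derivative v * deriv (kpsi e k) v) (at v)"
proof -
  define P where "P = kpsi e k v"
  have P: "P > 0" "P * P = (v - k)\<^sup>2 + e\<^sup>2"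
    using kpsi_pos[OF assms] kpsi_sq[of e k v] by (auto simp: P_def power2_eq_square)
  have s: "sqrt (((v - k) / e)\<^sup>2 + 1) = P / e"
  proof -
    have "((v - k) / e)\<^sup>2 + 1 = ((v - k)\<^sup>2 + e\<^sup>2) / e\<^sup>2" using assms by (simp add: field_simps)
    then show ?thesis using assms by (simp add: real_sqrt_divide P_def kpsi_def)
  qed
  have A: "((\<lambda>v. arsinh ((v - k) / e)) has_real_derivative (1 / P)) (at v)"
    by (rule DERIV_cong[OF DERIV_chain2[OF arsinh_real_has_field_derivative, where Db="1 / e"]])
      (use assms P in \<open>auto intro!: derivative_eq_intros simp: s\<close>)
  have "(kphi e k has_real_derivative
     k * ((v - k) / P) + (P + (v - k) * ((v - k) / P) - e\<^sup>2 * (1 / P)) / 2) (at v)"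
    unfolding kphi_def[abs_def]
    by (rule DERIV_cong, (rule derivative_intros kpsi_DERIV[OF assms] A)+, simp)
      (use P(1) in \<open>simp add: P_def[symmetric] field_simps\<close>)
  also have "k * ((v - k) / P) + (P + (v - k) * ((v - k) / P) - e\<^sup>2 * (1 / P)) / 2 =
     (2 * k * (v - k) + (P * P + (v - k)\<^sup>2 - e\<^sup>2)) / (2 * P)"
    using P(1) by (simp add: field_simps power2_eq_square)
  also have "\<dots> = v * ((v - k) / P)" unfolding P(2) using P(1) by (simp add: field_simps power2_eq_square)
  also have "(v - k) / P = deriv (kpsi e k) v" using DERIV_imp_deriv[OF kpsi_DERIV[OF assms, of k v]] by (simp add: P_def)
  finally show ?thesis .
qed

text \<open>The derivative of \<open>arsinh\<close> lies between 0 and 1. This bounds the last term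
  of \<open>kphi\<close>, e^2 arsinh((v - k)/e), by e |v - k|, which vanishes with e.\<close>

lemma abs_arsinh_le: "\<bar>arsinh x\<bar> \<le> \<bar>x::real\<bar>"
proof -
  have D: "((\<lambda>x. x - arsinh x) has_real_derivative 1 - 1 / sqrt (x\<^sup>2 + 1)) (at x)" for x :: real
    by (auto intro!: derivative_eq_intros simp: divide_inverse)
  have mono: "x - arsinh x \<le> y - arsinh y" if "x \<le> y" for x y :: real
  proof (rule DERIV_nonneg_imp_nondecreasing[OF that, of "\<lambda>x. x - arsinh x"], intro exI conjI)
    show "0 \<le> 1 - 1 / sqrt (x\<^sup>2 + 1)" for x :: real
    proof -
      have "1 \<le> sqrt (x\<^sup>2 + 1)" by simp
      then have "1 / sqrt (x\<^sup>2 + 1) \<le> 1 / 1" by (intro divide_left_mono) (auto intro: add_nonneg_pos)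
      then show ?thesis by linarith
    qed
  qed (rule D)
  have inc: "arsinh x \<le> arsinh y" if "x \<le> y" for x y :: real
    by (rule DERIV_nonneg_imp_nondecreasing[OF that], rule exI, rule conjI,
        rule arsinh_real_has_field_derivative) simp
  show ?thesis using mono[of 0 x] mono[of x 0] inc[of 0 x] inc[of x 0] by (cases "x \<ge> 0") auto
qed

lemma kpsi_lim: "(\<lambda>n. kpsi (1 / real (Suc n)) k v) \<longlonglongrightarrow> \<bar>v - k\<bar>"
proof -
  have "(\<lambda>n. sqrt ((v - k)\<^sup>2 + (inverse (real (Suc n)))\<^sup>2)) \<longlonglongrightarrow> sqrt ((v - k)\<^sup>2 + 0\<^sup>2)"
    by (intro tendsto_intros LIMSEQ_inverse_real_of_nat)
  then show ?thesis by (simp add: kpsi_def divide_inverse)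
qed

lemma kphi_lim: "(\<lambda>n. kphi (1 / real (Suc n)) k v) \<longlonglongrightarrow> kflux v k"
proof -
  let ?e = "\<lambda>n. 1 / real (Suc n)"
  have e0: "?e \<longlonglongrightarrow> 0" using LIMSEQ_inverse_real_of_nat by (simp add: divide_inverse)
  have "(\<lambda>n. (?e n)\<^sup>2 * arsinh ((v - k) / ?e n)) \<longlonglongrightarrow> 0"
  proof (rule Lim_null_comparison)
    show "\<forall>\<^sub>F n in sequentially. norm ((?e n)\<^sup>2 * arsinh ((v - k) / ?e n)) \<le> ?e n * \<bar>v - k\<bar>"
    proof (intro always_eventually allI)
      fix n
      have "norm ((?e n)\<^sup>2 * arsinh ((v - k) / ?e n)) \<le> (?e n)\<^sup>2 * \<bar>(v - k) / ?e n\<bar>"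
        unfolding real_norm_def abs_mult by (intro mult_mono abs_arsinh_le) auto
      also have "\<dots> = ?e n * \<bar>v - k\<bar>" by (simp add: power2_eq_square abs_mult)
      finally show "norm ((?e n)\<^sup>2 * arsinh ((v - k) / ?e n)) \<le> ?e n * \<bar>v - k\<bar>" .
    qed
    show "(\<lambda>n. ?e n * \<bar>v - k\<bar>) \<longlonglongrightarrow> 0" using tendsto_mult_left_zero[OF e0] .
  qed
  then have "(\<lambda>n. kphi (?e n) k v) \<longlonglongrightarrow> k * \<bar>v - k\<bar> + ((v - k) * \<bar>v - k\<bar> - 0) / 2"
    unfolding kphi_def by (intro tendsto_intros kpsi_lim) auto
  then show ?thesis by (simp add: kflux_def algebra_simps add_divide_distrib diff_divide_distrib)
qed

lemma kpsi_bound: assumes "0 < e" "e \<le> 1" "\<bar>v\<bar> \<le> K" shows "\<bar>kpsi e k v\<bar> \<le> K + \<bar>k\<bar> + 1"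
proof -
  have "kpsi e k v \<le> \<bar>v - k\<bar> + \<bar>e\<bar>"
    unfolding kpsi_def by (rule real_sqrt_sum_squares_triangle_ineq[of "v - k" 0 0 e, simplified])
  then show ?thesis using assms kpsi_pos[of e k v] by linarith
qed

text \<open>All of k, v - k, e and \<open>kpsi e k v\<close> are at most L = K + |k| + 1 in absolute
  value, so each of the three terms is at most L^2. The bound is uniform in e, as dominated
  convergence requires.\<close>

lemma kphi_bound: assumes "0 < e" "e \<le> 1" "\<bar>v\<bar> \<le> K" shows "\<bar>kphi e k v\<bar> \<le> 2 * (K + \<bar>k\<bar> + 1)\<^sup>2"
proof -
  define L where "L = K + \<bar>k\<bar> + 1"
  have L: "L \<ge> 0" "\<bar>k\<bar> \<le> L" "\<bar>v - k\<bar> \<le> L" "e \<le> L" "\<bar>kpsi e k v\<bar> \<le> L"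
    using assms kpsi_bound[OF assms, of k] by (auto simp: L_def)
  have "e\<^sup>2 * \<bar>arsinh ((v - k) / e)\<bar> \<le> e\<^sup>2 * \<bar>(v - k) / e\<bar>"
    by (intro mult_left_mono abs_arsinh_le) auto
  also have "\<dots> = e * \<bar>v - k\<bar>" using assms by (simp add: power2_eq_square)
  also have "\<dots> \<le> L * L" using L assms by (intro mult_mono) auto
  finally have 1: "\<bar>e\<^sup>2 * arsinh ((v - k) / e)\<bar> \<le> L * L" by (simp add: abs_mult)
  have 2: "\<bar>k * kpsi e k v\<bar> \<le> L * L" "\<bar>(v - k) * kpsi e k v\<bar> \<le> L * L"
    unfolding abs_mult using L by (auto intro!: mult_mono)
  have *: "\<bar>x + (y - z) / 2\<bar> \<le> 2 * M" if "\<bar>x\<bar> \<le> M" "\<bar>y\<bar> \<le> M" "\<bar>z\<bar> \<le> M" for x y z M :: real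
    using that by (auto simp: abs_le_iff field_simps)
  have "\<bar>kphi e k v\<bar> \<le> 2 * (L * L)" unfolding kphi_def by (rule *[OF 2 1])
  then show ?thesis by (simp add: L_def power2_eq_square)
qed

section \<open>Entropy inequalities tested with products\<close>

lemma bump_fun_bounded:
  assumes "bump_fun S a a'"
  shows "\<exists>C. (\<forall>x. \<bar>a x\<bar> \<le> C) \<and> (\<forall>x. \<bar>a' x\<bar> \<le> C)" "continuous_on UNIV a" "continuous_on UNIV a'"
proof -
  obtain l r where lr: "\<And>x. x \<notin> {l..r} \<Longrightarrow> a x = 0 \<and> a' x = 0"
    and a: "smooth1 a" "\<And>x. (a has_real_derivative a' x) (at x)"
    using assms unfolding bump_fun_def by meson
  have eq: "a' = deriv a" using DERIV_imp_deriv[OF a(2)] by (simp add: fun_eq_iff)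
  show c: "continuous_on UNIV a" "continuous_on UNIV a'"
    using a(1) unfolding eq by (auto intro: smooth1_continuous smooth1_deriv)
  have "\<exists>C. \<forall>x. \<bar>f x\<bar> \<le> C" if "continuous_on UNIV f" "\<And>x. x \<notin> {l..r} \<Longrightarrow> f x = 0" for f :: "real \<Rightarrow> real"
  proof -
    have "compact (f ` {l..r})" using that by (intro compact_continuous_image) (auto intro: continuous_on_subset)
    then obtain B where B: "\<forall>y\<in>f ` {l..r}. norm y \<le> B" by (meson bounded_iff compact_imp_bounded)
    have "\<bar>f x\<bar> \<le> max 0 B" for x using B that(2)[of x] by (cases "x \<in> {l..r}") (auto simp: max_def)
    then show ?thesis by blast
  qed
  from this[OF c(1)] this[OF c(2)] lr obtain C C' where "\<forall>x. \<bar>a x\<bar> \<le> C" "\<forall>x. \<bar>a' x\<bar> \<le> C'" by blast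
  then show "\<exists>C. (\<forall>x. \<bar>a x\<bar> \<le> C) \<and> (\<forall>x. \<bar>a' x\<bar> \<le> C)"
    by (intro exI[of _ "max C C'"]) (auto intro: max.coboundedI1 max.coboundedI2)
qed

text \<open>Transfers the inequality from \<open>w\<close> on the half-plane to its Borel
  representative on the whole plane, where Fubini's theorem is convenient. Nothing is added, because
  \<open>b\<close> and \<open>b'\<close> vanish for t \<le> 0.\<close>

lemma entropy_inequality_product:
  assumes w: "burgers_entropy_solution w" "ess_bounded (lebesgue_on half_plane) (\<lambda>(x, t). w x t)"
    and g: "borel_version w K g"
    and a: "bump_fun UNIV a a'" and b: "bump_fun {0<..} b b'"
    and \<psi>: "convex_on UNIV \<psi>" "C2 \<psi>" "\<And>v. (\<phi> has_real_derivative v * deriv \<psi> v) (at v)"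
  shows "0 \<le> (\<integral>p. \<psi> (g p) * (a (fst p) * b' (snd p)) + \<phi> (g p) * (a' (fst p) * b (snd p)) \<partial>lborel)"
proof -
  let ?f = "\<lambda>p. w (fst p) (snd p)"
  let ?\<theta> = "\<lambda>p. a (fst p) * b (snd p)"
  let ?h = "\<lambda>p. \<psi> (g p) * (a (fst p) * b' (snd p)) + \<phi> (g p) * (a' (fst p) * b (snd p))"
  have f[measurable]: "?f \<in> borel_measurable (lebesgue_on half_plane)"
    using w(2) by (auto simp: ess_bounded_def case_prod_unfold)
  have g'[measurable]: "g \<in> borel_measurable (borel \<Otimes>\<^sub>M borel)" using g by (simp add: borel_version_def borel_prod)
  have cont: "continuous_on UNIV \<psi>" "continuous_on UNIV \<phi>"
    using \<psi>(2,3) unfolding C2_def by (blast intro: continuous_at_imp_continuous_on DERIV_isCont)+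
  note [measurable] = borel_measurable_continuous_onI[OF cont(1)] borel_measurable_continuous_onI[OF cont(2)]
    borel_measurable_continuous_onI[OF bump_fun_bounded(2)[OF a]] borel_measurable_continuous_onI[OF bump_fun_bounded(3)[OF a]]
    borel_measurable_continuous_onI[OF bump_fun_bounded(2)[OF b]] borel_measurable_continuous_onI[OF bump_fun_bounded(3)[OF b]]
  have d: "deriv (\<lambda>s. a x * b s) t = a x * b' t" "deriv (\<lambda>y. a y * b t) x = a' x * b t" for x t
    using a b by (auto simp: bump_fun_def intro!: DERIV_imp_deriv derivative_eq_intros)
  have h: "?h \<in> borel_measurable borel" unfolding borel_prod[symmetric] by measurable
  have "0 \<le> (\<integral>p. \<psi> (?f p) * (a (fst p) * b' (snd p)) + \<phi> (?f p) * (a' (fst p) * b (snd p)) \<partial>lebesgue_on half_plane)"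
  proof -
    have "distr_le_zero (\<lambda>x t. \<psi> (w x t)) (\<lambda>x t. \<phi> (w x t))"
      using w(1) \<psi> by (simp add: burgers_entropy_solution_def)
    moreover have "\<forall>p. 0 \<le> ?\<theta> p" using a b by (simp add: bump_fun_def)
    ultimately show ?thesis
      using test_function_product[OF a b] unfolding distr_le_zero_def
      by (fastforce simp: d case_prod_unfold)
  qed
  also have "\<dots> = (\<integral>p. ?h p \<partial>lebesgue_on half_plane)"
  proof (rule integral_cong_AE)
    show "AE p in lebesgue_on half_plane. \<psi> (?f p) * (a (fst p) * b' (snd p)) + \<phi> (?f p) * (a' (fst p) * b (snd p)) = ?h p"
      using g unfolding AE_lebesgue_on_iff[OF half_plane_borel] borel_version_def
      by (auto elim: eventually_mono)
    have *: "borel_measurable borel \<subseteq> borel_measurable (lebesgue_on half_plane)"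
      by (intro subsetI measurable_restrict_space1 measurable_completion) simp
    show "?h \<in> borel_measurable (lebesgue_on half_plane)" using h * by blast
    have "(\<lambda>p. a (fst p) * b' (snd p)) \<in> borel_measurable borel"
      "(\<lambda>p. a' (fst p) * b (snd p)) \<in> borel_measurable borel"
      unfolding borel_prod[symmetric] by measurable
    then have m: "(\<lambda>p. a (fst p) * b' (snd p)) \<in> borel_measurable (lebesgue_on half_plane)"
      "(\<lambda>p. a' (fst p) * b (snd p)) \<in> borel_measurable (lebesgue_on half_plane)"
      using * by blast+
    show "(\<lambda>p. \<psi> (?f p) * (a (fst p) * b' (snd p)) + \<phi> (?f p) * (a' (fst p) * b (snd p)))
       \<in> borel_measurable (lebesgue_on half_plane)"
      by (rule borel_measurable_add[OF borel_measurable_times[OF measurable_compose[OF f] m(1)]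
            borel_measurable_times[OF measurable_compose[OF f] m(2)]])
        (auto intro: borel_measurable_continuous_onI cont)
  qed
  also have "\<dots> = (\<integral>p. indicator half_plane p *\<^sub>R ?h p \<partial>lebesgue)"
    by (rule integral_restrict_space) auto
  also have "(\<lambda>p. indicator half_plane p *\<^sub>R ?h p) = ?h"
  proof
    fix p
    have "b (snd p) = 0 \<and> b' (snd p) = 0" if "p \<notin> half_plane"
      using b that unfolding bump_fun_def half_plane_def by (cases p) (force simp: subset_iff)
    then show "indicator half_plane p *\<^sub>R ?h p = ?h p" by (auto simp: indicator_def)
  qed
  also have "integral\<^sup>L lebesgue ?h = integral\<^sup>L lborel ?h"
    using h by (intro integral_completion) auto
  finally show ?thesis .
qed

lemma bump_fun_bounded_support:
  assumes "bump_fun S a a'" "bump_fun T b b'"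
  obtains B where "bounded B" "B \<in> sets borel" "\<And>p. p \<notin> B \<Longrightarrow> a (fst p) = 0 \<and> a' (fst p) = 0 \<or> b (snd p) = 0 \<and> b' (snd p) = 0"
proof -
  obtain l r where 1: "\<And>x. x \<notin> {l..r} \<Longrightarrow> a x = 0 \<and> a' x = 0" using assms(1) unfolding bump_fun_def by meson
  obtain l' r' where 2: "\<And>x. x \<notin> {l'..r'} \<Longrightarrow> b x = 0 \<and> b' x = 0" using assms(2) unfolding bump_fun_def by meson
  show ?thesis
  proof (rule that[of "{l..r} \<times> {l'..r'}"])
    show "bounded ({l..r} \<times> {l'..r'})" by (intro bounded_Times) auto
    show "{l..r} \<times> {l'..r'} \<in> sets borel" by (intro borel_closed closed_Times) auto
  qed (use 1 2 in force)
qed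

text \<open>The entropies \<open>kpsi\<close> with e = 1/(n + 1) are inserted and n tends to
  infinity. The constant k is frozen here; the doubling argument replaces it by the value of a
  second solution.\<close>

lemma kruzkov_inequality:
  assumes w: "burgers_entropy_solution w" "ess_bounded (lebesgue_on half_plane) (\<lambda>(x, t). w x t)"
    and g: "borel_version w K g"
    and a: "bump_fun UNIV a a'" and b: "bump_fun {0<..} b b'"
  shows "0 \<le> (\<integral>p. \<bar>g p - k\<bar> * (a (fst p) * b' (snd p)) + kflux (g p) k * (a' (fst p) * b (snd p)) \<partial>lborel)"
proof -
  obtain B where B: "bounded B" "B \<in> sets borel" "\<And>p. p \<notin> B \<Longrightarrow> a (fst p) = 0 \<and> a' (fst p) = 0 \<or> b (snd p) = 0 \<and> b' (snd p) = 0"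
    using bump_fun_bounded_support[OF a b] by blast
  obtain C where C: "\<And>x. \<bar>a x\<bar> \<le> C" "\<And>x. \<bar>a' x\<bar> \<le> C" using bump_fun_bounded(1)[OF a] by blast
  obtain D where D: "\<And>x. \<bar>b x\<bar> \<le> D" "\<And>x. \<bar>b' x\<bar> \<le> D" using bump_fun_bounded(1)[OF b] by blast
  have gK: "\<bar>g p\<bar> \<le> K" for p using g unfolding borel_version_def by blast
  let ?e = "\<lambda>n. 1 / real (Suc n)"
  let ?h = "\<lambda>n p. kpsi (?e n) k (g p) * (a (fst p) * b' (snd p)) + kphi (?e n) k (g p) * (a' (fst p) * b (snd p))"
  let ?M = "(K + \<bar>k\<bar> + 1) * (C * D) + 2 * (K + \<bar>k\<bar> + 1)\<^sup>2 * (C * D)"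
  have [measurable]: "g \<in> borel_measurable (borel \<Otimes>\<^sub>M borel)" using g by (simp add: borel_version_def borel_prod)
  note [measurable] = 
    borel_measurable_continuous_onI[OF bump_fun_bounded(2)[OF a]] borel_measurable_continuous_onI[OF bump_fun_bounded(3)[OF a]]
    borel_measurable_continuous_onI[OF bump_fun_bounded(2)[OF b]] borel_measurable_continuous_onI[OF bump_fun_bounded(3)[OF b]]
  have "continuous_on UNIV (kpsi (?e n) k)" "continuous_on UNIV (kphi (?e n) k)" for n
    by (intro continuous_at_imp_continuous_on ballI DERIV_isCont[OF kpsi_DERIV] DERIV_isCont[OF kphi_DERIV]; simp)+
  then have [measurable]: "kpsi (?e n) k \<in> borel_measurable borel" "kphi (?e n) k \<in> borel_measurable borel" for n
    by (auto intro: borel_measurable_continuous_onI)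
  have bd: "\<bar>?h n p\<bar> \<le> indicator B p * ?M" for n p
  proof (cases "p \<in> B")
    case True
    have nn: "0 \<le> C" "0 \<le> D" "0 \<le> K"
      using C(1)[of 0] D(1)[of 0] gK[of p] by linarith+
    have "0 < ?e n" "?e n \<le> 1" by auto
    note kb = kpsi_bound[OF this gK[of p], of k] kphi_bound[OF this gK[of p], of k]
    have ab: "\<bar>a (fst p) * b' (snd p)\<bar> \<le> C * D" "\<bar>a' (fst p) * b (snd p)\<bar> \<le> C * D"
      unfolding abs_mult by (intro mult_mono C D nn abs_ge_zero)+
    have "\<bar>kpsi (?e n) k (g p) * (a (fst p) * b' (snd p))\<bar> \<le> (K + \<bar>k\<bar> + 1) * (C * D)"
      unfolding abs_mult[of "kpsi _ _ _"] using nn by (intro mult_mono kb ab abs_ge_zero) auto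
    moreover have "\<bar>kphi (?e n) k (g p) * (a' (fst p) * b (snd p))\<bar> \<le> 2 * (K + \<bar>k\<bar> + 1)\<^sup>2 * (C * D)"
      unfolding abs_mult[of "kphi _ _ _"] by (intro mult_mono kb ab abs_ge_zero) auto
    ultimately show ?thesis using True by simp
  next
    case False
    then show ?thesis using B(3)[OF False] by auto
  qed
  have "(\<lambda>n. integral\<^sup>L lborel (?h n)) \<longlonglongrightarrow>
    (\<integral>p. \<bar>g p - k\<bar> * (a (fst p) * b' (snd p)) + kflux (g p) k * (a' (fst p) * b (snd p)) \<partial>lborel)"
  proof (rule integral_dominated_convergence[where w="\<lambda>p. indicator B p * ?M"])
    show "integrable lborel (\<lambda>p. indicator B p * ?M)"
      by (rule integrable_box[where C="\<bar>?M\<bar>" and S=B]) (use B in \<open>auto simp: indicator_def\<close>)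
    show "AE p in lborel. (\<lambda>n. ?h n p) \<longlonglongrightarrow> \<bar>g p - k\<bar> * (a (fst p) * b' (snd p)) + kflux (g p) k * (a' (fst p) * b (snd p))"
      by (intro AE_I2 tendsto_intros kpsi_lim kphi_lim)
    show "(\<lambda>p. \<bar>g p - k\<bar> * (a (fst p) * b' (snd p)) + kflux (g p) k * (a' (fst p) * b (snd p))) \<in> borel_measurable lborel"
      unfolding kflux_def measurable_lborel2 borel_prod[symmetric] by measurable
    show "?h n \<in> borel_measurable lborel" for n unfolding measurable_lborel2 borel_prod[symmetric] by measurable
  qed (use bd in auto)
  moreover have "0 \<le> integral\<^sup>L lborel (?h n)" for n
    by (rule entropy_inequality_product[OF w g a b kpsi_convex kpsi_C2 kphi_DERIV]) auto
  ultimately show ?thesis by (intro LIMSEQ_le_const) auto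
qed

section \<open>Doubling of variables\<close>

text \<open>A class that is stable under sums and under taking any slice and consists of integrable
  functions; within it Fubini's theorem carries no almost-everywhere clauses.\<close>

definition box_bounded :: "('a::euclidean_space \<Rightarrow> real) \<Rightarrow> bool" where
  "box_bounded f \<longleftrightarrow> f \<in> borel_measurable borel \<and> (\<exists>C. \<forall>p. \<bar>f p\<bar> \<le> C) \<and>
     (\<exists>S. bounded S \<and> (\<forall>p. p \<notin> S \<longrightarrow> f p = 0))"

lemma box_bounded_integrable: "box_bounded f \<Longrightarrow> integrable lborel f"
  unfolding box_bounded_def using integrable_box by blast

lemma box_bounded_slice:
  fixes f :: "'a::euclidean_space \<times> 'b::euclidean_space \<Rightarrow> real"
  assumes "box_bounded f"
  shows "box_bounded (\<lambda>y. f (x, y))" "box_bounded (\<lambda>x. f (x, y))"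
proof -
  obtain S C where f: "f \<in> borel_measurable borel" "\<And>p. \<bar>f p\<bar> \<le> C" "bounded S" "\<And>p. p \<notin> S \<Longrightarrow> f p = 0"
    using assms unfolding box_bounded_def by blast
  have m: "f \<in> borel_measurable (borel \<Otimes>\<^sub>M borel)" using f(1) by (simp add: borel_prod)
  have "f (x, y) = 0" if "y \<notin> snd ` S" for x y using that f(4) by force
  moreover have "f (x, y) = 0" if "x \<notin> fst ` S" for x y using that f(4) by force
  moreover have "(\<lambda>y. f (x, y)) \<in> borel_measurable borel" "(\<lambda>x. f (x, y)) \<in> borel_measurable borel"
    using m by measurable
  ultimately show "box_bounded (\<lambda>y. f (x, y))" "box_bounded (\<lambda>x. f (x, y))"
    unfolding box_bounded_def
    using f(2) bounded_fst[OF f(3)] bounded_snd[OF f(3)]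
    by (auto intro!: exI[of _ C] exI[of _ "snd ` S"] exI[of _ "fst ` S"])
qed

lemma box_bounded_Fubini:
  fixes f :: "'a::euclidean_space \<times> 'b::euclidean_space \<Rightarrow> real"
  assumes "box_bounded f"
  shows "(\<integral>x. (\<integral>y. f (x, y) \<partial>lborel) \<partial>lborel) = integral\<^sup>L lborel f"
    "(\<integral>y. (\<integral>x. f (x, y) \<partial>lborel) \<partial>lborel) = integral\<^sup>L lborel f"
    "integrable lborel (\<lambda>x. \<integral>y. f (x, y) \<partial>lborel)"
    "integrable lborel (\<lambda>y. \<integral>x. f (x, y) \<partial>lborel)"
proof -
  have i: "integrable (lborel \<Otimes>\<^sub>M lborel) f"
    using box_bounded_integrable[OF assms] by (simp add: lborel_prod)
  then have i': "integrable (lborel \<Otimes>\<^sub>M lborel) (case_prod (\<lambda>x y. f (x, y)))" by simp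
  show "(\<integral>x. (\<integral>y. f (x, y) \<partial>lborel) \<partial>lborel) = integral\<^sup>L lborel f"
    using lborel_pair.integral_fst'[OF i] by (simp add: lborel_prod)
  show "(\<integral>y. (\<integral>x. f (x, y) \<partial>lborel) \<partial>lborel) = integral\<^sup>L lborel f"
    using lborel_pair.integral_snd[OF i'] by (simp add: lborel_prod)
  show "integrable lborel (\<lambda>x. \<integral>y. f (x, y) \<partial>lborel)"
    using lborel_pair.integrable_fst'[OF i] .
  show "integrable lborel (\<lambda>y. \<integral>x. f (x, y) \<partial>lborel)"
    using lborel_pair.integrable_snd[OF i'] .
qed

section \<open>Translations and their continuity in L^1\<close>

lemma lborel_integral_translate:
  fixes f :: "'a::euclidean_space \<Rightarrow> real"
  assumes "f \<in> borel_measurable borel"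
  shows "(\<integral>x. f (x - c) \<partial>lborel) = integral\<^sup>L lborel f"
  using integral_distr[of "(+) (- c)" lborel borel f] assms
  by (simp add: lborel_distr_plus)

lemma lborel_integral_reflect:
  fixes f :: "'a::euclidean_space \<Rightarrow> real"
  assumes "f \<in> borel_measurable borel"
  shows "(\<integral>x. f (c - x) \<partial>lborel) = integral\<^sup>L lborel f"
proof -
  have "lborel = density (distr lborel borel (\<lambda>x. c + (-1) *\<^sub>R x)) (\<lambda>_::'a. \<bar>-1::real\<bar>^DIM('a))"
    by (rule lborel_affine) simp
  then have "(lborel :: 'a measure) = distr lborel borel (\<lambda>x. c - x)" by (simp add: density_1)
  then have "integral\<^sup>L lborel f = integral\<^sup>L (distr lborel borel (\<lambda>x. c - x)) f" by simp
  also have "\<dots> = (\<integral>x. f (c - x) \<partial>lborel)"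
    using assms by (intro integral_distr) auto
  finally show ?thesis by simp
qed

text \<open>A measurable function is an almost everywhere limit of continuous ones. Clipping these
  at K and -K keeps the bound, so dominated convergence on the bounded set applies.\<close>

lemma continuous_approx_L1:
  fixes g :: "'a::euclidean_space \<Rightarrow> real"
  assumes g: "g \<in> borel_measurable borel" "\<And>p. \<bar>g p\<bar> \<le> K" and B: "bounded B" "B \<in> sets borel" and "\<epsilon> > 0"
  obtains G where "continuous_on UNIV G" "\<And>p. \<bar>G p\<bar> \<le> K" "(\<integral>p. indicator B p * \<bar>g p - G p\<bar> \<partial>lborel) < \<epsilon>"
proof -
  have "g measurable_on UNIV"
    using g(1) by (intro lebesgue_measurable_imp_measurable_on_real) (auto intro: measurable_completion)
  then obtain N G where N: "negligible N" and G: "\<And>n. continuous_on UNIV (G n)" "\<And>x. x \<notin> N \<Longrightarrow> (\<lambda>n. G n x) \<longlonglongrightarrow> g x"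
    unfolding measurable_on_def by auto
  define H where "H n x = max (-K) (min K (G n x))" for n x
  have K: "0 \<le> K" using g(2)[of undefined] by linarith
  have Hc: "continuous_on UNIV (H n)" for n unfolding H_def by (intro continuous_intros G)
  have Hb: "\<bar>H n x\<bar> \<le> K" for n x unfolding H_def using K by auto
  have lim: "(\<lambda>n. H n x) \<longlonglongrightarrow> g x" if "x \<notin> N" for x
  proof -
    have "(\<lambda>n. max (-K) (min K (G n x))) \<longlonglongrightarrow> max (-K) (min K (g x))"
      by (intro tendsto_intros G that)
    moreover have "max (-K) (min K (g x)) = g x" using g(2)[of x] by auto
    ultimately show ?thesis by (simp add: H_def)
  qed
  have Hm[measurable]: "H n \<in> borel_measurable borel" for n by (rule borel_measurable_continuous_onI[OF Hc])
  note [measurable] = g(1) B(2)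
  have "(\<lambda>n. \<integral>p. indicator B p * \<bar>g p - H n p\<bar> \<partial>lborel) \<longlonglongrightarrow> (\<integral>p. 0 \<partial>(lborel :: 'a measure))"
  proof (rule integral_dominated_convergence[where w="\<lambda>p. indicator B p * (2 * K)"])
    show "integrable lborel (\<lambda>p. indicator B p * (2 * K))"
      by (rule integrable_box[where C="2 * K" and S=B]) (use K B in \<open>auto simp: indicator_def\<close>)
    have "AE p in lborel. p \<notin> N"
      using N by (auto simp: negligible_iff_null_sets AE_completion_iff dest!: AE_not_in)
    then show "AE p in lborel. (\<lambda>n. indicator B p * \<bar>g p - H n p\<bar>) \<longlonglongrightarrow> 0"
    proof eventually_elim
      case (elim p)
      have "(\<lambda>n. indicator B p * \<bar>g p - H n p\<bar>) \<longlonglongrightarrow> indicator B p * \<bar>g p - g p\<bar>"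
        by (intro tendsto_intros lim elim)
      then show ?case by simp
    qed
    show "AE p in lborel. norm (indicator B p * \<bar>g p - H n p\<bar>) \<le> indicator B p * (2 * K)" for n
    proof (rule AE_I2)
      fix p show "norm (indicator B p * \<bar>g p - H n p\<bar>) \<le> indicator B p * (2 * K)"
        using g(2)[of p] Hb[of n p] by (auto simp: indicator_def)
    qed
  qed auto
  then have "\<forall>\<^sub>F n in sequentially. (\<integral>p. indicator B p * \<bar>g p - H n p\<bar> \<partial>lborel) < \<epsilon>"
    using \<open>\<epsilon> > 0\<close> by (auto intro: order_tendstoD(2))
  then obtain n where "(\<integral>p. indicator B p * \<bar>g p - H n p\<bar> \<partial>lborel) < \<epsilon>"
    using eventually_happens' sequentially_bot by blast
  then show ?thesis using that Hc Hb by blast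
qed

text \<open>The difference is split through a continuous approximation \<open>G\<close>: two terms
  are L^1 errors of \<open>G\<close>, the middle one is controlled by uniform continuity of
  \<open>G\<close> on a ball.\<close>

lemma translation_continuous_L1:
  fixes g :: "'a::euclidean_space \<Rightarrow> real"
  assumes g: "g \<in> borel_measurable borel" "\<And>p. \<bar>g p\<bar> \<le> K" and B: "bounded B" "B \<in> sets borel" and "\<epsilon> > 0"
  obtains \<delta> where "\<delta> > 0" "\<And>z. norm z < \<delta> \<Longrightarrow> (\<integral>p. indicator B p * \<bar>g (p - z) - g p\<bar> \<partial>lborel) \<le> \<epsilon>"
proof -
  obtain r where r: "r > 0" "B \<subseteq> cball 0 r"
    using bounded_subset_ballD[OF B(1), of 0] ball_subset_cball by blast
  \<comment> \<open>Radius r + 1, so that for |z| < 1 both p and p - z stay in the ball whenever p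
    lies in \<open>B\<close>.\<close>
  define B' where "B' = cball (0::'a) (r + 1)"
  obtain G where G: "continuous_on UNIV G" "\<And>p. \<bar>G p\<bar> \<le> K" "(\<integral>p. indicator B' p * \<bar>g p - G p\<bar> \<partial>lborel) < \<epsilon> / 3"
    by (rule continuous_approx_L1[OF g, of B' "\<epsilon> / 3"]) (use \<open>\<epsilon> > 0\<close> in \<open>auto simp: B'_def\<close>)
  define m where "m = measure lborel B'"
  have m: "m \<ge> 0" by (simp add: m_def)
  have "uniformly_continuous_on B' G"
    by (rule compact_uniformly_continuous) (use G(1) in \<open>auto simp: B'_def intro: continuous_on_subset\<close>)
  moreover have "\<epsilon> / (3 * (m + 1)) > 0" using \<open>\<epsilon> > 0\<close> m by simp
  ultimately obtain d where d: "d > 0" "\<And>x y. x \<in> B' \<Longrightarrow> y \<in> B' \<Longrightarrow> dist y x < d \<Longrightarrow> dist (G y) (G x) < \<epsilon> / (3 * (m + 1))"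
    unfolding uniformly_continuous_on_def by metis
  note [measurable] = g(1) B(2) borel_measurable_continuous_onI[OF G(1)]
  have [measurable]: "B' \<in> sets borel" by (simp add: B'_def)
  have K: "0 \<le> K" using g(2)[of undefined] by linarith
  have I: "integrable lborel (\<lambda>p. indicator B' p * \<bar>g (p - z) - G (p - z)\<bar>)" for z
  proof (rule integrable_box[where C="2 * K" and S=B'])
    fix p show "\<bar>indicator B' p * \<bar>g (p - z) - G (p - z)\<bar>\<bar> \<le> 2 * K"
      using g(2)[of "p - z"] G(2)[of "p - z"] K by (auto simp: indicator_def)
    show "(\<lambda>p. indicator B' p * \<bar>g (p - z) - G (p - z)\<bar>) \<in> borel_measurable borel" by measurable
  qed (auto simp: B'_def)
  show ?thesis
  proof (rule that[of "min d 1"])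
    fix z :: 'a assume z: "norm z < min d 1"
    have "p - z \<in> B'" "p \<in> B'" if "p \<in> B" for p
    proof -
      have "norm p \<le> r" using that r(2) by auto
      then show "p - z \<in> B'" "p \<in> B'" using z norm_triangle_ineq4[of p z] by (auto simp: B'_def)
    qed note inB = this
    have 1: "(\<integral>p. indicator B' (p - z) * \<bar>g (p - z) - G (p - z)\<bar> \<partial>lborel) < \<epsilon> / 3"
      using G(3) lborel_integral_translate[of "\<lambda>p. indicator B' p * \<bar>g p - G p\<bar>" z] by simp
    have I1: "integrable lborel (\<lambda>p. indicator B' (p - z) * \<bar>g (p - z) - G (p - z)\<bar>)"
    proof (rule integrable_box[where C="2 * K" and S="cball 0 (r + 2)"])
      fix p show "\<bar>indicator B' (p - z) * \<bar>g (p - z) - G (p - z)\<bar>\<bar> \<le> 2 * K"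
        using g(2)[of "p - z"] G(2)[of "p - z"] K by (auto simp: indicator_def)
      assume "p \<notin> cball 0 (r + 2)"
      then have "p - z \<notin> B'" using z norm_triangle_ineq2[of p z] by (auto simp: B'_def)
      then show "indicator B' (p - z) * \<bar>g (p - z) - G (p - z)\<bar> = 0" by simp
    qed auto
    have I2: "integrable lborel (\<lambda>p. indicator B' p * (\<epsilon> / (3 * (m + 1))))"
      by (rule integrable_box[where C="\<epsilon> / (3 * (m + 1))" and S=B']) (use m \<open>\<epsilon> > 0\<close> in \<open>auto simp: B'_def indicator_def\<close>)
    have "(\<integral>p. indicator B p * \<bar>g (p - z) - g p\<bar> \<partial>lborel) \<le>
      (\<integral>p. indicator B' (p - z) * \<bar>g (p - z) - G (p - z)\<bar> + indicator B' p * (\<epsilon> / (3 * (m + 1)))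
          + indicator B' p * \<bar>g p - G p\<bar> \<partial>lborel)"
    proof (rule integral_mono_AE)
      show "integrable lborel (\<lambda>p. indicator B p * \<bar>g (p - z) - g p\<bar>)"
      proof (rule integrable_box[where C="2 * K" and S=B])
        fix p show "\<bar>indicator B p * \<bar>g (p - z) - g p\<bar>\<bar> \<le> 2 * K"
          using g(2)[of "p - z"] g(2)[of "p"] K by (auto simp: indicator_def)
      qed (use B in auto)
      show "AE p in lborel. indicator B p * \<bar>g (p - z) - g p\<bar> \<le>
         indicator B' (p - z) * \<bar>g (p - z) - G (p - z)\<bar> + indicator B' p * (\<epsilon> / (3 * (m + 1)))
          + indicator B' p * \<bar>g p - G p\<bar>"
      proof (rule AE_I2)
        fix p show "indicator B p * \<bar>g (p - z) - g p\<bar> \<le>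
         indicator B' (p - z) * \<bar>g (p - z) - G (p - z)\<bar> + indicator B' p * (\<epsilon> / (3 * (m + 1)))
          + indicator B' p * \<bar>g p - G p\<bar>"
        proof (cases "p \<in> B")
          case True
          have "dist (G (p - z)) (G p) < \<epsilon> / (3 * (m + 1))"
            using inB[OF True] z by (intro d) (auto simp: dist_norm)
          then show ?thesis using inB[OF True] True by (simp add: dist_real_def)
        next
          case False
          then show ?thesis using m \<open>\<epsilon> > 0\<close> by simp
        qed
      qed
    qed (use I[of 0] I1 I2 in auto)
    also have "\<dots> = (\<integral>p. indicator B' (p - z) * \<bar>g (p - z) - G (p - z)\<bar> \<partial>lborel) +
       (\<integral>p. indicator B' p * (\<epsilon> / (3 * (m + 1))) \<partial>lborel) + (\<integral>p. indicator B' p * \<bar>g p - G p\<bar> \<partial>lborel)"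
      using I[of 0] I1 I2 by simp
    also have "(\<integral>p. indicator B' p * (\<epsilon> / (3 * (m + 1))) \<partial>lborel) = m * (\<epsilon> / (3 * (m + 1)))"
      by (simp add: m_def)
    also have "\<dots> \<le> \<epsilon> / 3"
      using m \<open>\<epsilon> > 0\<close> by (simp add: field_simps)
    finally show "(\<integral>p. indicator B p * \<bar>g (p - z) - g p\<bar> \<partial>lborel) \<le> \<epsilon>" using 1 G(3) by linarith
  qed (use d in auto)
qed

text \<open>The passage to the diagonal. \<open>E p k\<close> stands for the Kruzhkov integrand with
  frozen k and \<open>M\<close> for a mollifier. After the substitution q = p - z, the integral over
  p differs from its value at z = 0 by at most |C| \<epsilon>, by the Lipschitz bound in k and
  continuity of translations in L^1.\<close>

lemma doubling_limit:
  fixes g :: "'a::euclidean_space \<Rightarrow> real" and E :: "'a \<Rightarrow> real \<Rightarrow> real"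
  assumes g: "g \<in> borel_measurable borel" "\<And>p. \<bar>g p\<bar> \<le> K" and B: "bounded B" "B \<in> sets borel"
    and E: "(\<lambda>(p, k). E p k) \<in> borel_measurable borel"
      "\<And>p k. \<bar>k\<bar> \<le> K \<Longrightarrow> \<bar>E p k\<bar> \<le> C * indicator B p"
      "\<And>p k k'. \<bar>k\<bar> \<le> K \<Longrightarrow> \<bar>k'\<bar> \<le> K \<Longrightarrow> \<bar>E p k - E p k'\<bar> \<le> C * (indicator B p * \<bar>k - k'\<bar>)"
    and M: "\<And>\<delta>. \<delta> > 0 \<Longrightarrow> \<exists>M. M \<in> borel_measurable borel \<and> (\<forall>z. 0 \<le> M z) \<and> (\<exists>D. \<forall>z. M z \<le> D) \<and>
       (\<forall>z. norm z \<ge> \<delta> \<longrightarrow> M z = 0) \<and> 0 < integral\<^sup>L lborel M \<and>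
       0 \<le> (\<integral>p. (\<integral>q. E p (g q) * M (p - q) \<partial>lborel) \<partial>lborel)"
  shows "0 \<le> (\<integral>p. E p (g p) \<partial>lborel)"
proof (rule field_le_epsilon)
  have C: "0 \<le> C * indicator B p" for p using E(2)[of 0 p] g(2)[of undefined] by (smt (verit))
  fix e :: real assume "e > 0"
  define \<epsilon> where "\<epsilon> = e / (\<bar>C\<bar> + 1)"
  have \<epsilon>: "\<epsilon> > 0" using \<open>e > 0\<close> by (simp add: \<epsilon>_def)
  obtain \<delta> where \<delta>: "\<delta> > 0" "\<And>z. norm z < \<delta> \<Longrightarrow> (\<integral>p. indicator B p * \<bar>g (p - z) - g p\<bar> \<partial>lborel) \<le> \<epsilon>"
    using translation_continuous_L1[OF g B \<epsilon>] by blast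
  obtain M D where M: "M \<in> borel_measurable borel" "\<And>z. 0 \<le> M z" "\<And>z. M z \<le> D"
       "\<And>z. norm z \<ge> \<delta> \<Longrightarrow> M z = 0" "0 < integral\<^sup>L lborel M"
       "0 \<le> (\<integral>p. (\<integral>q. E p (g q) * M (p - q) \<partial>lborel) \<partial>lborel)"
    using assms(8)[OF \<delta>(1)] by blast
  note [measurable] = g(1) M(1)
  have Em[measurable]: "case_prod E \<in> borel_measurable (borel \<Otimes>\<^sub>M borel)" using E(1) by (simp add: borel_prod)
  obtain R where R: "\<And>p. p \<in> B \<Longrightarrow> norm p \<le> R" using B(1) by (auto simp: bounded_iff)
  let ?J = "\<integral>p. E p (g p) \<partial>lborel"
  have bb0: "box_bounded (\<lambda>p. E p (g (p - z)))" for z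
    unfolding box_bounded_def
  proof (intro conjI exI[of _ B] exI[of _ "\<bar>C\<bar>"] allI impI)
    show "(\<lambda>p. E p (g (p - z))) \<in> borel_measurable borel" by measurable
    show "\<bar>E p (g (p - z))\<bar> \<le> \<bar>C\<bar>" for p
      using E(2)[OF g(2)[of "p - z"], of p] by (cases "p \<in> B") auto
    show "E p (g (p - z)) = 0" if "p \<notin> B" for p
      using E(2)[OF g(2)[of "p - z"], of p] that by auto
  qed (rule B)
  have bb1: "box_bounded (\<lambda>(p, z). E p (g (p - z)) * M z)"
    unfolding box_bounded_def
  proof (intro conjI exI[of _ "B \<times> cball 0 \<delta>"] exI[of _ "\<bar>C\<bar> * D"] allI impI)
    show "(\<lambda>(p, z). E p (g (p - z)) * M z) \<in> borel_measurable borel"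
      unfolding borel_prod[symmetric] by measurable
    show "bounded (B \<times> cball (0::'a) \<delta>)" by (intro bounded_Times B) auto
    fix x :: "'a \<times> 'a"
    obtain p z where x: "x = (p, z)" by force
    have "\<bar>E p (g (p - z))\<bar> \<le> \<bar>C\<bar>"
      using E(2)[OF g(2)[of "p - z"], of p] by (cases "p \<in> B") auto
    then show "\<bar>case x of (p, z) \<Rightarrow> E p (g (p - z)) * M z\<bar> \<le> \<bar>C\<bar> * D"
      using M(2)[of z] M(3)[of z] by (auto simp: x abs_mult intro!: mult_mono)
    assume "x \<notin> B \<times> cball 0 \<delta>"
    then have "E p (g (p - z)) = 0 \<or> M z = 0"
      using E(2)[OF g(2)[of "p - z"], of p] M(4)[of z] by (auto simp: x)
    then show "(case x of (p, z) \<Rightarrow> E p (g (p - z)) * M z) = 0" by (auto simp: x)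
  qed
  have bM: "box_bounded M"
    unfolding box_bounded_def
    using M(1,2,3,4) by (intro conjI exI[of _ "cball 0 \<delta>"] exI[of _ D]) (auto simp: abs_le_iff intro: order_trans)
  have *: "(\<integral>p. E p (g (p - z)) \<partial>lborel) \<le> ?J + \<bar>C\<bar> * \<epsilon>" if "norm z < \<delta>" for z
  proof -
    have I: "integrable lborel (\<lambda>p. \<bar>C\<bar> * (indicator B p * \<bar>g (p - z) - g p\<bar>))"
    proof (rule integrable_box[where C="\<bar>C\<bar> * (2 * K)" and S=B])
      fix p have "\<bar>g (p - z) - g p\<bar> \<le> 2 * K" using g(2)[of "p - z"] g(2)[of p] by linarith
      then show "\<bar>\<bar>C\<bar> * (indicator B p * \<bar>g (p - z) - g p\<bar>)\<bar> \<le> \<bar>C\<bar> * (2 * K)"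
        by (cases "p \<in> B") (auto simp: abs_mult intro!: mult_left_mono)
    qed (use B in auto)
    have I0: "integrable lborel (\<lambda>p. E p (g (p - z)))" for z
      by (rule box_bounded_integrable[OF bb0])
    have "(\<integral>p. E p (g (p - z)) \<partial>lborel) \<le> (\<integral>p. E p (g p) + \<bar>C\<bar> * (indicator B p * \<bar>g (p - z) - g p\<bar>) \<partial>lborel)"
    proof (rule integral_mono)
      show "E p (g (p - z)) \<le> E p (g p) + \<bar>C\<bar> * (indicator B p * \<bar>g (p - z) - g p\<bar>)" for p
        using E(3)[OF g(2)[of "p - z"] g(2)[of p], of p]
          mult_right_mono[OF abs_ge_self[of C], of "indicator B p * \<bar>g (p - z) - g p\<bar>"] by force
    qed (use I I0[of 0] I0[of z] in auto)
    also have "\<dots> = ?J + \<bar>C\<bar> * (\<integral>p. (indicator B p * \<bar>g (p - z) - g p\<bar>) \<partial>lborel)"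
      using I I0[of 0] by simp
    also have "\<dots> \<le> ?J + \<bar>C\<bar> * \<epsilon>" using \<delta>(2)[OF that] by (simp add: mult_left_mono)
    finally show ?thesis .
  qed
  note M(6)
  also have "(\<integral>p. (\<integral>q. E p (g q) * M (p - q) \<partial>lborel) \<partial>lborel) = (\<integral>p. (\<integral>z. E p (g (p - z)) * M z \<partial>lborel) \<partial>lborel)"
  proof (rule Bochner_Integration.integral_cong[OF refl])
    fix p
    have "(\<lambda>z. E p (g (p - z)) * M z) \<in> borel_measurable borel" by measurable
    from lborel_integral_reflect[OF this, of p]
    show "(\<integral>q. E p (g q) * M (p - q) \<partial>lborel) = (\<integral>z. E p (g (p - z)) * M z \<partial>lborel)" by simp
  qed
  also have "\<dots> = (\<integral>z. (\<integral>p. E p (g (p - z)) * M z \<partial>lborel) \<partial>lborel)"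
    using box_bounded_Fubini(1,2)[OF bb1] by simp
  also have "\<dots> \<le> (\<integral>z. (?J + \<bar>C\<bar> * \<epsilon>) * M z \<partial>lborel)"
  proof (rule integral_mono)
    show "integrable lborel (\<lambda>z. \<integral>p. E p (g (p - z)) * M z \<partial>lborel)"
      using box_bounded_Fubini(4)[OF bb1] by simp
    show "integrable lborel (\<lambda>z. (?J + \<bar>C\<bar> * \<epsilon>) * M z)"
      using box_bounded_integrable[OF bM] by simp
    fix z show "(\<integral>p. E p (g (p - z)) * M z \<partial>lborel) \<le> (?J + \<bar>C\<bar> * \<epsilon>) * M z"
    proof (cases "norm z < \<delta>")
      case True
      then show ?thesis using mult_right_mono[OF *[OF True] M(2)[of z]] by simp
    next
      case False
      then show ?thesis using M(4)[of z] by simp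
    qed
  qed
  also have "\<dots> = (?J + \<bar>C\<bar> * \<epsilon>) * integral\<^sup>L lborel M" by simp
  \<comment> \<open>Only the sign is at stake, so the positive mass of \<open>M\<close> is divided
    out.\<close>
  finally have "0 \<le> ?J + \<bar>C\<bar> * \<epsilon>" using M(5) by (simp add: zero_le_mult_iff)
  also have "\<bar>C\<bar> * \<epsilon> \<le> e" using \<open>e > 0\<close> by (simp add: \<epsilon>_def field_simps)
  finally show "0 \<le> ?J + e" by simp
qed


section \<open>Kruzhkov's inequality for two solutions\<close>

definition bounded_fun :: "('a \<Rightarrow> real) \<Rightarrow> bool" where
  "bounded_fun f \<longleftrightarrow> (\<exists>C. \<forall>x. \<bar>f x\<bar> \<le> C)"

lemma bounded_fun_add: "bounded_fun f \<Longrightarrow> bounded_fun g \<Longrightarrow> bounded_fun (\<lambda>x. f x + g x)"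
  unfolding bounded_fun_def by (meson abs_triangle_ineq add_mono order_trans)

lemma bounded_fun_diff: "bounded_fun f \<Longrightarrow> bounded_fun g \<Longrightarrow> bounded_fun (\<lambda>x. f x - g x)"
  unfolding bounded_fun_def by (meson abs_triangle_ineq4 add_mono order_trans)

lemma bounded_fun_mult: "bounded_fun f \<Longrightarrow> bounded_fun g \<Longrightarrow> bounded_fun (\<lambda>x. f x * g x)"
proof -
  assume "bounded_fun f" "bounded_fun g"
  then obtain C D where C: "\<And>x. \<bar>f x\<bar> \<le> C" and D: "\<And>x. \<bar>g x\<bar> \<le> D" unfolding bounded_fun_def by blast
  have "\<bar>f x * g x\<bar> \<le> C * D" for x
    unfolding abs_mult using order_trans[OF abs_ge_zero C[of x]] by (intro mult_mono C D) auto
  then show "bounded_fun (\<lambda>x. f x * g x)" unfolding bounded_fun_def by blast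
qed

lemma bounded_fun_abs: "bounded_fun f \<Longrightarrow> bounded_fun (\<lambda>x. \<bar>f x\<bar>)"
  unfolding bounded_fun_def by simp

lemma bounded_fun_compose: "bounded_fun f \<Longrightarrow> bounded_fun (\<lambda>x. f (h x))"
  unfolding bounded_fun_def by blast

lemma bounded_fun_const: "bounded_fun (\<lambda>x. c)"
  unfolding bounded_fun_def by blast

lemma bounded_fun_minus: "bounded_fun f \<Longrightarrow> bounded_fun (\<lambda>x. - f x)"
  unfolding bounded_fun_def by simp

lemmas bounded_fun_intros = bounded_fun_minus bounded_fun_add bounded_fun_diff bounded_fun_mult bounded_fun_abs bounded_fun_const

lemma kflux_eq: "kflux v k = (1 / 2) * (\<bar>v - k\<bar> * (v + k))"
  by (simp add: kflux_def)

lemma kflux_commute: "kflux v k = kflux k v"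
  by (simp add: kflux_def abs_minus_commute add.commute)

lemma bounded_fun_kflux: "bounded_fun f \<Longrightarrow> bounded_fun g \<Longrightarrow> bounded_fun (\<lambda>x. kflux (f x) (g x))"
  unfolding kflux_eq by (intro bounded_fun_intros)

lemma kflux_lipschitz:
  assumes "\<bar>v\<bar> \<le> K" "\<bar>k\<bar> \<le> K" "\<bar>k'\<bar> \<le> K"
  shows "\<bar>kflux v k - kflux v k'\<bar> \<le> 2 * K * \<bar>k - k'\<bar>"
proof -
  have K: "0 \<le> K" using assms by linarith
  \<comment> \<open>Add and subtract |v - k'| (v + k).\<close>
  have "2 * (kflux v k - kflux v k') = (\<bar>v - k\<bar> - \<bar>v - k'\<bar>) * (v + k) + \<bar>v - k'\<bar> * (k - k')"
    by (simp add: kflux_def field_simps)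
  also have "\<bar>\<dots>\<bar> \<le> \<bar>k - k'\<bar> * (2 * K) + (2 * K) * \<bar>k - k'\<bar>"
  proof (intro order_trans[OF abs_triangle_ineq] add_mono)
    show "\<bar>(\<bar>v - k\<bar> - \<bar>v - k'\<bar>) * (v + k)\<bar> \<le> \<bar>k - k'\<bar> * (2 * K)"
      unfolding abs_mult using assms by (intro mult_mono) auto
    show "\<bar>\<bar>v - k'\<bar> * (k - k')\<bar> \<le> (2 * K) * \<bar>k - k'\<bar>"
      unfolding abs_mult using assms K by (intro mult_mono) auto
  qed
  finally show ?thesis by (simp add: abs_mult)
qed

lemma kflux_measurable [measurable (raw)]:
  assumes [measurable]: "f \<in> borel_measurable M" "g \<in> borel_measurable M"
  shows "(\<lambda>x. kflux (f x) (g x)) \<in> borel_measurable M"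
  unfolding kflux_def by measurable

text \<open>Supplies the test function in p for fixed q: multiplication by a translated mollifier
  keeps the support inside that of \<open>a\<close>, so a time factor stays away from t = 0.\<close>

lemma bump_fun_mult_translate:
  assumes "bump_fun S a a'" "bump_fun UNIV m m'"
  shows "bump_fun S (\<lambda>x. a x * m (x - y)) (\<lambda>x. a' x * m (x - y) + a x * m' (x - y))"
proof -
  obtain c d where cd: "{c..d} \<subseteq> S" "\<And>x. x \<notin> {c..d} \<Longrightarrow> a x = 0 \<and> a' x = 0"
    and a: "smooth1 a" "\<And>x. (a has_real_derivative a' x) (at x)" "\<And>x. 0 \<le> a x"
    using assms(1) unfolding bump_fun_def by meson
  have m: "smooth1 m" "\<And>x. (m has_real_derivative m' x) (at x)" "\<And>x. 0 \<le> m x"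
    using assms(2) unfolding bump_fun_def by blast+
  show ?thesis
  proof (rule bump_funI[where l=c and r=d])
    show "smooth1 (\<lambda>x. a x * m (x - y))"
      using smooth1_mult[OF a(1) smooth1_affine[OF m(1), of 1 "- y"]] by simp
    have "((\<lambda>x. m (x - y)) has_real_derivative m' (x - y)) (at x)" for x
      by (rule DERIV_cong[OF DERIV_chain2[OF m(2), of "\<lambda>x. x - y" 1]]) (auto intro!: derivative_eq_intros)
    from DERIV_mult[OF a(2) this]
    show "((\<lambda>x. a x * m (x - y)) has_real_derivative a' x * m (x - y) + a x * m' (x - y)) (at x)" for x
      by (simp add: algebra_simps)
  qed (use a m cd in auto)
qed

text \<open>Supplies the test function in q for fixed p. Differentiating the reflected mollifier
  produces a minus sign, the source of the cancellation in
  \<open>kruzkov_pair_inequality\<close>.\<close>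

lemma bump_fun_reflect:
  assumes "bump_fun UNIV m m'" "\<And>z. z \<notin> {- h..h} \<Longrightarrow> m z = 0 \<and> m' z = 0" "0 \<le> c" "{x - h..x + h} \<subseteq> S"
  shows "bump_fun S (\<lambda>y. c * m (x - y)) (\<lambda>y. - (c * m' (x - y)))"
proof -
  have m: "smooth1 m" "\<And>x. (m has_real_derivative m' x) (at x)" "\<And>x. 0 \<le> m x"
    using assms(1) unfolding bump_fun_def by blast+
  show ?thesis
  proof (rule bump_funI[where l="x - h" and r="x + h"])
    show "smooth1 (\<lambda>y. c * m (x - y))"
      using smooth1_mult[OF smooth1_const smooth1_affine[OF m(1), of "-1" x]] by simp
    have "((\<lambda>y. m (x - y)) has_real_derivative m' (x - y) * - 1) (at y)" for y
      by (rule DERIV_chain2[OF m(2)]) (auto intro!: derivative_eq_intros)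
    from DERIV_cmult[OF this, of c]
    show "((\<lambda>y. c * m (x - y)) has_real_derivative - (c * m' (x - y))) (at y)" for y
      by simp
    show "c * m (x - y) = 0" "- (c * m' (x - y)) = 0" if "y \<notin> {x - h..x + h}" for y
      using assms(2)[of "x - y"] that by auto
  qed (use assms m in auto)
qed

lemma bump_fun_bump:
  assumes "h > 0"
  shows "bump_fun UNIV (bump 1 (- h) h) (deriv (bump 1 (- h) h))"
    "z \<notin> {- h..h} \<Longrightarrow> bump 1 (- h) h z = 0 \<and> deriv (bump 1 (- h) h) z = 0"
proof -
  have z: "bump 1 (- h) h z = 0 \<and> deriv (bump 1 (- h) h) z = 0" if "z \<notin> {- h..h}" for z
  proof
    show "bump 1 (- h) h z = 0" using that by (intro bump_outside) auto
    have "((\<lambda>_. 0) has_real_derivative 0) (at z)" by simp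
    then have "(bump 1 (- h) h has_real_derivative 0) (at z)"
      by (rule has_field_derivative_transform_within_open[of _ _ _ "- {- h..h}"])
        (use that in \<open>auto simp: bump_outside\<close>)
    then show "deriv (bump 1 (- h) h) z = 0" by (rule DERIV_imp_deriv)
  qed
  then show "z \<notin> {- h..h} \<Longrightarrow> bump 1 (- h) h z = 0 \<and> deriv (bump 1 (- h) h) z = 0" .
  show "bump_fun UNIV (bump 1 (- h) h) (deriv (bump 1 (- h) h))"
    by (rule bump_funI[where l="-h" and r=h])
      (use z smooth1_bump smooth1_DERIV[OF smooth1_bump] bump_bounds in auto)
qed

text \<open>If the integral were 0, the nonnegative integrand would vanish almost everywhere; but it
  is positive on an open square, which is not negligible.\<close>

lemma bump_integral_pos:
  assumes "h > 0"
  shows "0 < (\<integral>p. bump 1 (- h) h (fst p) * bump 1 (- h) h (snd p) \<partial>(lborel :: (real \<times> real) measure))"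
proof -
  let ?f = "\<lambda>p :: real \<times> real. bump 1 (- h) h (fst p) * bump 1 (- h) h (snd p)"
  let ?S = "{- h<..<h} \<times> {- h<..<h}"
  have c: "continuous_on UNIV ?f"
    by (intro continuous_intros continuous_on_compose2[OF smooth1_continuous[OF smooth1_bump]]) auto
  have nn: "0 \<le> ?f p" for p using bump_bounds(1)[of 1] by simp
  have i: "integrable lborel ?f"
  proof (rule integrable_box[where C=1 and S="?S"])
    show "?f \<in> borel_measurable borel" by (rule borel_measurable_continuous_onI[OF c])
    show "bounded ?S" by (intro bounded_Times) auto
    show "\<bar>?f p\<bar> \<le> 1" for p using nn[of p] bump_bounds[of 1] by (simp add: mult_le_one)
    show "p \<notin> ?S \<Longrightarrow> ?f p = 0" for p by (cases p) (auto simp: bump_outside)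
  qed
  have "integral\<^sup>L lborel ?f \<noteq> 0"
  proof
    assume "integral\<^sup>L lborel ?f = 0"
    then have "AE p in lborel. ?f p = 0"
      using integral_nonneg_eq_0_iff_AE[OF i] nn by auto
    then have "AE p in lborel. p \<notin> ?S"
      by eventually_elim (auto simp: bump_eq)
    moreover have S: "open ?S" "?S \<noteq> {}" using assms by (auto intro!: open_Times exI[of _ 0])
    ultimately have "?S \<in> null_sets lborel"
      by (simp add: AE_iff_null_sets borel_open)
    then have "negligible ?S" by (simp add: negligible_iff_null_sets null_sets_completionI)
    then show False using open_not_negligible[OF S] by blast
  qed
  moreover have "0 \<le> integral\<^sup>L lborel ?f" using nn by (intro Bochner_Integration.integral_nonneg) auto
  ultimately show ?thesis by linarith
qed

text \<open>Kruzhkov's doubling. The inequality for \<open>w\<close> is used in p with k =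
  \<open>f q\<close>, that for \<open>v\<close> in q with k = \<open>g p\<close>. Integrated over
  the other variable and added, all terms containing \<open>m'\<close> cancel, and only derivatives
  of \<open>a\<close> and \<open>b\<close> remain.\<close>

theorem kruzkov_pair_inequality:
  assumes w: "burgers_entropy_solution w" "ess_bounded (lebesgue_on half_plane) (\<lambda>(x, t). w x t)" "borel_version w K g"
    and v: "burgers_entropy_solution v" "ess_bounded (lebesgue_on half_plane) (\<lambda>(x, t). v x t)" "borel_version v K f"
    and a: "bump_fun UNIV a a'" and b: "bump_fun {0<..} b b'"
  shows "0 \<le> (\<integral>p. \<bar>g p - f p\<bar> * (a (fst p) * b' (snd p)) + kflux (g p) (f p) * (a' (fst p) * b (snd p)) \<partial>lborel)"
proof -
  have gK: "\<bar>g p\<bar> \<le> K" and fK: "\<bar>f p\<bar> \<le> K" for p using w(3) v(3) unfolding borel_version_def by blast+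
  have K: "0 \<le> K" using gK[of undefined] by linarith
  have gm[measurable]: "g \<in> borel_measurable (borel \<Otimes>\<^sub>M borel)" and fm[measurable]: "f \<in> borel_measurable (borel \<Otimes>\<^sub>M borel)"
    using w(3) v(3) by (simp_all add: borel_version_def borel_prod)
  note [measurable] = 
    borel_measurable_continuous_onI[OF bump_fun_bounded(2)[OF a]] borel_measurable_continuous_onI[OF bump_fun_bounded(3)[OF a]]
    borel_measurable_continuous_onI[OF bump_fun_bounded(2)[OF b]] borel_measurable_continuous_onI[OF bump_fun_bounded(3)[OF b]]
  obtain B where B: "bounded B" "B \<in> sets borel" "\<And>p. p \<notin> B \<Longrightarrow> a (fst p) = 0 \<and> a' (fst p) = 0 \<or> b (snd p) = 0 \<and> b' (snd p) = 0"
    using bump_fun_bounded_support[OF a b] by blast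
  obtain Ca where Ca: "\<And>x. \<bar>a x\<bar> \<le> Ca" "\<And>x. \<bar>a' x\<bar> \<le> Ca" using bump_fun_bounded(1)[OF a] by blast
  obtain Cb where Cb: "\<And>x. \<bar>b x\<bar> \<le> Cb" "\<And>x. \<bar>b' x\<bar> \<le> Cb" using bump_fun_bounded(1)[OF b] by blast
  have nn: "0 \<le> Ca" "0 \<le> Cb" using Ca(1)[of 0] Cb(1)[of 0] by linarith+
  define E where "E p k = \<bar>g p - k\<bar> * (a (fst p) * b' (snd p)) + kflux (g p) k * (a' (fst p) * b (snd p))" for p k
  have ab: "\<bar>a (fst p) * b' (snd p)\<bar> \<le> (Ca * Cb) * indicator B p" "\<bar>a' (fst p) * b (snd p)\<bar> \<le> (Ca * Cb) * indicator B p" for p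
  proof -
    have "\<bar>a (fst p) * b' (snd p)\<bar> \<le> Ca * Cb" "\<bar>a' (fst p) * b (snd p)\<bar> \<le> Ca * Cb"
      unfolding abs_mult by (intro mult_mono Ca Cb nn abs_ge_zero)+
    then show "\<bar>a (fst p) * b' (snd p)\<bar> \<le> (Ca * Cb) * indicator B p" "\<bar>a' (fst p) * b (snd p)\<bar> \<le> (Ca * Cb) * indicator B p"
      using B(3)[of p] by (cases "p \<in> B"; auto)+
  qed
  \<comment> \<open>Large enough for two purposes: 2 K (1 + 2 K) bounds the size of \<open>E\<close>
    and 1 + 2 K its Lipschitz constant in k, each times the bound Ca Cb of the test
    functions.\<close>
  define C where "C = (2 * K + 2 * K * (2 * K) + 2 * K + 1) * (Ca * Cb)"
  have "0 \<le> (\<integral>p. E p (f p) \<partial>lborel)"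
  proof (rule doubling_limit[of f K B E C])
    show "f \<in> borel_measurable borel" using fm by (simp add: borel_prod)
    show "(\<lambda>(p, k). E p k) \<in> borel_measurable borel"
      unfolding E_def borel_prod[symmetric] by measurable
    have E_diff: "\<bar>E p k - E p k'\<bar> \<le> (1 + 2 * K) * (Ca * Cb) * (indicator B p * \<bar>k - k'\<bar>)"
      if "\<bar>k\<bar> \<le> K" "\<bar>k'\<bar> \<le> K" for p k k'
    proof -
      have "\<bar>E p k - E p k'\<bar> \<le> \<bar>\<bar>g p - k\<bar> - \<bar>g p - k'\<bar>\<bar> * \<bar>a (fst p) * b' (snd p)\<bar>
          + \<bar>kflux (g p) k - kflux (g p) k'\<bar> * \<bar>a' (fst p) * b (snd p)\<bar>"
        unfolding abs_mult[symmetric] E_def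
        by (rule order_trans[OF _ abs_triangle_ineq]) (simp add: algebra_simps)
      also have "\<dots> \<le> \<bar>k - k'\<bar> * ((Ca * Cb) * indicator B p) + (2 * K * \<bar>k - k'\<bar>) * ((Ca * Cb) * indicator B p)"
        using K by (intro add_mono mult_mono ab kflux_lipschitz gK that) auto
      finally show ?thesis by (simp add: algebra_simps)
    qed
    then show "\<bar>E p k - E p k'\<bar> \<le> C * (indicator B p * \<bar>k - k'\<bar>)" if "\<bar>k\<bar> \<le> K" "\<bar>k'\<bar> \<le> K" for p k k'
    proof -
      have "(1 + 2 * K) * (Ca * Cb) \<le> C" unfolding C_def using K nn by (intro mult_right_mono) auto
      then show ?thesis using E_diff[OF that, of p] by (meson mult_right_mono order_trans indicator_pos_le mult_nonneg_nonneg abs_ge_zero)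
    qed
    show "\<bar>E p k\<bar> \<le> C * indicator B p" if "\<bar>k\<bar> \<le> K" for p k
    proof -
      \<comment> \<open>\<open>E\<close> vanishes at k = \<open>g p\<close>, so its size follows
        from the Lipschitz bound over a distance of at most 2 K.\<close>
      have gg: "kflux (g p) (g p) = 0" by (simp add: kflux_def)
      have "E p (g p) = 0" by (simp add: E_def gg)
      then have "\<bar>E p k\<bar> \<le> (1 + 2 * K) * (Ca * Cb) * (indicator B p * \<bar>k - g p\<bar>)"
        using E_diff[OF that gK[of p], of p] by simp
      also have "\<dots> \<le> (1 + 2 * K) * (Ca * Cb) * (indicator B p * (2 * K))"
        using gK[of p] that K nn by (intro mult_left_mono) auto
      also have "\<dots> = (2 * K + 2 * K * (2 * K)) * (Ca * Cb) * indicator B p" by (simp add: algebra_simps)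
      also have "\<dots> \<le> C * indicator B p" unfolding C_def using K nn by (intro mult_right_mono) auto
      finally show ?thesis .
    qed
    fix \<delta> :: real assume "\<delta> > 0"
    obtain l r where lr: "{l..r} \<subseteq> {0<..}" "\<And>x. x \<notin> {l..r} \<Longrightarrow> b x = 0 \<and> b' x = 0"
      using b unfolding bump_fun_def by meson
    \<comment> \<open>Small against \<delta>, so that the mollifier is supported within distance
      \<delta>, and below l, so that the time window of radius h around any t \<ge> l is positive.
      If l \<le> 0, the support interval {l..r} is empty and the value 1 is a dummy.\<close>
    define h where "h = min (\<delta> / 4) (if l > 0 then l / 2 else 1)"
    have h: "h > 0" "4 * h \<le> \<delta>" "l > 0 \<Longrightarrow> h < l"
      using \<open>\<delta> > 0\<close> by (auto simp: h_def min_def field_simps)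
    define m where "m = bump 1 (- h) h"
    define m' where "m' = deriv m"
    have m: "bump_fun UNIV m m'" "\<And>z. z \<notin> {- h..h} \<Longrightarrow> m z = 0 \<and> m' z = 0"
      using bump_fun_bump[OF h(1)] by (auto simp: m_def m'_def)
    have m01: "0 \<le> m z" "m z \<le> 1" for z unfolding m_def by (auto intro: bump_bounds)
    note [measurable] = 
      borel_measurable_continuous_onI[OF bump_fun_bounded(2)[OF m(1)]] borel_measurable_continuous_onI[OF bump_fun_bounded(3)[OF m(1)]]
    define M where "M z = m (fst z) * m (snd z)" for z :: "real \<times> real"
    define J1 where "J1 z = (let p = fst z; q = snd z in
       \<bar>g p - f q\<bar> * ((a (fst p) * m (fst p - fst q)) * (b' (snd p) * m (snd p - snd q) + b (snd p) * m' (snd p - snd q)))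
       + kflux (g p) (f q) * ((a' (fst p) * m (fst p - fst q) + a (fst p) * m' (fst p - fst q)) * (b (snd p) * m (snd p - snd q))))"
      for z :: "(real \<times> real) \<times> real \<times> real"
    define J2 where "J2 z = (let p = fst z; q = snd z in
       \<bar>f q - g p\<bar> * ((a (fst p) * m (fst p - fst q)) * (- (b (snd p) * m' (snd p - snd q))))
       + kflux (f q) (g p) * (- (a (fst p) * m' (fst p - fst q)) * (b (snd p) * m (snd p - snd q))))"
      for z :: "(real \<times> real) \<times> real \<times> real"
    \<comment> \<open>The terms with \<open>m'\<close> cancel here; this uses the symmetry of |v -
      k| and of \<open>kflux\<close>.\<close>
    have sum: "J1 (p, q) + J2 (p, q) = E p (f q) * M (p - q)" for p q
      by (simp add: J1_def J2_def E_def M_def Let_def kflux_commute[of "f q"] abs_minus_commute[of "f q"] algebra_simps)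
    \<comment> \<open>Both integrands live where p is in the support box and q within h of p in each
      coordinate. This set is bounded, which makes Fubini's theorem available in four
      dimensions.\<close>
    define S where "S = {z :: (real \<times> real) \<times> real \<times> real. fst z \<in> B \<and> \<bar>fst (fst z) - fst (snd z)\<bar> \<le> h \<and> \<bar>snd (fst z) - snd (snd z)\<bar> \<le> h}"
    obtain R where R: "\<And>p. p \<in> B \<Longrightarrow> norm p \<le> R" using B(1) by (auto simp: bounded_iff)
    have S: "bounded S"
    proof (rule bounded_subset[of "B \<times> cball 0 (R + 2 * h)"])
      show "bounded (B \<times> cball (0 :: real \<times> real) (R + 2 * h))" by (intro bounded_Times B) auto
      show "S \<subseteq> B \<times> cball 0 (R + 2 * h)"
      proof
        fix z assume z: "z \<in> S"
        obtain p q where pq: "z = (p, q)" by (rule prod.exhaust)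
        have "norm q \<le> norm p + norm (p - q)" by (metis norm_triangle_sub norm_minus_commute)
        also have "norm (p - q) \<le> \<bar>fst p - fst q\<bar> + \<bar>snd p - snd q\<bar>"
          using norm_Pair_le[of "fst p - fst q" "snd p - snd q"] by (cases p; cases q) simp
        finally show "z \<in> B \<times> cball 0 (R + 2 * h)" using z R[of p] by (auto simp: S_def pq)
      qed
    qed
    have J0: "J1 z = 0 \<and> J2 z = 0" if "z \<notin> S" for z
    proof -
      obtain p q where pq: "z = (p, q)" by (rule prod.exhaust)
      have "(a (fst p) = 0 \<and> a' (fst p) = 0) \<or> (b (snd p) = 0 \<and> b' (snd p) = 0) \<or>
        (m (fst p - fst q) = 0 \<and> m' (fst p - fst q) = 0) \<or> (m (snd p - snd q) = 0 \<and> m' (snd p - snd q) = 0)"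
        using that B(3)[of p] m(2)[of "fst p - fst q"] m(2)[of "snd p - snd q"]
        by (auto simp: S_def pq abs_le_iff)
      then show ?thesis by (auto simp: J1_def J2_def pq Let_def)
    qed
    have bd: "bounded_fun a" "bounded_fun a'" "bounded_fun b" "bounded_fun b'" "bounded_fun m" "bounded_fun m'" "bounded_fun g" "bounded_fun f"
      using bump_fun_bounded(1)[OF a] bump_fun_bounded(1)[OF b] bump_fun_bounded(1)[OF m(1)] gK fK unfolding bounded_fun_def by blast+
    have bbJ: "box_bounded J1" "box_bounded J2"
    proof -
      have "bounded_fun J1" "bounded_fun J2"
        unfolding J1_def J2_def Let_def
        by (intro bounded_fun_intros bounded_fun_kflux bd[THEN bounded_fun_compose])+
      moreover have "J1 \<in> borel_measurable borel" "J2 \<in> borel_measurable borel"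
        unfolding J1_def J2_def Let_def borel_prod[symmetric] by measurable
      ultimately show "box_bounded J1" "box_bounded J2"
        unfolding box_bounded_def bounded_fun_def using S J0 by blast+
    qed
    have I1: "0 \<le> (\<integral>p. J1 (p, q) \<partial>lborel)" for q
      using kruzkov_inequality[OF w bump_fun_mult_translate[OF a m(1), of "fst q"] bump_fun_mult_translate[OF b m(1), of "snd q"], of "f q"]
      by (simp add: J1_def Let_def)
    have I2: "0 \<le> (\<integral>q. J2 (p, q) \<partial>lborel)" for p
    \<comment> \<open>For p in the time support of \<open>b\<close> the window in q is admissible;
      for other p the integrand is identically 0.\<close>
    proof (cases "snd p \<in> {l..r}")
      case True
      then have "l \<in> {l..r}" by auto
      then have "0 < l" using lr(1) by blast
      then have sub: "{snd p - h..snd p + h} \<subseteq> {0<..}" using True h(3) by auto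
      have 0: "0 \<le> a (fst p)" "0 \<le> b (snd p)" using a b by (auto simp: bump_fun_def)
      have "bump_fun UNIV (\<lambda>y. a (fst p) * m (fst p - y)) (\<lambda>y. - (a (fst p) * m' (fst p - y)))"
        by (rule bump_fun_reflect[where h=h]) (use m 0 in auto)
      moreover have "bump_fun {0<..} (\<lambda>y. b (snd p) * m (snd p - y)) (\<lambda>y. - (b (snd p) * m' (snd p - y)))"
        by (rule bump_fun_reflect[where h=h]) (use m 0 sub in auto)
      ultimately have "0 \<le> (\<integral>q. \<bar>f q - g p\<bar> * (a (fst p) * m (fst p - fst q) * - (b (snd p) * m' (snd p - snd q)))
          + kflux (f q) (g p) * (- (a (fst p) * m' (fst p - fst q)) * (b (snd p) * m (snd p - snd q))) \<partial>lborel)"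
        by (rule kruzkov_inequality[OF v])
      then show ?thesis
        by (simp add: J2_def Let_def)
    next
      case False
      then show ?thesis using lr(2)[OF False] by (simp add: J2_def Let_def)
    qed
    have "0 \<le> (\<integral>p. (\<integral>q. E p (f q) * M (p - q) \<partial>lborel) \<partial>lborel)"
    proof -
      have "0 \<le> integral\<^sup>L lborel J1" 
        unfolding box_bounded_Fubini(2)[OF bbJ(1), symmetric] by (rule Bochner_Integration.integral_nonneg) (rule I1)
      moreover have "0 \<le> integral\<^sup>L lborel J2" 
        unfolding box_bounded_Fubini(1)[OF bbJ(2), symmetric] by (rule Bochner_Integration.integral_nonneg) (rule I2)
      ultimately have "0 \<le> (\<integral>p. (\<integral>q. J1 (p, q) \<partial>lborel) \<partial>lborel) + (\<integral>p. (\<integral>q. J2 (p, q) \<partial>lborel) \<partial>lborel)"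
        using box_bounded_Fubini(1)[OF bbJ(1)] box_bounded_Fubini(1)[OF bbJ(2)] by simp
      also have "\<dots> = (\<integral>p. (\<integral>q. J1 (p, q) \<partial>lborel) + (\<integral>q. J2 (p, q) \<partial>lborel) \<partial>lborel)"
        by (rule Bochner_Integration.integral_add[symmetric]) (intro box_bounded_Fubini bbJ)+
      also have "\<dots> = (\<integral>p. (\<integral>q. J1 (p, q) + J2 (p, q) \<partial>lborel) \<partial>lborel)"
        by (intro Bochner_Integration.integral_cong refl Bochner_Integration.integral_add[symmetric]
            box_bounded_integrable box_bounded_slice bbJ)
      finally show ?thesis unfolding sum .
    qed
    moreover have "M \<in> borel_measurable borel" unfolding M_def borel_prod[symmetric] by measurable
    moreover have "\<forall>z. 0 \<le> M z" "\<forall>z. M z \<le> 1" using m01 by (auto simp: M_def intro: mult_le_one)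
    moreover have "\<forall>z. norm z \<ge> \<delta> \<longrightarrow> M z = 0"
    proof (intro allI impI)
      fix z :: "real \<times> real" assume "norm z \<ge> \<delta>"
      moreover have "norm z \<le> \<bar>fst z\<bar> + \<bar>snd z\<bar>" using norm_Pair_le[of "fst z" "snd z"] by simp
      ultimately have "fst z \<notin> {- h..h} \<or> snd z \<notin> {- h..h}" using h(1,2) by auto
      then show "M z = 0" using m(2) by (auto simp: M_def)
    qed
    moreover have "0 < integral\<^sup>L lborel M" unfolding M_def m_def by (rule bump_integral_pos[OF h(1)])
    ultimately show "\<exists>M. M \<in> borel_measurable borel \<and> (\<forall>z. 0 \<le> M z) \<and> (\<exists>D. \<forall>z. M z \<le> D) \<and>
       (\<forall>z. norm z \<ge> \<delta> \<longrightarrow> M z = 0) \<and> 0 < integral\<^sup>L lborel M \<and>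
       0 \<le> (\<integral>p. (\<integral>q. E p (f q) * M (p - q) \<partial>lborel) \<partial>lborel)"
      by (intro exI[of _ M]) auto
  qed (use fK B in auto)
  then show ?thesis by (simp add: E_def)
qed

section \<open>\<open>L\<^sup>1\<close> contraction\<close>

text \<open>The limits of the profiles in \<open>bump_fun_trapezoid\<close>. With piecewise linear
  factors the time derivative of the test function becomes a difference of two window
  averages.\<close>

definition trapezoid :: "real \<Rightarrow> real \<Rightarrow> real \<Rightarrow> real \<Rightarrow> real" where
  "trapezoid s h d x = ramp s (s + h) x - ramp s (s + h) (x - d)"

definition trapezoid' :: "real \<Rightarrow> real \<Rightarrow> real \<Rightarrow> real \<Rightarrow> real" where
  "trapezoid' s h d x = indicator {s<..<s + h} x - indicator {s<..<s + h} (x - d)"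

lemma trapezoid_bounds: "d \<ge> 0 \<Longrightarrow> 0 \<le> trapezoid s h d x" "h \<ge> 0 \<Longrightarrow> d \<ge> 0 \<Longrightarrow> trapezoid s h d x \<le> h"
  by (auto simp: trapezoid_def ramp_def)

lemma trapezoid_outside: "h \<ge> 0 \<Longrightarrow> d \<ge> 0 \<Longrightarrow> x \<notin> {s..s + h + d} \<Longrightarrow> trapezoid s h d x = 0"
  by (auto simp: trapezoid_def ramp_def)

lemma trapezoid'_bound: "\<bar>trapezoid' s h d x\<bar> \<le> 1"
  by (auto simp: trapezoid'_def indicator_def)

lemma trapezoid'_outside: "h \<ge> 0 \<Longrightarrow> d \<ge> 0 \<Longrightarrow> x \<notin> {s..s + h + d} \<Longrightarrow> trapezoid' s h d x = 0"
  by (auto simp: trapezoid'_def indicator_def)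

lemma trapezoid_measurable [measurable]: "trapezoid s h d \<in> borel_measurable borel"
  "trapezoid' s h d \<in> borel_measurable borel"
  unfolding trapezoid_def[abs_def] trapezoid'_def[abs_def] ramp_def by measurable

text \<open>Connects Lebesgue integrals over open windows with gauge integrals, in whose terms the
  Lebesgue points and the splitting of intervals are expressed; the end points form a null
  set.\<close>

lemma integral_Ioo_eq:
  assumes "G \<in> borel_measurable borel" "\<And>t. \<bar>G t\<bar> \<le> C"
  shows "G integrable_on {a..b}" "(\<integral>t. indicator {a<..<b} t * G t \<partial>lborel) = integral {a..b::real} (G :: real \<Rightarrow> real)"
proof -
  have i: "set_integrable lborel {a..b} G"
    unfolding set_integrable_def
    by (rule integrable_box[where C="\<bar>C\<bar>" and S="{a..b}"])
      (use assms in \<open>auto simp: indicator_def intro: order_trans[OF _ abs_ge_self]\<close>)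
  show "G integrable_on {a..b}" by (rule set_borel_integral_eq_integral(1)[OF i])
  have "(\<integral>t. indicator {a<..<b} t * G t \<partial>lborel) = (LINT t:{a..b}|lborel. G t)"
    unfolding set_lebesgue_integral_def
  proof (rule integral_cong_AE)
    have "AE t in lborel. t \<noteq> a" "AE t in lborel. t \<noteq> b" by (rule AE_lborel_singleton)+
    then show "AE t in lborel. indicator {a<..<b} t * G t = indicator {a..b} t *\<^sub>R G t"
      by eventually_elim (auto simp: indicator_def)
  qed (use assms in auto)
  then show "(\<integral>t. indicator {a<..<b} t * G t \<partial>lborel) = integral {a..b} G"
    using set_borel_integral_eq_integral(2)[OF i] by simp
qed

lemma lebesgue_point_right:
  fixes G :: "real \<Rightarrow> real"
  assumes "\<And>a b. G integrable_on {a..b}"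
  shows "AE \<tau> in lborel. \<forall>\<epsilon>>0. \<exists>d>0. \<forall>h. 0 < h \<and> h < d \<longrightarrow> \<bar>integral {\<tau>..\<tau> + h} G / h - G \<tau>\<bar> < \<epsilon>"
proof (rule integrable_ccontinuous_explicit[of G])
  show "G integrable_on cbox a b" for a b using assms by simp
  fix N assume N: "negligible N"
    "\<And>x e. x \<notin> N \<Longrightarrow> 0 < e \<Longrightarrow> \<exists>d>0. \<forall>h. 0 < h \<and> h < d \<longrightarrow>
       norm (integral (cbox x (x + h *\<^sub>R One)) G /\<^sub>R h ^ DIM(real) - G x) < e"
  have "AE \<tau> in lborel. \<tau> \<notin> N"
    using N(1) by (auto simp: negligible_iff_null_sets AE_completion_iff dest!: AE_not_in)
  then show ?thesis
  proof eventually_elim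
    case (elim \<tau>)
    show ?case using N(2)[OF elim] by (simp add: divide_inverse mult.commute)
  qed
qed

text \<open>Rises over [-2R, -R], equals 1 on [-R, R] and falls over [R, 2R]. Its slope 1/R is the
  origin of the factor K/R in the growth estimate.\<close>

definition cutoff :: "real \<Rightarrow> real \<Rightarrow> real" where
  "cutoff R x = trapezoid (-2 * R) R (3 * R) x / R"

lemma cutoff_bounds: "R > 0 \<Longrightarrow> 0 \<le> cutoff R x" "R > 0 \<Longrightarrow> cutoff R x \<le> 1"
  using trapezoid_bounds(1)[of "3 * R" "-2 * R" R x] trapezoid_bounds(2)[of R "3 * R" "-2 * R" x]
  by (auto simp: cutoff_def)

lemma cutoff_outside: "R > 0 \<Longrightarrow> x \<notin> {-2 * R..2 * R} \<Longrightarrow> cutoff R x = 0"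
  by (auto simp: cutoff_def trapezoid_outside)

lemma cutoff_inside: "x \<in> {- R..R} \<Longrightarrow> R > 0 \<Longrightarrow> cutoff R x = 1"
  by (auto simp: cutoff_def trapezoid_def ramp_def)

lemma cutoff_measurable [measurable]: "cutoff R \<in> borel_measurable borel"
  unfolding cutoff_def[abs_def] by measurable

definition local_mass :: "(real \<times> real \<Rightarrow> real) \<Rightarrow> real \<Rightarrow> real \<Rightarrow> real" where
  "local_mass e R t = (\<integral>x. cutoff R x * e (x, t) \<partial>lborel)"

text \<open>The contraction argument in abstract form: \<open>e\<close> will be |w - v| and
  \<open>F\<close> the Kruzhkov flux, so that |F| \<le> K e limits the speed of propagation to
  K.\<close>

context
  fixes e F :: "real \<times> real \<Rightarrow> real" and K L :: real
  assumes e_meas: "e \<in> borel_measurable borel" and F_meas: "F \<in> borel_measurable borel"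
    and e_bounds: "\<And>p. 0 \<le> e p" "\<And>p. e p \<le> L" and F_bound: "\<And>p. \<bar>F p\<bar> \<le> K * e p" and K: "0 \<le> K"
    and ineq: "\<And>a a' b b'. bump_fun UNIV a a' \<Longrightarrow> bump_fun {0<..} b b' \<Longrightarrow>
      0 \<le> (\<integral>p. e p * (a (fst p) * b' (snd p)) + F p * (a' (fst p) * b (snd p)) \<partial>lborel)"
begin

lemma L_nonneg: "0 \<le> L"
  using e_bounds(1)[of undefined] e_bounds(2)[of undefined] by linarith

text \<open>The limit of the inequality for smooth profiles. Since s' > 0, the time profile is
  supported away from t = 0 and thus admissible.\<close>

lemma trapezoid_inequality:
  assumes "h > 0" "d > 0" "s' > 0" "h' > 0" "d' > 0"
  shows "0 \<le> (\<integral>p. e p * (trapezoid s h d (fst p) * trapezoid' s' h' d' (snd p)) +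
     F p * (trapezoid' s h d (fst p) * trapezoid s' h' d' (snd p)) \<partial>lborel)"
proof -
  note [measurable] = e_meas[folded borel_prod] F_meas[folded borel_prod]
  define T where "T n s h d x = bump_int (real (Suc n)) s (s+h) x - bump_int (real (Suc n)) s (s+h) (x - d)" for n s h d x
  define T' where "T' n s h d x = bump (real (Suc n)) s (s+h) x - bump (real (Suc n)) s (s+h) (x - d)" for n s h d x
  have bf: "bump_fun S (T n s h d) (T' n s h d)" if "h > 0" "d > 0" "{s..s+h+d} \<subseteq> S" for n s h d S
    unfolding T_def[abs_def] T'_def[abs_def] using that by (intro bump_fun_trapezoid) auto
  have Tb: "\<bar>T n s h d x\<bar> \<le> h" if "h > 0" for n s h d x
    using bump_int_nonneg[of "real (Suc n)" s "s+h" x] bump_int_nonneg[of "real (Suc n)" s "s+h" "x - d"]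
      bump_int_le[of "real (Suc n)" s "s+h" x] bump_int_le[of "real (Suc n)" s "s+h" "x - d"] that
    unfolding T_def by auto
  have T'b: "\<bar>T' n s h d x\<bar> \<le> 1" for n s h d x
    using bump_bounds[of "real (Suc n)" s "s+h" x] bump_bounds[of "real (Suc n)" s "s+h" "x - d"]
    unfolding T'_def by auto
  have T0: "T n s h d x = 0" if "x \<notin> {s..s+h+d}" "h > 0" "d > 0" for n s h d x
  proof (cases "x < s")
    case True
    then show ?thesis using that unfolding T_def by (simp add: bump_int_left)
  next
    case False
    then show ?thesis
      using that bump_int_right[of "real (Suc n)" s "s+h" x] bump_int_right[of "real (Suc n)" s "s+h" "x - d"]
      unfolding T_def by simp
  qed
  have T'0: "T' n s h d x = 0" if "x \<notin> {s..s+h+d}" "h > 0" "d > 0" for n s h d x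
    using that unfolding T'_def by (auto simp: bump_outside)
  have Tl: "(\<lambda>n. T n s h d x) \<longlonglongrightarrow> trapezoid s h d x" if "h > 0" for s h d x
    unfolding T_def trapezoid_def using that by (intro tendsto_diff bump_int_lim) auto
  have T'l: "(\<lambda>n. T' n s h d x) \<longlonglongrightarrow> trapezoid' s h d x" for s h d x
    unfolding T'_def trapezoid'_def by (intro tendsto_diff bump_lim)
  have [measurable]: "T n s h d \<in> borel_measurable borel" "T' n s h d \<in> borel_measurable borel" if "h > 0" "d > 0" for n s h d
    by (rule borel_measurable_continuous_onI[OF bump_fun_bounded(2)[OF bf[OF that subset_UNIV]]],
        rule borel_measurable_continuous_onI[OF bump_fun_bounded(3)[OF bf[OF that subset_UNIV]]])
  let ?f = "\<lambda>n p. e p * (T n s h d (fst p) * T' n s' h' d' (snd p)) + F p * (T' n s h d (fst p) * T n s' h' d' (snd p))"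
  let ?S = "{s..s+h+d} \<times> {s'..s'+h'+d'}"
  let ?M = "L * (h * 1) + K * L * (1 * h')"
  have FL: "\<bar>F p\<bar> \<le> K * L" for p
    using F_bound[of p] mult_left_mono[OF e_bounds(2)[of p] K] by linarith
  have "(\<lambda>n. integral\<^sup>L lborel (?f n)) \<longlonglongrightarrow> (\<integral>p. e p * (trapezoid s h d (fst p) * trapezoid' s' h' d' (snd p)) +
     F p * (trapezoid' s h d (fst p) * trapezoid s' h' d' (snd p)) \<partial>lborel)"
  proof (rule integral_dominated_convergence[where w="\<lambda>p. indicator ?S p * ?M"])
    have "?S \<in> sets borel" by (intro borel_closed closed_Times) auto
    then show "integrable lborel (\<lambda>p. indicator ?S p * ?M)"
      by (intro integrable_box[where C="\<bar>?M\<bar>" and S="?S"]) (auto simp: indicator_def intro!: bounded_Times)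
    show "AE p in lborel. (\<lambda>n. ?f n p) \<longlonglongrightarrow> e p * (trapezoid s h d (fst p) * trapezoid' s' h' d' (snd p)) +
     F p * (trapezoid' s h d (fst p) * trapezoid s' h' d' (snd p))"
      using assms by (intro AE_I2 tendsto_intros Tl T'l)
    show "AE p in lborel. norm (?f n p) \<le> indicator ?S p * ?M" for n
    proof (rule AE_I2)
      fix p :: "real \<times> real"
      show "norm (?f n p) \<le> indicator ?S p * ?M"
      proof (cases "p \<in> ?S")
        case True
        have "\<bar>?f n p\<bar> \<le> \<bar>e p\<bar> * (\<bar>T n s h d (fst p)\<bar> * \<bar>T' n s' h' d' (snd p)\<bar>) + \<bar>F p\<bar> * (\<bar>T' n s h d (fst p)\<bar> * \<bar>T n s' h' d' (snd p)\<bar>)"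
          unfolding abs_mult[symmetric] by (rule abs_triangle_ineq)
        also have "\<dots> \<le> ?M"
          using assms e_bounds[of p] L_nonneg K by (intro add_mono mult_mono Tb T'b FL) auto
        finally show ?thesis using True by simp
      next
        case False
        then have "fst p \<notin> {s..s+h+d} \<or> snd p \<notin> {s'..s'+h'+d'}" by (auto simp: mem_Times_iff)
        then have "?f n p = 0" using T0 T'0 assms by (elim disjE) simp_all
        then show ?thesis using False by simp
      qed
    qed
    show "?f n \<in> borel_measurable lborel" for n
      unfolding measurable_lborel2 borel_prod[symmetric] using assms by measurable
    show "(\<lambda>p. e p * (trapezoid s h d (fst p) * trapezoid' s' h' d' (snd p)) +
     F p * (trapezoid' s h d (fst p) * trapezoid s' h' d' (snd p))) \<in> borel_measurable lborel"
      unfolding measurable_lborel2 borel_prod[symmetric] by measurable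
  qed
  moreover have "0 \<le> integral\<^sup>L lborel (?f n)" for n
    using assms by (intro ineq bf) auto
  ultimately show ?thesis by (intro LIMSEQ_le_const) auto
qed

section \<open>Growth in time of the local masses\<close>

lemma slice_integrable:
  assumes "R > 0" shows "integrable lborel (\<lambda>x. cutoff R x * e (x, t))"
proof (rule integrable_box[where C=L and S="{-2 * R..2 * R}"])
  note [measurable] = e_meas[folded borel_prod]
  show "(\<lambda>x. cutoff R x * e (x, t)) \<in> borel_measurable borel" by measurable
  show "\<bar>cutoff R x * e (x, t)\<bar> \<le> L" for x
    using cutoff_bounds[OF assms, of x] e_bounds[of "(x, t)"] mult_mono[of "cutoff R x" 1 "e (x, t)" L] by simp
qed (use cutoff_outside[OF assms] in auto)

lemma local_mass_nonneg: "R > 0 \<Longrightarrow> 0 \<le> local_mass e R t"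
  unfolding local_mass_def using cutoff_bounds e_bounds by (intro Bochner_Integration.integral_nonneg) auto

lemma local_mass_le:
  assumes "R > 0" shows "local_mass e R t \<le> 4 * R * L"
proof -
  have "local_mass e R t \<le> (\<integral>x. indicator {-2 * R..2 * R} x * L \<partial>lborel)"
    unfolding local_mass_def
  proof (rule integral_mono)
    show "cutoff R x * e (x, t) \<le> indicator {-2 * R..2 * R} x * L" for x
      using cutoff_bounds[OF assms, of x] e_bounds[of "(x, t)"] mult_mono[of "cutoff R x" 1 "e (x, t)" L]
        cutoff_outside[OF assms, of x] by (cases "x \<in> {-2 * R..2 * R}") auto
    show "integrable lborel (\<lambda>x. indicator {-2 * R..2 * R} x * L)"
      by (rule integrable_box[where C="\<bar>L\<bar>" and S="{-2 * R..2 * R}"]) (auto simp: indicator_def)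
  qed (rule slice_integrable[OF assms])
  then show ?thesis using assms by simp
qed

lemma local_mass_measurable: "R > 0 \<Longrightarrow> local_mass e R \<in> borel_measurable borel"
proof -
  note [measurable] = e_meas[folded borel_prod]
  have "(\<lambda>t. \<integral>x. cutoff R x * e (x, t) \<partial>lborel) \<in> borel_measurable borel"
    by (rule lborel.borel_measurable_lebesgue_integral) measurable
  then show ?thesis by (simp add: local_mass_def[abs_def])
qed

lemma local_mass_abs: "R > 0 \<Longrightarrow> \<bar>local_mass e R t\<bar> \<le> 4 * R * L"
  using local_mass_le local_mass_nonneg by (simp add: abs_of_nonneg)

lemma local_mass_integrable: "R > 0 \<Longrightarrow> local_mass e R integrable_on {a..b}"
  by (rule integral_Ioo_eq(1)[OF local_mass_measurable local_mass_abs])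

text \<open>The test function is R times \<open>cutoff R\<close> in space. Its time derivative
  yields the mass near 0 minus the mass near \<tau>. In the flux term the space slope is at most 1,
  the time profile at most h, and |F| \<le> K e is needed only on [-2R, 2R], where
  \<open>cutoff (2 * R)\<close> is 1. Division by R leaves h K/R.\<close>

lemma local_mass_growth:
  assumes "R > 0" "0 < h" "h < \<tau>"
  shows "integral {\<tau>..\<tau> + h} (local_mass e R) \<le> integral {h..2 * h} (local_mass e R)
     + h * (K / R) * integral {0..\<tau> + h} (local_mass e (2 * R))"
proof -
  note [measurable] = e_meas[folded borel_prod] F_meas[folded borel_prod]
  let ?X = "trapezoid (-2 * R) R (3 * R)" and ?X' = "trapezoid' (-2 * R) R (3 * R)"
  \<comment> \<open>Rises over [h, 2h] and falls over [\<tau>, \<tau> + h].\<close>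
  let ?T = "trapezoid h h (\<tau> - h)" and ?T' = "trapezoid' h h (\<tau> - h)"
  let ?A = "\<lambda>p. R * (?T' (snd p) * (cutoff R (fst p) * e p))"
  let ?B = "\<lambda>p. h * K * (indicator {0<..<\<tau> + h} (snd p) * (cutoff (2 * R) (fst p) * e p))"
  have R2: "2 * R > 0" using assms by simp
  have c: "0 \<le> cutoff R x * e p" "cutoff R x * e p \<le> L" "0 \<le> cutoff (2 * R) x * e p" "cutoff (2 * R) x * e p \<le> L" for x p
    using cutoff_bounds[OF assms(1), of x] cutoff_bounds[OF R2, of x] e_bounds[of p] 
      mult_mono[of "cutoff R x" 1 "e p" L] mult_mono[of "cutoff (2 * R) x" 1 "e p" L] by auto
  have bbA: "box_bounded (\<lambda>p. ?A (snd p, fst p))"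
    unfolding box_bounded_def
  proof (intro conjI exI[of _ "{0..\<tau> + h} \<times> {-2 * R..2 * R}"] exI[of _ "R * (1 * L)"] allI impI)
    show "(\<lambda>p. ?A (snd p, fst p)) \<in> borel_measurable borel" unfolding borel_prod[symmetric] by measurable
    show "bounded ({0..\<tau> + h} \<times> {-2 * R..2 * R})" by (intro bounded_Times) auto
    fix p :: "real \<times> real"
    have "\<bar>?T' (fst p)\<bar> * \<bar>cutoff R (snd p) * e (snd p, fst p)\<bar> \<le> 1 * L"
      using c[of "snd p" "(snd p, fst p)"] by (intro mult_mono trapezoid'_bound) auto
    then show "\<bar>?A (snd p, fst p)\<bar> \<le> R * (1 * L)" using assms by (simp add: abs_mult)
    assume "p \<notin> {0..\<tau> + h} \<times> {-2 * R..2 * R}"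
    then have "fst p \<notin> {0..\<tau> + h} \<or> snd p \<notin> {-2 * R..2 * R}" by (auto simp: mem_Times_iff)
    then show "?A (snd p, fst p) = 0"
      using cutoff_outside[OF assms(1), of "snd p"] trapezoid'_outside[of h "\<tau> - h" "fst p" h] assms by auto
  qed
  have bbB: "box_bounded (\<lambda>p. ?B (snd p, fst p))"
    unfolding box_bounded_def
  proof (intro conjI exI[of _ "{0..\<tau> + h} \<times> {-2 * (2 * R)..2 * (2 * R)}"] exI[of _ "h * K * (1 * L)"] allI impI)
    show "(\<lambda>p. ?B (snd p, fst p)) \<in> borel_measurable borel" unfolding borel_prod[symmetric] by measurable
    show "bounded ({0..\<tau> + h} \<times> {-2 * (2 * R)..2 * (2 * R)})" by (intro bounded_Times) auto
    fix p :: "real \<times> real"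
    have "\<bar>indicator {0<..<\<tau> + h} (fst p)\<bar> * \<bar>cutoff (2 * R) (snd p) * e (snd p, fst p)\<bar> \<le> 1 * L"
      using c[of "snd p" "(snd p, fst p)"] by (intro mult_mono) (auto simp: indicator_def)
    then have "\<bar>indicator {0<..<\<tau> + h} (fst p) * (cutoff (2 * R) (snd p) * e (snd p, fst p))\<bar> \<le> 1 * L"
      by (simp add: abs_mult)
    from mult_left_mono[OF this, of "h * K"]
    show "\<bar>?B (snd p, fst p)\<bar> \<le> h * K * (1 * L)" using assms K by (simp add: abs_mult)
    assume "p \<notin> {0..\<tau> + h} \<times> {-2 * (2 * R)..2 * (2 * R)}"
    then have "fst p \<notin> {0..\<tau> + h} \<or> snd p \<notin> {-2 * (2 * R)..2 * (2 * R)}" by (auto simp: mem_Times_iff)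
    then show "?B (snd p, fst p) = 0"
      using cutoff_outside[OF R2, of "snd p"] by auto
  qed
  have sw: "(\<integral>t. (\<integral>x. f (x, t) \<partial>lborel) \<partial>lborel) = integral\<^sup>L lborel f \<and> integrable lborel f"
    if bb: "box_bounded (\<lambda>p. f (snd p, fst p))" for f :: "real \<times> real \<Rightarrow> real"
  proof -
    have "box_bounded f"
    proof -
      obtain C S where *: "(\<lambda>p. f (snd p, fst p)) \<in> borel_measurable borel" "\<And>p. \<bar>f (snd p, fst p)\<bar> \<le> C"
        "bounded S" "\<And>p. p \<notin> S \<Longrightarrow> f (snd p, fst p) = 0"
        using bb unfolding box_bounded_def by blast
      have "(\<lambda>p. (\<lambda>p. f (snd p, fst p)) (snd p, fst p)) \<in> borel_measurable borel"
        using *(1) unfolding borel_prod[symmetric] by measurable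
      moreover have "bounded ((\<lambda>p. (snd p, fst p)) ` S)"
      proof (rule bounded_subset[of "(snd ` S) \<times> (fst ` S)"])
        show "bounded ((snd ` S) \<times> (fst ` S))" using *(3) by (intro bounded_Times bounded_fst bounded_snd)
      qed auto
      moreover have "f p = 0" if "p \<notin> (\<lambda>p. (snd p, fst p)) ` S" for p
        using *(4)[of "(snd p, fst p)"] that by force
      moreover have "\<bar>f p\<bar> \<le> C" for p using *(2)[of "(snd p, fst p)"] by simp
      ultimately show ?thesis unfolding box_bounded_def by auto
    qed
    then show ?thesis using box_bounded_Fubini(2) box_bounded_integrable by blast
  qed
  note swA = sw[of ?A, OF bbA] and swB = sw[of ?B, OF bbB]
  have "0 \<le> (\<integral>p. e p * (?X (fst p) * ?T' (snd p)) + F p * (?X' (fst p) * ?T (snd p)) \<partial>lborel)"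
    using assms by (intro trapezoid_inequality) auto
  also have "\<dots> \<le> (\<integral>p. ?A p + ?B p \<partial>lborel)"
  proof (rule integral_mono_AE)
    have Xc: "?X x = R * cutoff R x" for x using assms by (simp add: cutoff_def)
    have eqA: "e p * (?X (fst p) * ?T' (snd p)) = ?A p" for p unfolding Xc by (simp add: algebra_simps)
    have le: "\<bar>F p * (?X' (fst p) * ?T (snd p))\<bar> \<le> ?B p" for p
    proof (cases "fst p \<in> {-2 * R..2 * R} \<and> snd p \<in> {0<..<\<tau> + h}")
      case True
      then have cc: "cutoff (2 * R) (fst p) = 1" using assms by (intro cutoff_inside) auto
      have "\<bar>F p\<bar> * (\<bar>?X' (fst p)\<bar> * \<bar>?T (snd p)\<bar>) \<le> K * e p * (1 * h)"
        using assms trapezoid_bounds(1)[of "\<tau> - h" h h "snd p"] trapezoid_bounds(2)[of h "\<tau> - h" h "snd p"] K e_bounds[of p]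
        by (intro mult_mono trapezoid'_bound F_bound) auto
      then show ?thesis unfolding cc using True by (simp add: abs_mult algebra_simps)
    next
      case False
      have "?X' (fst p) = 0 \<or> ?T (snd p) = 0"
      proof (cases "fst p \<in> {-2 * R..2 * R}")
        case True
        then have "snd p \<le> 0 \<or> snd p \<ge> \<tau> + h" using False by auto
        then have "?T (snd p) = 0" using assms by (auto simp: trapezoid_def ramp_def)
        then show ?thesis by simp
      next
        case False
        then show ?thesis using trapezoid'_outside[of R "3 * R" "fst p" "-2 * R"] assms by auto
      qed
      moreover have "0 \<le> ?B p" using c(3)[of "fst p" p] assms K by simp
      ultimately show ?thesis by auto
    qed
    show "AE p in lborel. e p * (?X (fst p) * ?T' (snd p)) + F p * (?X' (fst p) * ?T (snd p)) \<le> ?A p + ?B p"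
      using le unfolding eqA by (intro AE_I2) (smt (verit))
    show "integrable lborel (\<lambda>p. ?A p + ?B p)"
      by (rule Bochner_Integration.integrable_add) (use swA swB in blast)+
    have "integrable lborel (\<lambda>p. F p * (?X' (fst p) * ?T (snd p)))"
    proof (rule Bochner_Integration.integrable_bound[of _ ?B])
      show "(\<lambda>p. F p * (?X' (fst p) * ?T (snd p))) \<in> borel_measurable lborel"
        unfolding measurable_lborel2 borel_prod[symmetric] by measurable
      show "AE p in lborel. norm (F p * (?X' (fst p) * ?T (snd p))) \<le> norm (?B p)"
        using order_trans[OF le abs_ge_self] by (intro AE_I2) (simp only: real_norm_def)
    qed (use swB in blast)
    then show "integrable lborel (\<lambda>p. e p * (?X (fst p) * ?T' (snd p)) + F p * (?X' (fst p) * ?T (snd p)))"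
      unfolding eqA by (rule Bochner_Integration.integrable_add[OF conjunct2[OF swA]])
  qed
  also have "\<dots> = integral\<^sup>L lborel ?A + integral\<^sup>L lborel ?B"
    by (rule Bochner_Integration.integral_add) (use swA swB in blast)+
  also have "integral\<^sup>L lborel ?A = (\<integral>t. (\<integral>x. ?A (x, t) \<partial>lborel) \<partial>lborel)"
    by (rule conjunct1[OF swA, symmetric])
  also have "\<dots> = (\<integral>t. R * (indicator {h<..<2 * h} t * local_mass e R t - indicator {\<tau><..<\<tau> + h} t * local_mass e R t) \<partial>lborel)"
  proof (rule Bochner_Integration.integral_cong[OF refl])
    fix t
    have "?T' t = indicator {h<..<2 * h} t - indicator {\<tau><..<\<tau> + h} t"
      by (auto simp: trapezoid'_def indicator_def)
    moreover have "(\<integral>x. ?A (x, t) \<partial>lborel) = R * (?T' t * local_mass e R t)"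
      by (simp add: local_mass_def)
    ultimately show "(\<integral>x. ?A (x, t) \<partial>lborel) = R * (indicator {h<..<2 * h} t * local_mass e R t - indicator {\<tau><..<\<tau> + h} t * local_mass e R t)"
      by (simp only: left_diff_distrib)
  qed
  also have "\<dots> = R * (integral {h..2 * h} (local_mass e R) - integral {\<tau>..\<tau> + h} (local_mass e R))"
  proof -
    have i: "integrable lborel (\<lambda>t. indicator {a<..<b} t * local_mass e R t)" for a b
      by (rule integrable_box[where C="4 * R * L" and S="{a..b}"])
        (use local_mass_abs[OF assms(1)] local_mass_measurable[OF assms(1)] L_nonneg assms(1) in \<open>auto simp: indicator_def\<close>)
    show ?thesis
      using i integral_Ioo_eq(2)[OF local_mass_measurable[OF assms(1)] local_mass_abs[OF assms(1)]] by simp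
  qed
  also have "integral\<^sup>L lborel ?B = (\<integral>t. (\<integral>x. ?B (x, t) \<partial>lborel) \<partial>lborel)"
    by (rule conjunct1[OF swB, symmetric])
  also have "\<dots> = (\<integral>t. h * K * (indicator {0<..<\<tau> + h} t * local_mass e (2 * R) t) \<partial>lborel)"
    by (simp add: local_mass_def)
  also have "\<dots> = h * K * integral {0..\<tau> + h} (local_mass e (2 * R))"
    using integral_Ioo_eq(2)[OF local_mass_measurable[OF R2] local_mass_abs[OF R2]] by simp
  finally show ?thesis using assms by (simp add: field_simps)
qed

text \<open>The bound is used twice: first with the trivial bound \<open>local_mass e (2 * R) \<le> 8 * R * L\<close>, which makes the
  local masses bounded uniformly in \<open>R\<close>, and then with that uniform bound, which makes the error
  vanish as \<open>R\<close> tends to infinity.\<close>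

lemma local_mass_limit:
  assumes init: "\<And>R \<epsilon>. R > 0 \<Longrightarrow> \<epsilon> > 0 \<Longrightarrow> \<exists>\<delta>>0. AE t in lborel. 0 < t \<and> t < \<delta> \<longrightarrow> local_mass e R t \<le> E\<^sub>0 + \<epsilon>"
    and "R > 0"
  shows "AE \<tau> in lborel. 0 < \<tau> \<longrightarrow> local_mass e R \<tau> \<le> E\<^sub>0 + (K / R) * integral {0..\<tau>} (local_mass e (2 * R))"
proof -
  have R2: "2 * R > 0" using assms by simp
  have "AE \<tau> in lborel. \<forall>\<epsilon>>0. \<exists>d>0. \<forall>h. 0 < h \<and> h < d \<longrightarrow>
      \<bar>integral {\<tau>..\<tau> + h} (local_mass e R) / h - local_mass e R \<tau>\<bar> < \<epsilon>"
    by (rule lebesgue_point_right) (rule local_mass_integrable[OF \<open>R > 0\<close>])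
  then show ?thesis
  proof eventually_elim
    case (elim \<tau>)
    show ?case
    proof (rule impI, rule field_le_epsilon)
      fix \<epsilon>' :: real assume "0 < \<tau>" "0 < \<epsilon>'"
      define \<epsilon> where "\<epsilon> = \<epsilon>' / 3"
      have \<epsilon>: "\<epsilon> > 0" using \<open>0 < \<epsilon>'\<close> by (simp add: \<epsilon>_def)
      obtain d where d: "d > 0" "\<And>h. 0 < h \<Longrightarrow> h < d \<Longrightarrow> \<bar>integral {\<tau>..\<tau> + h} (local_mass e R) / h - local_mass e R \<tau>\<bar> < \<epsilon>"
        using elim \<epsilon> by meson
      obtain \<delta> where \<delta>: "\<delta> > 0" "AE t in lborel. 0 < t \<and> t < \<delta> \<longrightarrow> local_mass e R t \<le> E\<^sub>0 + \<epsilon>"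
        using init[OF \<open>R > 0\<close> \<epsilon>] by blast
      \<comment> \<open>The mass on scale 2R is at most \<open>8 * R * L\<close>; times K/R this
        leaves 8 K L. The summand 1 makes \<open>M\<close> positive.\<close>
      define M where "M = K * (8 * L) + 1"
      have M: "M > 0" using K L_nonneg by (simp add: M_def add_nonneg_pos)
      \<comment> \<open>Below d for the Lebesgue point at \<tau>, 2h below \<delta> for the initial
        window, h below \<tau> for the growth estimate, and so small that the extra term 8 h K L is
        at most \<epsilon>.\<close>
      define h where "h = min (min (d / 2) (\<delta> / 3)) (min (\<tau> / 2) (\<epsilon> / M))"
      have h: "0 < h" "h < d" "2 * h < \<delta>" "h < \<tau>" "h \<le> \<epsilon> / M"
      proof -
        have "0 < \<epsilon> / M" using \<epsilon> M by simp
        then show "0 < h" "h < d" "2 * h < \<delta>" "h < \<tau>" "h \<le> \<epsilon> / M"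
          using d(1) \<delta>(1) \<open>0 < \<tau>\<close> unfolding h_def by linarith+
      qed
      have 1: "integral {h..2 * h} (local_mass e R) \<le> h * (E\<^sub>0 + \<epsilon>)"
      proof -
        have "integral {h..2 * h} (local_mass e R) = (\<integral>t. indicator {h<..<2 * h} t * local_mass e R t \<partial>lborel)"
          using integral_Ioo_eq(2)[OF local_mass_measurable[OF assms(2)] local_mass_abs[OF assms(2)]] by simp
        also have "\<dots> \<le> (\<integral>t. indicator {h<..<2 * h} t * (E\<^sub>0 + \<epsilon>) \<partial>lborel)"
        proof (rule integral_mono_AE)
          show "integrable lborel (\<lambda>t. indicator {h<..<2 * h} t * local_mass e R t)"
            by (rule integrable_box[where C="4 * R * L" and S="{h..2 * h}"])
              (use local_mass_abs[OF assms(2)] local_mass_measurable[OF assms(2)] L_nonneg assms(2) in \<open>auto simp: indicator_def\<close>)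
          show "AE t in lborel. indicator {h<..<2 * h} t * local_mass e R t \<le> indicator {h<..<2 * h} t * (E\<^sub>0 + \<epsilon>)"
            using \<delta>(2) by eventually_elim (use h in \<open>auto simp: indicator_def\<close>)
          show "integrable lborel (\<lambda>t. indicator {h<..<2 * h} t * (E\<^sub>0 + \<epsilon>))"
            by (rule integrable_box[where C="\<bar>E\<^sub>0 + \<epsilon>\<bar>" and S="{h..2 * h}"]) (auto simp: indicator_def)
        qed
        also have "\<dots> = h * (E\<^sub>0 + \<epsilon>)" using h(1) by simp
        finally show ?thesis .
      qed
      have 2: "integral {0..\<tau> + h} (local_mass e (2 * R)) \<le> integral {0..\<tau>} (local_mass e (2 * R)) + h * (8 * R * L)"
      proof -
        have "integral {0..\<tau> + h} (local_mass e (2 * R)) = integral {0..\<tau>} (local_mass e (2 * R)) + integral {\<tau>..\<tau> + h} (local_mass e (2 * R))"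
          by (rule Henstock_Kurzweil_Integration.integral_combine[symmetric])
            (use h \<open>0 < \<tau>\<close> local_mass_integrable[OF R2] in auto)
        also have "integral {\<tau>..\<tau> + h} (local_mass e (2 * R)) \<le> integral {\<tau>..\<tau> + h} (\<lambda>_. 4 * (2 * R) * L)"
          by (rule integral_le) (use local_mass_integrable[OF R2] local_mass_le[OF R2] in auto)
        also have "\<dots> = h * (8 * R * L)" using h by simp
        finally show ?thesis by simp
      qed
      have "integral {\<tau>..\<tau> + h} (local_mass e R) \<le> h * (E\<^sub>0 + \<epsilon>) + h * (K / R) * (integral {0..\<tau>} (local_mass e (2 * R)) + h * (8 * R * L))"
      proof -
        have "0 \<le> h * (K / R)" using K h(1) assms(2) by simp
        from mult_left_mono[OF 2 this] local_mass_growth[OF assms(2) h(1) h(4)] 1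
        show ?thesis by linarith
      qed
      also have "\<dots> = h * (E\<^sub>0 + \<epsilon> + (K / R) * integral {0..\<tau>} (local_mass e (2 * R)) + h * (K * (8 * L)))"
        using assms(2) by (simp add: field_simps)
      finally have "integral {\<tau>..\<tau> + h} (local_mass e R) / h \<le> E\<^sub>0 + \<epsilon> + (K / R) * integral {0..\<tau>} (local_mass e (2 * R)) + h * (K * (8 * L))"
        using h(1) by (simp add: pos_divide_le_eq mult.commute)
      moreover have "h * (K * (8 * L)) \<le> \<epsilon>"
      proof -
        have "h * (K * (8 * L)) \<le> h * M" using h(1) by (intro mult_left_mono) (auto simp: M_def)
        also have "\<dots> \<le> \<epsilon>" using h(5) M by (simp add: pos_le_divide_eq)
        finally show ?thesis .
      qed
      ultimately show "local_mass e R \<tau> \<le> E\<^sub>0 + (K / R) * integral {0..\<tau>} (local_mass e (2 * R)) + \<epsilon>'"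
        using d(2)[OF h(1,2)] unfolding \<epsilon>_def by linarith
    qed
  qed
qed

lemma contraction:
  assumes init: "\<And>R \<epsilon>. R > 0 \<Longrightarrow> \<epsilon> > 0 \<Longrightarrow> \<exists>\<delta>>0. AE t in lborel. 0 < t \<and> t < \<delta> \<longrightarrow> local_mass e R t \<le> E\<^sub>0 + \<epsilon>"
  shows "AE \<tau> in lborel. 0 < \<tau> \<longrightarrow> (\<forall>n::nat. (\<integral>x. indicator {- real n..real n} x * e (x, \<tau>) \<partial>lborel) \<le> E\<^sub>0)"
proof -
  \<comment> \<open>Restriction to integer radii leaves only countably many exceptional null
    sets.\<close>
  have lim: "AE \<tau> in lborel. \<forall>n. 0 < \<tau> \<longrightarrow> local_mass e (real (Suc n)) \<tau> \<le>
      E\<^sub>0 + (K / real (Suc n)) * integral {0..\<tau>} (local_mass e (2 * real (Suc n)))"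
    unfolding AE_all_countable by (rule allI, rule local_mass_limit[OF init]) auto
  have first: "AE \<tau> in lborel. \<forall>n. 0 < \<tau> \<longrightarrow> local_mass e (real (Suc n)) \<tau> \<le> E\<^sub>0 + 8 * K * L * \<tau>"
    using lim
  proof eventually_elim
    case (elim \<tau>)
    show ?case
    proof (intro allI impI)
      fix n assume "0 < \<tau>"
      let ?R = "real (Suc n)"
      have "integral {0..\<tau>} (local_mass e (2 * ?R)) \<le> integral {0..\<tau>} (\<lambda>_. 4 * (2 * ?R) * L)"
        by (rule integral_le) (use local_mass_integrable[of "2 * ?R"] local_mass_le[of "2 * ?R"] in auto)
      also have "\<dots> = \<tau> * (8 * ?R * L)" using \<open>0 < \<tau>\<close> by simp
      finally have "(K / ?R) * integral {0..\<tau>} (local_mass e (2 * ?R)) \<le> (K / ?R) * (\<tau> * (8 * ?R * L))"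
        using K by (intro mult_left_mono) auto
      also have "\<dots> = 8 * K * L * \<tau>" by (simp del: of_nat_Suc)
      finally show "local_mass e ?R \<tau> \<le> E\<^sub>0 + 8 * K * L * \<tau>"
        using spec[OF elim, of n] \<open>0 < \<tau>\<close> by linarith
    qed
  qed
  show ?thesis
    using lim
  proof eventually_elim
    case (elim \<tau>)
    show ?case
    proof (intro allI impI)
      fix n :: nat assume "0 < \<tau>"
      define C where "C = K * (\<tau> * (\<bar>E\<^sub>0\<bar> + 8 * K * L * \<tau>))"
      have *: "local_mass e (real (Suc m)) \<tau> \<le> E\<^sub>0 + C * inverse (real (Suc m))" for m
      proof -
        let ?R = "real (Suc m)"
        have R2: "2 * ?R > 0" by simp
        have "integral {0..\<tau>} (local_mass e (2 * ?R)) = (\<integral>t. indicator {0<..<\<tau>} t * local_mass e (2 * ?R) t \<partial>lborel)"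
          using integral_Ioo_eq(2)[OF local_mass_measurable[OF R2] local_mass_abs[OF R2]] by simp
        also have "\<dots> \<le> (\<integral>t. indicator {0<..<\<tau>} t * (\<bar>E\<^sub>0\<bar> + 8 * K * L * \<tau>) \<partial>lborel)"
        proof (rule integral_mono_AE)
          show "integrable lborel (\<lambda>t. indicator {0<..<\<tau>} t * local_mass e (2 * ?R) t)"
            by (rule integrable_box[where C="4 * (2 * ?R) * L" and S="{0..\<tau>}"])
              (use local_mass_abs[OF R2] local_mass_measurable[OF R2] L_nonneg in \<open>auto simp: indicator_def\<close>)
          show "AE t in lborel. indicator {0<..<\<tau>} t * local_mass e (2 * ?R) t \<le> indicator {0<..<\<tau>} t * (\<bar>E\<^sub>0\<bar> + 8 * K * L * \<tau>)"
            using first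
          proof eventually_elim
            case (elim t)
            show ?case
            proof (cases "t \<in> {0<..<\<tau>}")
              case True
              \<comment> \<open>The doubled radius is again an integer radius, of index 2 m + 1, so
                the uniform bound \<open>first\<close> covers it.\<close>
              have "2 * ?R = real (Suc (2 * m + 1))" by simp
              then have "local_mass e (2 * ?R) t \<le> E\<^sub>0 + 8 * K * L * t" using elim True by (metis greaterThanLessThan_iff)
              also have "\<dots> \<le> \<bar>E\<^sub>0\<bar> + 8 * K * L * \<tau>"
                using True K L_nonneg by (intro add_mono mult_left_mono) auto
              finally show ?thesis using True by simp
            qed simp
          qed
          show "integrable lborel (\<lambda>t. indicator {0<..<\<tau>} t * (\<bar>E\<^sub>0\<bar> + 8 * K * L * \<tau>))"
            by (rule integrable_box[where C="\<bar>\<bar>E\<^sub>0\<bar> + 8 * K * L * \<tau>\<bar>" and S="{0..\<tau>}"]) (auto simp: indicator_def)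
        qed
        also have "\<dots> = \<tau> * (\<bar>E\<^sub>0\<bar> + 8 * K * L * \<tau>)" using \<open>0 < \<tau>\<close> by simp
        finally have "(K / ?R) * integral {0..\<tau>} (local_mass e (2 * ?R)) \<le> (K / ?R) * (\<tau> * (\<bar>E\<^sub>0\<bar> + 8 * K * L * \<tau>))"
          using K by (intro mult_left_mono) auto
        also have "\<dots> = C * inverse ?R" by (simp add: C_def divide_inverse)
        finally show ?thesis using spec[OF elim, of m] \<open>0 < \<tau>\<close> by linarith
      qed
      let ?I = "\<integral>x. indicator {- real n..real n} x * e (x, \<tau>) \<partial>lborel"
      \<comment> \<open>For m \<ge> n the cutoff of radius m + 1 is 1 on [-n, n]. The left-hand side
        does not depend on m, so the error disappears as m grows.\<close>
      have le: "?I \<le> E\<^sub>0 + C * inverse (real (Suc m))" if "m \<ge> n" for m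
      proof -
        have "?I \<le> local_mass e (real (Suc m)) \<tau>"
          unfolding local_mass_def
        proof (rule integral_mono')
          fix x
          show "indicator {- real n..real n} x * e (x, \<tau>) \<le> cutoff (real (Suc m)) x * e (x, \<tau>)"
          proof (cases "x \<in> {- real n..real n}")
            case True
            then have "cutoff (real (Suc m)) x = 1" using that by (intro cutoff_inside) auto
            then show ?thesis using True by simp
          next
            case False
            then show ?thesis using cutoff_bounds(1)[of "real (Suc m)" x] e_bounds(1) by simp
          qed
          show "0 \<le> cutoff (real (Suc m)) x * e (x, \<tau>)"
            using cutoff_bounds(1)[of "real (Suc m)" x] e_bounds(1) by simp
        qed (rule slice_integrable, simp)
        then show ?thesis using *[of m] by linarith
      qed
      have "(\<lambda>m. E\<^sub>0 + C * inverse (real (Suc m))) \<longlonglongrightarrow> E\<^sub>0 + C * 0"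
        by (intro tendsto_intros LIMSEQ_inverse_real_of_nat)
      then show "?I \<le> E\<^sub>0" using le by (intro LIMSEQ_le_const[of _ "E\<^sub>0 + C * 0", simplified]) auto
    qed
  qed
qed

end

section \<open>Viscous approximations\<close>

definition hl_cost :: "(real \<Rightarrow> real) \<Rightarrow> real \<Rightarrow> real \<Rightarrow> real \<Rightarrow> real" where
  "hl_cost A x t y = A y + (x - y)\<^sup>2 / (2 * t)"

definition gibbs_moment :: "(real \<Rightarrow> real) \<Rightarrow> real \<Rightarrow> real set \<Rightarrow> nat \<Rightarrow> real \<Rightarrow> real \<Rightarrow> real" where
  "gibbs_moment A N Y k x t = (\<Sum>y\<in>Y. ((x - y) / t) ^ k * exp (- (N * hl_cost A x t y)))"

text \<open>The Cole-Hopf transform -(1/N) d/dx log Z of Z = \<open>gibbs_moment A N Y 0\<close>. Up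
  to a factor t^(-1/2), which the logarithmic derivative in x does not see, Z is a positive
  combination of heat kernels of viscosity 1/(2N). The quotient is also the Gibbs mean of the
  velocity (x - y)/t.\<close>

definition viscous_burgers :: "(real \<Rightarrow> real) \<Rightarrow> real \<Rightarrow> real set \<Rightarrow> real \<Rightarrow> real \<Rightarrow> real" where
  "viscous_burgers A N Y x t = gibbs_moment A N Y 1 x t / gibbs_moment A N Y 0 x t"

lemma hl_cost_dx: "t > 0 \<Longrightarrow> ((\<lambda>x. hl_cost A x t y) has_real_derivative (x - y) / t) (at x)"
  unfolding hl_cost_def by (auto intro!: derivative_eq_intros simp: field_simps)

lemma hl_cost_dt: "t > 0 \<Longrightarrow> ((\<lambda>t. hl_cost A x t y) has_real_derivative - (((x - y) / t)\<^sup>2 / 2)) (at t)"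
  unfolding hl_cost_def by (auto intro!: derivative_eq_intros simp: field_simps power2_eq_square)

text \<open>Differentiating the power lowers the moment, differentiating the Gibbs weight raises it.
  For k = 0 the truncated \<open>k - 1\<close> is harmless, as its coefficient vanishes.\<close>

lemma gibbs_moment_dx:
  assumes "t > 0"
  shows "((\<lambda>x. gibbs_moment A N Y k x t) has_real_derivative
    real k / t * gibbs_moment A N Y (k - 1) x t - N * gibbs_moment A N Y (Suc k) x t) (at x)"
proof -
  have "((\<lambda>x. ((x - y) / t) ^ k * exp (- (N * hl_cost A x t y))) has_real_derivative
    real k / t * (((x - y) / t) ^ (k - 1) * exp (- (N * hl_cost A x t y)))
     - N * (((x - y) / t) ^ Suc k * exp (- (N * hl_cost A x t y)))) (at x)" for y
  proof -
    define v where "v = (x - y) / t"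
    have 1: "((\<lambda>x. (x - y) / t) has_real_derivative 1 / t) (at x)"
      using assms by (auto intro!: derivative_eq_intros)
    have 2: "((\<lambda>x. exp (- (N * hl_cost A x t y))) has_real_derivative
        exp (- (N * hl_cost A x t y)) * - (N * v)) (at x)"
      unfolding v_def by (intro DERIV_chain2[OF DERIV_exp] DERIV_minus DERIV_cmult hl_cost_dx assms)
    show ?thesis
      by (rule DERIV_cong[OF DERIV_mult[OF DERIV_power[OF 1, of k] 2]])
        (simp add: v_def[symmetric] algebra_simps)
  qed
  then show ?thesis
    unfolding gibbs_moment_def sum_distrib_left sum_subtractf[symmetric] by (intro DERIV_sum) auto
qed

lemma gibbs_moment_dt:
  assumes "t > 0"
  shows "((\<lambda>t. gibbs_moment A N Y k x t) has_real_derivative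
    N / 2 * gibbs_moment A N Y (k + 2) x t - real k / t * gibbs_moment A N Y k x t) (at t)"
proof -
  have "((\<lambda>t. ((x - y) / t) ^ k * exp (- (N * hl_cost A x t y))) has_real_derivative
    N / 2 * (((x - y) / t) ^ (k + 2) * exp (- (N * hl_cost A x t y)))
     - real k / t * (((x - y) / t) ^ k * exp (- (N * hl_cost A x t y)))) (at t)" for y
  proof -
    define v where "v = (x - y) / t"
    have 1: "((\<lambda>t. (x - y) / t) has_real_derivative - (v / t)) (at t)"
      using assms by (auto intro!: derivative_eq_intros simp: v_def field_simps)
    have 2: "((\<lambda>t. exp (- (N * hl_cost A x t y))) has_real_derivative
        exp (- (N * hl_cost A x t y)) * - (N * - (v\<^sup>2 / 2))) (at t)"
      unfolding v_def by (intro DERIV_chain2[OF DERIV_exp] DERIV_minus DERIV_cmult hl_cost_dt assms)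
    show ?thesis
      by (rule DERIV_cong[OF DERIV_mult[OF DERIV_power[OF 1, of k] 2]], fold v_def, cases k)
        (simp_all add: power_add algebra_simps power2_eq_square)
  qed
  then show ?thesis
    unfolding gibbs_moment_def sum_distrib_left sum_subtractf[symmetric] by (intro DERIV_sum) auto
qed

lemma gibbs_moment_continuous: "continuous_on half_plane (\<lambda>p. gibbs_moment A N Y k (fst p) (snd p))"
  unfolding gibbs_moment_def hl_cost_def half_plane_def by (intro continuous_intros) auto

lemma gibbs_moment_0_pos: "finite Y \<Longrightarrow> Y \<noteq> {} \<Longrightarrow> gibbs_moment A N Y 0 x t > 0"
  unfolding gibbs_moment_def by (intro sum_pos) auto

locale viscous =
  fixes A :: "real \<Rightarrow> real" and N :: real and Y :: "real set"
  assumes Y: "finite Y" "Y \<noteq> {}"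
begin

abbreviation "u \<equiv> viscous_burgers A N Y"

definition "b x t = gibbs_moment A N Y 2 x t / gibbs_moment A N Y 0 x t"
definition "c x t = gibbs_moment A N Y 3 x t / gibbs_moment A N Y 0 x t"
text \<open>With \<open>u\<close>, \<open>b\<close>, \<open>c\<close> the first three moments of the
  Gibbs velocity, \<open>ux\<close> is 1/t minus N times its variance and \<open>uxx\<close> is N^2
  times its third central moment.\<close>

definition "ux x t = 1 / t - N * (b x t - (u x t)\<^sup>2)"
definition "uxx x t = N\<^sup>2 * (c x t - 3 * u x t * b x t + 2 * (u x t) ^ 3)"
definition "ut x t = N / 2 * (c x t - u x t * b x t) - u x t / t"

text \<open>The terms u/t cancel, and both sides are N/2 times the third central moment of the
  velocity.\<close>

lemma burgers_identity: "N \<noteq> 0 \<Longrightarrow> ut x t + u x t * ux x t = 1 / (2 * N) * uxx x t"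
  unfolding ut_def ux_def uxx_def by (simp add: field_simps power2_eq_square power3_eq_cube)

text \<open>The quotient rule: the denominator has logarithmic derivative -N u, which contributes
  the last term.\<close>

lemma quotient_dx:
  assumes "t > 0"
  shows "((\<lambda>x. gibbs_moment A N Y k x t / gibbs_moment A N Y 0 x t) has_real_derivative
     real k / t * (gibbs_moment A N Y (k - 1) x t / gibbs_moment A N Y 0 x t)
     - N * (gibbs_moment A N Y (Suc k) x t / gibbs_moment A N Y 0 x t)
     + N * u x t * (gibbs_moment A N Y k x t / gibbs_moment A N Y 0 x t)) (at x)"
proof -
  have p: "gibbs_moment A N Y 0 x t > 0" by (rule gibbs_moment_0_pos[OF Y])
  show ?thesis
    by (rule DERIV_cong[OF DERIV_divide[OF gibbs_moment_dx[OF assms] gibbs_moment_dx[OF assms]]])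
      (use p in \<open>simp_all add: viscous_burgers_def field_simps\<close>)
qed

lemma u_dx: "t > 0 \<Longrightarrow> ((\<lambda>x. u x t) has_real_derivative ux x t) (at x)"
  unfolding viscous_burgers_def ux_def b_def
  by (rule DERIV_cong[OF quotient_dx], assumption)
    (use gibbs_moment_0_pos[OF Y, of A N x t] in
      \<open>simp add: viscous_burgers_def algebra_simps power2_eq_square numeral_2_eq_2\<close>)

lemma b_dx: "t > 0 \<Longrightarrow> ((\<lambda>x. b x t) has_real_derivative 2 / t * u x t - N * c x t + N * u x t * b x t) (at x)"
  unfolding b_def c_def
  by (rule DERIV_cong[OF quotient_dx]) (simp_all add: viscous_burgers_def numeral_3_eq_3 numeral_2_eq_2)

lemma ux_dx: "t > 0 \<Longrightarrow> ((\<lambda>x. ux x t) has_real_derivative uxx x t) (at x)"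
  unfolding ux_def[abs_def]
  by (rule DERIV_cong, (rule derivative_intros u_dx b_dx | assumption)+)
    (simp add: ux_def uxx_def algebra_simps power2_eq_square power3_eq_cube)

lemma u_dt: "t > 0 \<Longrightarrow> ((\<lambda>t. u x t) has_real_derivative ut x t) (at t)"
proof -
  assume t: "t > 0"
  have p: "gibbs_moment A N Y 0 x t > 0" by (rule gibbs_moment_0_pos[OF Y])
  show ?thesis
    unfolding viscous_burgers_def[abs_def]
    by (rule DERIV_cong[OF DERIV_divide[OF gibbs_moment_dt[OF t] gibbs_moment_dt[OF t]]])
      (use p t in \<open>simp_all add: ut_def b_def c_def viscous_burgers_def field_simps numeral_3_eq_3 numeral_2_eq_2\<close>)
qed

lemma continuity:
  "continuous_on half_plane (\<lambda>p. u (fst p) (snd p))"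
  "continuous_on half_plane (\<lambda>p. ux (fst p) (snd p))"
  "continuous_on half_plane (\<lambda>p. uxx (fst p) (snd p))"
  "continuous_on half_plane (\<lambda>p. ut (fst p) (snd p))"
proof -
  have p: "gibbs_moment A N Y 0 x t \<noteq> 0" for x t using gibbs_moment_0_pos[OF Y, of A N x t] by simp
  have t: "snd p \<noteq> 0" if "p \<in> half_plane" for p using that by (auto simp: half_plane_def)
  have u: "continuous_on half_plane (\<lambda>p. u (fst p) (snd p))"
    unfolding viscous_burgers_def by (intro continuous_intros gibbs_moment_continuous) (auto simp: p)
  have b: "continuous_on half_plane (\<lambda>p. b (fst p) (snd p))"
    unfolding b_def by (intro continuous_intros gibbs_moment_continuous) (auto simp: p)
  have c: "continuous_on half_plane (\<lambda>p. c (fst p) (snd p))"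
    unfolding c_def by (intro continuous_intros gibbs_moment_continuous) (auto simp: p)
  show "continuous_on half_plane (\<lambda>p. u (fst p) (snd p))" by (rule u)
  show "continuous_on half_plane (\<lambda>p. ux (fst p) (snd p))"
    "continuous_on half_plane (\<lambda>p. uxx (fst p) (snd p))"
    "continuous_on half_plane (\<lambda>p. ut (fst p) (snd p))"
    unfolding ux_def uxx_def ut_def by (intro continuous_intros u b c; simp add: t)+
qed

end

text \<open>\<open>test_function\<close> hides the partial derivatives behind existential
  quantifiers. They are extracted here as far as \<open>\<theta>xx\<close>, which the viscous term
  requires, with one compact set outside of which all of them vanish.\<close>

lemma test_function_partials:
  assumes "test_function \<theta>"
  obtains \<theta>x \<theta>t \<theta>xx S where "compact S" "S \<subseteq> half_plane"
    "\<And>x t. ((\<lambda>y. \<theta> (y, t)) has_real_derivative \<theta>x (x, t)) (at x)"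
    "\<And>x t. ((\<lambda>y. \<theta>x (y, t)) has_real_derivative \<theta>xx (x, t)) (at x)"
    "\<And>x t. ((\<lambda>s. \<theta> (x, s)) has_real_derivative \<theta>t (x, t)) (at t)"
    "continuous_on UNIV \<theta>" "continuous_on UNIV \<theta>x" "continuous_on UNIV \<theta>t" "continuous_on UNIV \<theta>xx"
    "\<And>p. p \<notin> S \<Longrightarrow> \<theta> p = 0 \<and> \<theta>x p = 0 \<and> \<theta>t p = 0 \<and> \<theta>xx p = 0"
proof -
  have partials: "((\<lambda>y. f (y, t)) has_real_derivative fx (x, t)) (at x)" "((\<lambda>s. f (x, s)) has_real_derivative ft (x, t)) (at t)"
    if "\<And>p. (f has_derivative (\<lambda>h. fx p * fst h + ft p * snd h)) (at p)" for f fx ft :: "real \<times> real \<Rightarrow> real" and x t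
  proof -
    have "((\<lambda>y. (y, t)) has_derivative (\<lambda>h. (h, 0))) (at x)" "((\<lambda>s. (x, s)) has_derivative (\<lambda>h. (0, h))) (at t)"
      by (auto intro!: derivative_eq_intros)
    from has_derivative_compose[OF this(1) that] has_derivative_compose[OF this(2) that]
    show "((\<lambda>y. f (y, t)) has_real_derivative fx (x, t)) (at x)" "((\<lambda>s. f (x, s)) has_real_derivative ft (x, t)) (at t)"
      by (simp_all add: has_field_derivative_def)
  qed
  define S where "S = closure {p. \<theta> p \<noteq> 0}"
  have S: "compact S" "S \<subseteq> half_plane" using assms by (auto simp: test_function_def S_def)
  have "C_k (Suc 1) \<theta>" using assms unfolding test_function_def by blast
  then obtain \<theta>x \<theta>t where 1: "\<And>p. (\<theta> has_derivative (\<lambda>h. \<theta>x p * fst h + \<theta>t p * snd h)) (at p)" "C_k 1 \<theta>x" "C_k 1 \<theta>t"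
    unfolding C_k.simps(2) by blast
  from 1(2) obtain \<theta>xx \<theta>xt where 2: "\<And>p. (\<theta>x has_derivative (\<lambda>h. \<theta>xx p * fst h + \<theta>xt p * snd h)) (at p)" "C_k 0 \<theta>xx"
    unfolding One_nat_def C_k.simps(2) by blast
  from 1(3) obtain \<theta>tx \<theta>tt where 3: "\<And>p. (\<theta>t has_derivative (\<lambda>h. \<theta>tx p * fst h + \<theta>tt p * snd h)) (at p)"
    unfolding One_nat_def C_k.simps(2) by blast
  have o: "open (- S)" by (simp add: S_def open_Compl)
  \<comment> \<open>The complement of \<open>S\<close> is open, so on the coordinate line through p
    the function is locally 0 and so is its derivative.\<close>
  have z: "g p = 0" if "p \<notin> S" "\<And>q. q \<notin> S \<Longrightarrow> f q = 0" "((\<lambda>y. f (y, snd p)) has_real_derivative g p) (at (fst p))" for f g p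
  proof -
    have "((\<lambda>y. 0) has_real_derivative 0) (at (fst p))" by simp
    moreover have "open ((\<lambda>y. (y, snd p)) -` (- S))" by (intro open_vimage o continuous_intros)
    moreover have "fst p \<in> (\<lambda>y. (y, snd p)) -` (- S)" using that(1) by simp
    moreover have "0 = f (y, snd p)" if "y \<in> (\<lambda>y. (y, snd p)) -` (- S)" for y
      using that \<open>\<And>q. q \<notin> S \<Longrightarrow> f q = 0\<close>[of "(y, snd p)"] by simp
    ultimately have "((\<lambda>y. f (y, snd p)) has_real_derivative 0) (at (fst p))"
      by - (rule has_field_derivative_transform_within_open)
    from DERIV_unique[OF that(3) this] show ?thesis .
  qed
  have zt: "g p = 0" if "p \<notin> S" "\<And>q. q \<notin> S \<Longrightarrow> f q = 0" "((\<lambda>s. f (fst p, s)) has_real_derivative g p) (at (snd p))" for f g p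
  proof -
    have "((\<lambda>y. 0) has_real_derivative 0) (at (snd p))" by simp
    moreover have "open ((\<lambda>s. (fst p, s)) -` (- S))" by (intro open_vimage o continuous_intros)
    moreover have "snd p \<in> (\<lambda>s. (fst p, s)) -` (- S)" using that(1) by simp
    moreover have "0 = f (fst p, s)" if "s \<in> (\<lambda>s. (fst p, s)) -` (- S)" for s
      using that \<open>\<And>q. q \<notin> S \<Longrightarrow> f q = 0\<close>[of "(fst p, s)"] by simp
    ultimately have "((\<lambda>s. f (fst p, s)) has_real_derivative 0) (at (snd p))"
      by - (rule has_field_derivative_transform_within_open)
    from DERIV_unique[OF that(3) this] show ?thesis .
  qed
  have z0: "\<theta> p = 0" if "p \<notin> S" for p using that closure_subset[of "{p. \<theta> p \<noteq> 0}"] by (auto simp: S_def)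
  have zx: "\<theta>x p = 0" if "p \<notin> S" for p
    using z[OF that z0] partials(1)[of \<theta> \<theta>x \<theta>t "snd p" "fst p"] 1(1) by simp
  have zxx: "\<theta>xx p = 0" if "p \<notin> S" for p
    using z[OF that zx] partials(1)[of \<theta>x \<theta>xx \<theta>xt "snd p" "fst p"] 2(1) by simp
  have ztt: "\<theta>t p = 0" if "p \<notin> S" for p
    using zt[OF that z0] partials(2)[of \<theta> \<theta>x \<theta>t "fst p" "snd p"] 1(1) by simp
  have cont: "continuous_on UNIV f" if "\<And>p. (f has_derivative D p) (at p)" for f :: "real \<times> real \<Rightarrow> real" and D
    using that by (intro continuous_at_imp_continuous_on) (auto intro: has_derivative_continuous)
  show ?thesis
  proof (rule that[OF S])
    show "((\<lambda>y. \<theta> (y, t)) has_real_derivative \<theta>x (x, t)) (at x)"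
      "((\<lambda>s. \<theta> (x, s)) has_real_derivative \<theta>t (x, t)) (at t)" for x t by (rule partials[OF 1(1)])+
    show "((\<lambda>y. \<theta>x (y, t)) has_real_derivative \<theta>xx (x, t)) (at x)" for x t by (rule partials[OF 2(1)])
    show "continuous_on UNIV \<theta>" "continuous_on UNIV \<theta>x" "continuous_on UNIV \<theta>t"
      by (rule cont[OF 1(1)], rule cont[OF 2(1)], rule cont[OF 3])
    show "continuous_on UNIV \<theta>xx" using 2(2) by simp
  qed (use z0 zx zxx ztt in blast)
qed

text \<open>\<open>g\<close> may be singular at t = 0. The product is nevertheless continuous on the
  whole plane, which is covered by the two open sets \<open>half_plane\<close> and
  \<open>- S\<close>.\<close>

lemma box_bounded_mult_support:
  assumes "continuous_on half_plane g" "continuous_on UNIV \<theta>" "compact S" "S \<subseteq> half_plane" "\<And>p. p \<notin> S \<Longrightarrow> \<theta> p = (0::real)"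
  shows "box_bounded (\<lambda>p. g p * \<theta> p)"
proof -
  have o: "open half_plane" "open (- S)" unfolding half_plane_def
    by (auto intro: open_Times) (use assms(3) compact_imp_closed in auto)
  have "continuous_on (half_plane \<union> - S) (\<lambda>p. g p * \<theta> p)"
  proof (rule continuous_on_open_Un[OF o])
    show "continuous_on half_plane (\<lambda>p. g p * \<theta> p)"
      by (intro continuous_intros assms continuous_on_subset[OF assms(2)]) auto
    have "continuous_on (- S) (\<lambda>_. 0 :: real)" by simp
    then show "continuous_on (- S) (\<lambda>p. g p * \<theta> p)"
      by (rule continuous_on_eq) (use assms(5) in auto)
  qed
  moreover have "half_plane \<union> - S = UNIV" using assms(4) by auto
  ultimately have c: "continuous_on UNIV (\<lambda>p. g p * \<theta> p)" by simp
  have "compact ((\<lambda>p. g p * \<theta> p) ` S)" using assms(3) by (intro compact_continuous_image continuous_on_subset[OF c]) auto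
  then obtain B where B: "\<forall>y\<in>(\<lambda>p. g p * \<theta> p) ` S. norm y \<le> B" by (meson bounded_iff compact_imp_bounded)
  show ?thesis
    unfolding box_bounded_def
  proof (intro conjI exI[of _ S] exI[of _ "\<bar>B\<bar>"] allI impI)
    show "(\<lambda>p. g p * \<theta> p) \<in> borel_measurable borel" by (rule borel_measurable_continuous_onI[OF c])
    show "\<bar>g p * \<theta> p\<bar> \<le> \<bar>B\<bar>" for p using B assms(5)[of p] 
    proof (cases "p \<in> S")
      case True
      then have "norm (g p * \<theta> p) \<le> B" using B by blast
      then show ?thesis by simp
    next
      case False
      then show ?thesis using assms(5)[OF False] by simp
    qed
  qed (use assms compact_imp_bounded in auto)
qed

section \<open>Entropy balance of the viscous approximations\<close>

lemma integral_derivative_zero: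
  fixes P P' :: "real \<Rightarrow> real"
  assumes "box_bounded P'" "l \<le> r" "\<And>t. t \<in> {l..r} \<Longrightarrow> (P has_real_derivative P' t) (at t)"
    "P l = 0" "P r = 0" "\<And>t. t \<notin> {l..r} \<Longrightarrow> P' t = 0"
  shows "integral\<^sup>L lborel P' = 0"
proof -
  have "(P' has_integral (P r - P l)) {l..r}"
    using assms(2,3) by (intro fundamental_theorem_of_calculus)
      (auto intro: has_field_derivative_at_within simp: has_real_derivative_iff_has_vector_derivative[symmetric])
  then have "(P' has_integral 0) {l..r}" by (simp only: assms(4,5) diff_self)
  then have "(P' has_integral 0) UNIV"
    by (rule has_integral_on_superset) (rule assms(6), assumption, simp)
  then have "integral UNIV P' = 0" by (rule integral_unique)
  then show ?thesis using integral_lborel[OF box_bounded_integrable[OF assms(1)]] by simp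
qed

lemma box_bounded_add: "box_bounded f \<Longrightarrow> box_bounded g \<Longrightarrow> box_bounded (\<lambda>p. f p + g p)"
proof -
  assume a: "box_bounded f" "box_bounded g"
  obtain C S where f: "f \<in> borel_measurable borel" "\<And>p. \<bar>f p\<bar> \<le> C" "bounded S" "\<And>p. p \<notin> S \<Longrightarrow> f p = 0"
    using a(1) unfolding box_bounded_def by blast
  obtain D T where g: "g \<in> borel_measurable borel" "\<And>p. \<bar>g p\<bar> \<le> D" "bounded T" "\<And>p. p \<notin> T \<Longrightarrow> g p = 0"
    using a(2) unfolding box_bounded_def by blast
  show ?thesis
    unfolding box_bounded_def
  proof (intro conjI exI[of _ "S \<union> T"] exI[of _ "C + D"] allI impI)
    show "\<bar>f p + g p\<bar> \<le> C + D" for p using f(2)[of p] g(2)[of p] by linarith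
  qed (use f g in auto)
qed

lemma compact_half_plane_bounds:
  assumes "compact S" "S \<subseteq> half_plane"
  obtains R t0 where "0 < t0" "\<And>p. p \<in> S \<Longrightarrow> \<bar>fst p\<bar> \<le> R \<and> t0 \<le> snd p \<and> snd p \<le> R"
proof -
  obtain R where R: "\<And>p. p \<in> S \<Longrightarrow> norm p \<le> R" using compact_imp_bounded[OF assms(1)] by (auto simp: bounded_iff)
  have n: "\<bar>fst p\<bar> \<le> R \<and> snd p \<le> R" if "p \<in> S" for p
    using R[OF that] norm_fst_le[of "fst p" "snd p"] norm_snd_le[of "snd p" "fst p"] by auto
  show ?thesis
  proof (cases "S = {}")
    case True
    then show ?thesis using that[of 1 0] by simp
  next
    case False
    have "continuous_on S snd" by (intro continuous_intros)
    then obtain p where "p \<in> S" "\<And>q. q \<in> S \<Longrightarrow> snd p \<le> snd q"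
      using continuous_attains_inf[OF assms(1) False] by blast
    then show ?thesis using n assms(2) by (intro that[of "snd p" R]) (auto simp: half_plane_def)
  qed
qed

text \<open>The entropy balance of the viscous equation, integrated against a test function: with
  \<open>\<epsilon> = 1 / (2 * N)\<close>, the sum of the two divergences \<open>\<partial>\<^sub>t (\<psi>(u) \<theta>)\<close> and
  \<open>\<partial>\<^sub>x (\<phi>(u) \<theta> - \<epsilon> \<psi>'(u) u\<^sub>x \<theta> + \<epsilon> \<psi>(u) \<theta>\<^sub>x)\<close> is the integrand minus \<open>\<epsilon> \<psi>''(u) u\<^sub>x\<^sup>2 \<theta>\<close>.\<close>

lemma (in viscous) viscous_entropy_inequality:
  assumes N: "N > 0" and S: "compact S" "S \<subseteq> half_plane"
    and dx: "\<And>x t. ((\<lambda>y. \<theta> (y, t)) has_real_derivative \<theta>x (x, t)) (at x)"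
    and dxx: "\<And>x t. ((\<lambda>y. \<theta>x (y, t)) has_real_derivative \<theta>xx (x, t)) (at x)"
    and dt: "\<And>x t. ((\<lambda>s. \<theta> (x, s)) has_real_derivative \<theta>t (x, t)) (at t)"
    and cont: "continuous_on UNIV \<theta>" "continuous_on UNIV \<theta>x" "continuous_on UNIV \<theta>t" "continuous_on UNIV \<theta>xx"
    and zero: "\<And>p. p \<notin> S \<Longrightarrow> \<theta> p = 0 \<and> \<theta>x p = 0 \<and> \<theta>t p = 0 \<and> \<theta>xx p = 0"
    and nn: "\<And>p. 0 \<le> \<theta> p"
    and \<psi>: "\<And>v. (\<psi> has_real_derivative \<psi>' v) (at v)" "\<And>v. (\<psi>' has_real_derivative \<psi>'' v) (at v)"
      "continuous_on UNIV \<psi>''" "\<And>v. 0 \<le> \<psi>'' v"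
    and \<phi>: "\<And>v. (\<phi> has_real_derivative v * \<psi>' v) (at v)"
  shows "box_bounded (\<lambda>p. \<psi> (u (fst p) (snd p)) * \<theta>t p + \<phi> (u (fst p) (snd p)) * \<theta>x p + 1 / (2 * N) * \<psi> (u (fst p) (snd p)) * \<theta>xx p)"
    and "0 \<le> (\<integral>p. \<psi> (u (fst p) (snd p)) * \<theta>t p + \<phi> (u (fst p) (snd p)) * \<theta>x p + 1 / (2 * N) * \<psi> (u (fst p) (snd p)) * \<theta>xx p \<partial>lborel)"
proof -
  let ?\<epsilon> = "1 / (2 * N)"
  let ?u = "\<lambda>p. u (fst p) (snd p)" and ?ux = "\<lambda>p. ux (fst p) (snd p)" and ?uxx = "\<lambda>p. uxx (fst p) (snd p)"
    and ?ut = "\<lambda>p. ut (fst p) (snd p)"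
  have c0: "continuous_on UNIV \<psi>" "continuous_on UNIV \<psi>'" "continuous_on UNIV \<phi>"
    using \<psi>(1,2) \<phi> by (meson DERIV_isCont continuous_at_imp_continuous_on)+
  have cc: "continuous_on half_plane (\<lambda>p. f (?u p))" if "continuous_on UNIV f" for f :: "real \<Rightarrow> real"
    by (rule continuous_on_compose2[OF that continuity(1)]) auto
  note cs = cc[OF c0(1)] cc[OF c0(2)] cc[OF c0(3)] cc[OF \<psi>(3)] continuity
  note bb = box_bounded_mult_support[OF _ cont(1) S] box_bounded_mult_support[OF _ cont(2) S]
    box_bounded_mult_support[OF _ cont(3) S] box_bounded_mult_support[OF _ cont(4) S]
  define I where "I p = \<psi> (?u p) * \<theta>t p + \<phi> (?u p) * \<theta>x p + ?\<epsilon> * \<psi> (?u p) * \<theta>xx p" for p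
  define Pt where "Pt p = (\<psi>' (?u p) * ?ut p) * \<theta> p + \<psi> (?u p) * \<theta>t p" for p
  define Qx where "Qx p = (?u p * \<psi>' (?u p) * ?ux p - ?\<epsilon> * (\<psi>'' (?u p) * (?ux p)\<^sup>2 + \<psi>' (?u p) * ?uxx p)) * \<theta> p
     + (\<phi> (?u p) * \<theta>x p + ?\<epsilon> * \<psi> (?u p) * \<theta>xx p)" for p
  have bbI: "box_bounded I"
    unfolding I_def[abs_def] by (intro box_bounded_add bb continuous_intros cs) (use zero in auto)
  then show "box_bounded (\<lambda>p. \<psi> (?u p) * \<theta>t p + \<phi> (?u p) * \<theta>x p + ?\<epsilon> * \<psi> (?u p) * \<theta>xx p)"
    by (simp add: I_def[abs_def])
  have bbP: "box_bounded Pt"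
    unfolding Pt_def[abs_def] by (intro box_bounded_add bb continuous_intros cs) (use zero in auto)
  have bbQ: "box_bounded Qx"
    unfolding Qx_def[abs_def] by (intro box_bounded_add bb continuous_intros cs) (use zero in auto)
  obtain l R0 where l: "l > 0" and Sb: "\<And>p. p \<in> S \<Longrightarrow> \<bar>fst p\<bar> \<le> R0 \<and> l \<le> snd p \<and> snd p \<le> R0"
    using compact_half_plane_bounds[OF S] by blast
  define R where "R = max R0 1"
  have R: "R > 0" "\<And>p. p \<in> S \<Longrightarrow> \<bar>fst p\<bar> \<le> R \<and> l \<le> snd p \<and> snd p \<le> R"
    using Sb by (auto simp: R_def intro: max.coboundedI1)
  have out: "\<theta> p = 0 \<and> \<theta>x p = 0 \<and> \<theta>t p = 0 \<and> \<theta>xx p = 0" if "\<bar>fst p\<bar> > R \<or> \<bar>snd p\<bar> > R \<or> snd p \<le> 0" for p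
  proof -
    have "p \<notin> S" using that R(2)[of p] l by auto
    then show ?thesis by (rule zero)
  qed
  \<comment> \<open>A starting time below all of \<open>S\<close>, hence with \<theta> = 0, yet
    positive, so that \<open>u\<close> is differentiable from there on. The minimum with R matters
    for an empty \<open>S\<close>, where l and R are unrelated.\<close>
  define l' where "l' = min (l / 2) R"
  have l': "l' > 0" "l' < l" "l' \<le> R" using l R by (auto simp: l'_def)
  have outt: "\<theta> p = 0 \<and> \<theta>x p = 0 \<and> \<theta>t p = 0 \<and> \<theta>xx p = 0" if "snd p < l" for p
    using zero R(2)[of p] that by fastforce
  have "integral\<^sup>L lborel Pt = 0"
  proof -
    have "(\<integral>t. Pt (x, t) \<partial>lborel) = 0" for x
    proof (rule integral_derivative_zero[of _ l' "R + 1" "\<lambda>t. \<psi> (u x t) * \<theta> (x, t)"])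
      show "box_bounded (\<lambda>t. Pt (x, t))" by (rule box_bounded_slice[OF bbP])
      fix t
      show "t \<in> {l'..R + 1} \<Longrightarrow> ((\<lambda>t. \<psi> (u x t) * \<theta> (x, t)) has_real_derivative Pt (x, t)) (at t)"
        using l' DERIV_mult[OF DERIV_chain2[OF \<psi>(1) u_dt, of t x] dt[of x t]] by (simp add: Pt_def algebra_simps)
      show "t \<notin> {l'..R + 1} \<Longrightarrow> Pt (x, t) = 0" using l' outt[of "(x, t)"] out[of "(x, t)"] by (auto simp: Pt_def)
    qed (use l' outt out R(1) in auto)
    then show ?thesis using box_bounded_Fubini(1)[OF bbP] by simp
  qed
  moreover have "integral\<^sup>L lborel Qx = 0"
  proof -
    have "(\<integral>x. Qx (x, t) \<partial>lborel) = 0" for t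
    \<comment> \<open>Differentiability of \<open>u\<close> is known only for t > 0; at other times
      \<theta> and its derivatives vanish.\<close>
    proof (cases "t > 0")
      case True
      let ?Q = "\<lambda>x. (\<phi> (u x t) - ?\<epsilon> * (\<psi>' (u x t) * ux x t)) * \<theta> (x, t) + ?\<epsilon> * (\<psi> (u x t) * \<theta>x (x, t))"
      show ?thesis
      proof (rule integral_derivative_zero[of _ "- (R + 1)" "R + 1" ?Q])
        show "box_bounded (\<lambda>x. Qx (x, t))" by (rule box_bounded_slice[OF bbQ])
        fix x
        have "(?Q has_real_derivative
          ((u x t * \<psi>' (u x t)) * ux x t - ?\<epsilon> * ((\<psi>'' (u x t) * ux x t) * ux x t + uxx x t * \<psi>' (u x t))) * \<theta> (x, t)
            + \<theta>x (x, t) * (\<phi> (u x t) - ?\<epsilon> * (\<psi>' (u x t) * ux x t))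
            + ?\<epsilon> * ((\<psi>' (u x t) * ux x t) * \<theta>x (x, t) + \<theta>xx (x, t) * \<psi> (u x t))) (at x)"
          using True by (intro DERIV_add DERIV_mult DERIV_diff DERIV_cmult DERIV_chain2[OF \<psi>(1)] DERIV_chain2[OF \<psi>(2)] DERIV_chain2[OF \<phi>] u_dx ux_dx dx dxx)
        then show "(?Q has_real_derivative Qx (x, t)) (at x)"
          by (rule DERIV_cong) (simp add: Qx_def algebra_simps power2_eq_square)
        show "Qx (x, t) = 0" if "x \<notin> {- (R + 1)..R + 1}"
        proof -
          have "R < \<bar>x\<bar>" using that by auto
          then show ?thesis using out[of "(x, t)"] by (simp add: Qx_def)
        qed
      qed (use out R(1) in auto)
    next
      case False
      then have "Qx (x, t) = 0" for x using out[of "(x, t)"] by (simp add: Qx_def)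
      then show ?thesis by simp
    qed
    then show ?thesis using box_bounded_Fubini(2)[OF bbQ] by simp
  qed
  ultimately have "0 = (\<integral>p. Pt p + Qx p \<partial>lborel)"
    using box_bounded_integrable[OF bbP] box_bounded_integrable[OF bbQ] by simp
  also have "\<dots> \<le> integral\<^sup>L lborel I"
  proof (rule integral_mono)
    show "integrable lborel (\<lambda>p. Pt p + Qx p)"
      using box_bounded_integrable[OF bbP] box_bounded_integrable[OF bbQ] by simp
    show "integrable lborel I" by (rule box_bounded_integrable[OF bbI])
    fix p
    \<comment> \<open>The last bracket is the residual of the viscous equation, which is 0 by
      \<open>burgers_identity\<close>.\<close>
    have "Pt p + Qx p = I p - ?\<epsilon> * (\<psi>'' (?u p) * (?ux p)\<^sup>2) * \<theta> p
        + \<psi>' (?u p) * \<theta> p * ((?ut p + ?u p * ?ux p) - ?\<epsilon> * ?uxx p)"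
      by (simp add: Pt_def Qx_def I_def algebra_simps)
    also have "\<dots> = I p - ?\<epsilon> * (\<psi>'' (?u p) * (?ux p)\<^sup>2) * \<theta> p" using burgers_identity[of "fst p" "snd p"] N by simp
    also have "\<dots> \<le> I p" using N \<psi>(4) nn by (simp add: mult_nonneg_nonneg)
    finally show "Pt p + Qx p \<le> I p" .
  qed
  finally show "0 \<le> (\<integral>p. \<psi> (?u p) * \<theta>t p + \<phi> (?u p) * \<theta>x p + ?\<epsilon> * \<psi> (?u p) * \<theta>xx p \<partial>lborel)"
    unfolding I_def .
qed

section \<open>The Hopf--Lax formula\<close>

lemma AE_lebesgue_eq_measurable:
  fixes f g :: "'a::euclidean_space \<Rightarrow> real"
  assumes "g \<in> borel_measurable borel" "AE x in lborel. f x = g x"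
  shows "f \<in> borel_measurable lebesgue"
proof -
  obtain N where N: "N \<in> null_sets lborel" "{x. f x \<noteq> g x} \<subseteq> N"
    using assms(2) by (auto simp: eventually_ae_filter)
  have g: "g \<in> borel_measurable lebesgue" using assms(1) by (intro measurable_completion) simp
  show ?thesis
  proof (rule measurableI)
    fix A :: "real set" assume A: "A \<in> sets borel"
    have "f -` A = (g -` A - N) \<union> (f -` A \<inter> N)" using N(2) by auto
    moreover have "g -` A \<in> sets lebesgue" using measurable_sets[OF g A] by simp
    moreover have "N \<in> sets lebesgue" using N(1) by auto
    moreover have "f -` A \<inter> N \<in> sets lebesgue"
      using null_sets_completion_subset[OF _ null_sets_completionI[OF N(1)]] by blast
    ultimately have "f -` A \<in> sets lebesgue" by (metis sets.Diff sets.Un)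
    then show "f -` A \<inter> space lebesgue \<in> sets lebesgue" by simp
  qed simp
qed

text \<open>Null slices make a null set by Fubini's theorem if the set is product measurable; hence
  the measurability assumption on \<open>P\<close>. The order is exchanged on the way because time
  is the second coordinate.\<close>

lemma AE_half_plane_slices:
  assumes "Measurable.pred (borel \<Otimes>\<^sub>M borel) P" "AE t in lborel. 0 < t \<longrightarrow> (AE x in lborel. P (x, t))"
  shows "AE p in lborel. p \<in> half_plane \<longrightarrow> P p"
proof -
  note [measurable] = assms(1)
  let ?P = "\<lambda>x t :: real. 0 < t \<longrightarrow> P (x, t)"
  have "{p \<in> space (borel \<Otimes>\<^sub>M borel). ?P (fst p) (snd p)} \<in> sets (borel \<Otimes>\<^sub>M borel)"
    by measurable
  then have m: "{p \<in> space (lborel \<Otimes>\<^sub>M lborel). ?P (fst p) (snd p)} \<in> sets (lborel \<Otimes>\<^sub>M lborel)"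
    by (simp add: space_pair_measure cong: sets_pair_measure_cong)
  have "AE t in lborel. AE x in lborel. ?P x t"
    using assms(2) by eventually_elim auto
  then have "AE x in lborel. AE t in lborel. ?P x t"
    using lborel_pair.AE_commute[OF m] by simp
  then have "AE p in lborel \<Otimes>\<^sub>M lborel. ?P (fst p) (snd p)"
    using m by (intro lborel_pair.AE_pair_measure) auto
  then have "AE p in lborel. ?P (fst p) (snd p)" unfolding lborel_prod .
  then show ?thesis by eventually_elim (auto simp: half_plane_def)
qed

locale hopf_lax =
  fixes A :: "real \<Rightarrow> real" and M :: real
  assumes lip: "\<And>x y. \<bar>A x - A y\<bar> \<le> M * \<bar>x - y\<bar>" and M: "0 \<le> M"
begin

abbreviation "cost \<equiv> hl_cost A"

section \<open>Minimizers of the Hopf-Lax cost\<close>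

definition minimizer :: "real \<Rightarrow> real \<Rightarrow> real \<Rightarrow> bool" where
  "minimizer x t y \<longleftrightarrow> (\<forall>z. cost x t y \<le> cost x t z)"

definition regular :: "real \<Rightarrow> real \<Rightarrow> real \<Rightarrow> bool" where
  "regular x t y \<longleftrightarrow> minimizer x t y \<and> (\<forall>z. minimizer x t z \<longrightarrow> z = y)"

text \<open>The quadratic part of the cost beats the linear growth of \<open>A\<close>. The
  comparison point z may differ from x because x need not be a grid point, and the slack e admits
  almost minimizers.\<close>

lemma cost_localized:
  assumes "t > 0" "\<bar>x - z\<bar> \<le> 1" "0 \<le> e" "cost x t y \<le> cost x t z + e"
  shows "\<bar>x - y\<bar> \<le> 4 * t * M + 2 * t * e + 2"
proof (cases "\<bar>x - y\<bar> \<le> 1")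
  case True
  have "0 \<le> 4 * t * M + 2 * t * e" using assms M by simp
  then show ?thesis using True by linarith
next
  case False
  define D where "D = \<bar>x - y\<bar>"
  have D: "D > 1" using False by (simp add: D_def)
  have "A z - A y \<le> M * \<bar>z - y\<bar>" using lip[of z y] by linarith
  also have "\<dots> \<le> M * (D + 1)" using M assms(2) by (intro mult_left_mono) (auto simp: D_def)
  also have "\<dots> \<le> M * (2 * D)" using M D by (intro mult_left_mono) auto
  finally have 1: "A z - A y \<le> M * (2 * D)" .
  have 2: "(x - z)\<^sup>2 \<le> 1" using assms(2) by (simp add: abs_square_le_1)
  have "D\<^sup>2 / (2 * t) \<le> A z - A y + (x - z)\<^sup>2 / (2 * t) + e"
    using assms(4) by (simp add: hl_cost_def D_def)
  also have "\<dots> \<le> M * (2 * D) + 1 / (2 * t) + e"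
    using 1 2 assms(1) by (intro add_mono divide_right_mono) auto
  finally have "D\<^sup>2 / (2 * t) * (2 * t) \<le> (M * (2 * D) + 1 / (2 * t) + e) * (2 * t)"
    using assms(1) by (intro mult_right_mono) auto
  then have "D * D \<le> 4 * t * M * D + 1 + 2 * t * e"
    using assms(1) by (simp add: algebra_simps power2_eq_square)
  \<comment> \<open>D > 1 turns every term on the right into a multiple of D, so that D can be
    divided out.\<close>
  also have "\<dots> \<le> 4 * t * M * D + 1 * D + 2 * t * e * D"
    using D assms mult_left_mono[of 1 D "2 * t * e"] by (intro add_mono) auto
  also have "\<dots> = (4 * t * M + 1 + 2 * t * e) * D" by (simp add: algebra_simps)
  finally have "D \<le> 4 * t * M + 1 + 2 * t * e" using D by simp
  then show ?thesis by (simp add: D_def)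
qed

text \<open>Comparison with the point x itself gives (x - y)^2/(2t) \<le> M |x - y|.\<close>

lemma minimizer_bound:
  assumes "t > 0" "minimizer x t y" shows "\<bar>x - y\<bar> \<le> 2 * M * t"
proof (cases "x = y")
  case False
  have "cost x t y \<le> cost x t x" using assms(2) by (simp add: minimizer_def)
  then have "(x - y)\<^sup>2 / (2 * t) \<le> A x - A y" by (simp add: hl_cost_def)
  also have "\<dots> \<le> M * \<bar>x - y\<bar>" using lip[of x y] by linarith
  finally have "\<bar>x - y\<bar> * \<bar>x - y\<bar> \<le> (2 * M * t) * \<bar>x - y\<bar>"
    using assms(1) by (simp add: pos_divide_le_eq power2_eq_square algebra_simps)
  then show ?thesis by (rule mult_right_le_imp_le) (use False in simp)
qed (use M assms in simp)

lemma A_continuous: "continuous_on UNIV A"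
proof -
  have "isCont A x" for x
  proof -
    have "((\<lambda>y. A y - A x) \<longlongrightarrow> 0) (at x)"
    proof (rule Lim_null_comparison)
      show "\<forall>\<^sub>F y in at x. norm (A y - A x) \<le> M * \<bar>y - x\<bar>" using lip by (intro always_eventually) simp
      show "((\<lambda>y. M * \<bar>y - x\<bar>) \<longlongrightarrow> 0) (at x)" by (auto intro!: tendsto_eq_intros)
    qed
    then show ?thesis by (simp add: isCont_def LIM_zero_iff)
  qed
  then show ?thesis by (simp add: continuous_at_imp_continuous_on)
qed

lemma cost_continuous: "continuous_on UNIV (cost x t)"
  unfolding hl_cost_def[abs_def] divide_inverse by (intro continuous_intros A_continuous)

text \<open>The minimum over [x - D, x + D] is global: by \<open>cost_localized\<close> with e = 0
  and z = x, points outside cost more than x.\<close>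

lemma minimizer_exists: assumes "t > 0" shows "\<exists>y. minimizer x t y"
proof -
  define D where "D = 4 * t * M + 2"
  have "D \<ge> 0" using assms M by (simp add: D_def)
  then obtain y where y: "y \<in> {x - D..x + D}" "\<And>z. z \<in> {x - D..x + D} \<Longrightarrow> cost x t y \<le> cost x t z"
    using continuous_attains_inf[of "{x - D..x + D}" "cost x t"] continuous_on_subset[OF cost_continuous] by auto
  have "cost x t y \<le> cost x t z" for z
  proof (cases "cost x t z \<le> cost x t x")
    case True
    then have "\<bar>x - z\<bar> \<le> D" using cost_localized[OF assms, of x x 0 z] by (simp add: D_def)
    then show ?thesis by (intro y(2)) auto
  next
    case False
    moreover have "cost x t y \<le> cost x t x" using \<open>D \<ge> 0\<close> by (intro y(2)) auto
    ultimately show ?thesis by linarith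
  qed
  then show ?thesis by (auto simp: minimizer_def)
qed

text \<open>Quantitative uniqueness. Almost minimizers at distance \<eta> or more lie in a compact
  set, on which the cost attains a minimum strictly above its value at \<open>y0\<close>; \<delta>
  is at most half of this gap.\<close>

lemma regular_separation:
  assumes "t > 0" "regular x t y0" "\<eta> > 0"
  obtains \<delta> where "\<delta> > 0" "\<And>y. cost x t y \<le> cost x t y0 + \<delta> \<Longrightarrow> \<bar>y - y0\<bar> < \<eta>"
proof -
  define D where "D = 4 * t * M + 2 * t * 1 + 2"
  define K where "K = {y \<in> {x - D..x + D}. \<eta> \<le> \<bar>y - y0\<bar>}"
  have K: "compact K"
  proof -
    have "closed {y. \<eta> \<le> \<bar>y - y0\<bar>}" by (intro closed_Collect_le continuous_intros)
    then have "compact ({x - D..x + D} \<inter> {y. \<eta> \<le> \<bar>y - y0\<bar>})" by (intro compact_Int_closed) auto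
    then show ?thesis by (simp add: K_def Int_def)
  qed
  have m: "cost x t y0 \<le> cost x t z" for z using assms(2) by (simp add: regular_def minimizer_def)
  have far: "y \<in> K" if "cost x t y \<le> cost x t y0 + 1" "\<not> \<bar>y - y0\<bar> < \<eta>" for y
  proof -
    have "cost x t y \<le> cost x t x + 1" using that(1) m[of x] by linarith
    then have "\<bar>x - y\<bar> \<le> D" using cost_localized[OF assms(1), of x x 1 y] by (simp add: D_def)
    then show ?thesis using that(2) by (auto simp: K_def)
  qed
  show ?thesis
  proof (cases "K = {}")
    case True
    show ?thesis by (rule that[of 1]) (use far True in auto)
  next
    case False
    moreover have "continuous_on K (cost x t)" by (rule continuous_on_subset[OF cost_continuous]) simp
    ultimately obtain z where z: "z \<in> K" "\<And>y. y \<in> K \<Longrightarrow> cost x t z \<le> cost x t y"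
      using continuous_attains_inf[OF K] by blast
    have "cost x t y0 < cost x t z"
    proof (rule ccontr)
      assume "\<not> ?thesis"
      then have "cost x t z \<le> cost x t v" for v using m[of v] by linarith
      then have "minimizer x t z" by (simp add: minimizer_def)
      then have "z = y0" using assms(2) by (simp add: regular_def)
      then show False using z(1) \<open>\<eta> > 0\<close> by (simp add: K_def)
    qed
    define \<delta> where "\<delta> = min 1 ((cost x t z - cost x t y0) / 2)"
    have \<delta>: "0 < \<delta>" "\<delta> \<le> 1" "cost x t y0 + \<delta> < cost x t z"
      using \<open>cost x t y0 < cost x t z\<close> by (auto simp: \<delta>_def min_def field_simps)
    show ?thesis
    proof (rule that[OF \<delta>(1)], rule ccontr)
      fix y assume y: "cost x t y \<le> cost x t y0 + \<delta>" "\<not> \<bar>y - y0\<bar> < \<eta>"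
      then have "y \<in> K" using \<delta>(2) by (intro far) auto
      then show False using z(2)[of y] y(1) \<delta>(3) by linarith
    qed
  qed
qed

text \<open>Adding the two minimality inequalities cancels \<open>A\<close> and leaves (x' - x)(y' -
  y) \<ge> 0.\<close>

lemma minimizer_mono:
  assumes "t > 0" "x < x'" "minimizer x t y" "minimizer x' t y'" shows "y \<le> y'"
proof -
  have "cost x t y \<le> cost x t y'" "cost x' t y' \<le> cost x' t y"
    using assms by (auto simp: minimizer_def)
  then have "(x - y)\<^sup>2 / (2 * t) + (x' - y')\<^sup>2 / (2 * t) \<le> (x - y')\<^sup>2 / (2 * t) + (x' - y)\<^sup>2 / (2 * t)"
    by (simp add: hl_cost_def)
  then have "(x - y)\<^sup>2 + (x' - y')\<^sup>2 \<le> (x - y')\<^sup>2 + (x' - y)\<^sup>2"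
    using assms(1) by (simp add: add_divide_distrib[symmetric] divide_le_cancel)
  then have "0 \<le> (x' - x) * (y' - y)" by (simp add: power2_eq_square algebra_simps)
  then show ?thesis using assms(2) by (simp add: zero_le_mult_iff)
qed

text \<open>Any selection of minimizers is monotone in x and so has countably many discontinuities.
  At a continuity point every minimizer is squeezed between the one-sided limits of the
  selection.\<close>

lemma countable_irregular: assumes "t > 0" shows "countable {x. \<not> (\<exists>y. regular x t y)}"
proof -
  define sel where "sel x = (SOME y. minimizer x t y)" for x
  have sel: "minimizer x t (sel x)" for x
    unfolding sel_def using minimizer_exists[OF assms] by (rule someI_ex)
  have "mono sel"
    by (rule monoI) (metis sel minimizer_mono[OF assms] order_le_less order_refl)
  then have c: "countable {a. \<not> isCont sel a}" by (rule mono_ctble_discont)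
  have "\<exists>y. regular x t y" if "isCont sel x" for x
  proof -
    have le: "sel x \<le> y" if "minimizer x t y" for y
    proof (rule tendsto_upperbound[of sel "sel x" "at_left x"])
      show "(sel \<longlongrightarrow> sel x) (at_left x)" using \<open>isCont sel x\<close> by (auto simp: isCont_def intro: tendsto_within_subset)
      show "\<forall>\<^sub>F z in at_left x. sel z \<le> y"
        unfolding eventually_at_filter using minimizer_mono[OF assms _ sel that] by (intro always_eventually) auto
    qed simp
    have ge: "y \<le> sel x" if "minimizer x t y" for y
    proof (rule tendsto_lowerbound[of sel "sel x" "at_right x"])
      show "(sel \<longlongrightarrow> sel x) (at_right x)" using \<open>isCont sel x\<close> by (auto simp: isCont_def intro: tendsto_within_subset)
      show "\<forall>\<^sub>F z in at_right x. y \<le> sel z"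
        unfolding eventually_at_filter using minimizer_mono[OF assms _ that sel] by (intro always_eventually) auto
    qed simp
    show ?thesis using le ge sel by (intro exI[of _ "sel x"]) (force simp: regular_def)
  qed
  then show ?thesis by (intro countable_subset[OF _ c]) auto
qed

lemma AE_regular: "t > 0 \<Longrightarrow> AE x in lborel. \<exists>y. regular x t y"
  using AE_not_in[OF countable_imp_null_set_lborel[OF countable_irregular]] by simp

section \<open>Finite grids and Laplace's method\<close>

definition grid :: "nat \<Rightarrow> real set" where
  "grid n = (\<lambda>i. real_of_int i / real (Suc n)) ` {- int ((Suc n)\<^sup>2)..int ((Suc n)\<^sup>2)}"

lemma grid_finite: "finite (grid n)" "grid n \<noteq> {}" by (auto simp: grid_def)

lemma grid_card: "real (card (grid n)) \<le> 2 * (real (Suc n))\<^sup>2 + 1"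
proof -
  have "card (grid n) \<le> card {- int ((Suc n)\<^sup>2)..int ((Suc n)\<^sup>2)}"
    unfolding grid_def by (intro card_image_le) auto
  also have "\<dots> = 2 * (Suc n)\<^sup>2 + 1"
  proof -
    have "card {- int m..int m} = 2 * m + 1" for m by simp
    then show ?thesis .
  qed
  finally have "real (card (grid n)) \<le> real (2 * (Suc n)\<^sup>2 + 1)" by (rule of_nat_mono)
  then show ?thesis by simp
qed

lemma real_of_int_square: "real_of_int (int (m\<^sup>2)) = real m * real m"
  by (simp add: power2_eq_square)

lemma grid_bound: "y \<in> grid n \<Longrightarrow> \<bar>y\<bar> \<le> real (Suc n)"
proof -
  assume "y \<in> grid n"
  then obtain i where i: "y = real_of_int i / real (Suc n)" "\<bar>i\<bar> \<le> int ((Suc n)\<^sup>2)" by (auto simp: grid_def)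
  have "real_of_int \<bar>i\<bar> \<le> real_of_int (int ((Suc n)\<^sup>2))" using i(2) by (simp only: of_int_le_iff)
  then have "\<bar>real_of_int i\<bar> \<le> real (Suc n) * real (Suc n)"
    by (simp only: of_int_abs real_of_int_square)
  then show ?thesis by (simp add: i(1) abs_divide pos_divide_le_eq del: of_nat_Suc)
qed

lemma grid_near: assumes "\<bar>x\<bar> \<le> real n" shows "\<exists>y\<in>grid n. \<bar>y - x\<bar> \<le> 1 / real (Suc n)"
proof
  let ?k = "real (Suc n)"
  let ?i = "\<lfloor>x * ?k\<rfloor>"
  have k: "?k > 0" by simp
  have 1: "real_of_int ?i \<le> x * ?k" "x * ?k < real_of_int ?i + 1" by linarith+
  have "\<bar>x * ?k\<bar> \<le> real n * ?k" unfolding abs_mult using assms by (intro mult_mono) auto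
  then have "\<bar>real_of_int ?i\<bar> \<le> real n * ?k + 1" using 1 by linarith
  \<comment> \<open>n (n + 1) + 1 \<le> (n + 1)^2: the grid reaches to n + 1, one unit beyond the
    range |x| \<le> n, which leaves room for rounding down.\<close>
  also have "\<dots> \<le> ?k * ?k" by (simp add: algebra_simps)
  finally have "real_of_int \<bar>?i\<bar> \<le> real_of_int (int ((Suc n)\<^sup>2))"
    by (simp only: of_int_abs real_of_int_square)
  then have "\<bar>?i\<bar> \<le> int ((Suc n)\<^sup>2)" by (simp only: of_int_le_iff)
  then show "real_of_int ?i / ?k \<in> grid n" by (auto simp: grid_def intro!: imageI)
  have "real_of_int ?i / ?k - x = (real_of_int ?i - x * ?k) / ?k" using k by (simp add: field_simps del: of_nat_Suc)
  then have "\<bar>real_of_int ?i / ?k - x\<bar> = \<bar>real_of_int ?i - x * ?k\<bar> / ?k" by (simp add: abs_divide)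
  also have "\<dots> \<le> 1 / ?k"
  proof (rule divide_right_mono)
    show "\<bar>real_of_int ?i - x * ?k\<bar> \<le> 1" using 1 by linarith
  qed simp
  finally show "\<bar>real_of_int ?i / ?k - x\<bar> \<le> 1 / ?k" .
qed

text \<open>Inverse temperature n + 1, grid spacing 1/(n + 1) and grid range n + 1 are tied to one
  index. The grid has only quadratically many points, so Gibbs weights of order exp(-(n + 1)
  \<delta>) outweigh their number.\<close>

definition approx :: "nat \<Rightarrow> real \<Rightarrow> real \<Rightarrow> real" where
  "approx n = viscous_burgers A (real (Suc n)) (grid n)"

text \<open>Laplace's method. No minimality of \<open>ys\<close> is needed.\<close>

lemma gibbs_concentration:
  assumes Y: "finite Y" "ys \<in> Y" and N: "N > 0" and B: "0 \<le> B" "0 \<le> D"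
    and near: "\<And>y. y \<in> Y \<Longrightarrow> cost x t y \<le> cost x t ys + \<delta> \<Longrightarrow> \<bar>(x - y) / t - v\<bar> \<le> B"
    and all: "\<And>y. y \<in> Y \<Longrightarrow> \<bar>(x - y) / t - v\<bar> \<le> D"
  shows "\<bar>viscous_burgers A N Y x t - v\<bar> \<le> B + real (card Y) * exp (- (N * \<delta>)) * D"
proof -
  define E where "E y = exp (- (N * cost x t y))" for y
  define Z where "Z = (\<Sum>y\<in>Y. E y)"
  have E: "E y > 0" for y by (simp add: E_def)
  have Z: "Z > 0" unfolding Z_def using Y E by (intro sum_pos) auto
  have EZ: "E ys \<le> Z" unfolding Z_def using Y E by (intro member_le_sum) (auto intro: less_imp_le)
  \<comment> \<open>A point whose cost exceeds that of \<open>ys\<close> by more than \<delta> has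
    weight at most exp(-N \<delta>) times \<open>E ys\<close>, and \<open>E ys\<close> is one
    summand of \<open>Z\<close>.\<close>
  have "\<bar>(x - y) / t - v\<bar> * E y \<le> B * E y + exp (- (N * \<delta>)) * D * Z" if "y \<in> Y" for y
  proof (cases "cost x t y \<le> cost x t ys + \<delta>")
    case True
    have "\<bar>(x - y) / t - v\<bar> * E y \<le> B * E y" using near[OF that True] E[of y] by (intro mult_right_mono) auto
    then show ?thesis using B Z by (auto intro: add_increasing2)
  next
    case False
    then have "N * (cost x t ys + \<delta>) \<le> N * cost x t y" using N by (intro mult_left_mono) auto
    then have "E y \<le> exp (- (N * \<delta>)) * E ys" unfolding E_def exp_add[symmetric] by (simp add: algebra_simps)
    also have "\<dots> \<le> exp (- (N * \<delta>)) * Z" using EZ by (intro mult_left_mono) auto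
    finally have "\<bar>(x - y) / t - v\<bar> * E y \<le> D * (exp (- (N * \<delta>)) * Z)"
      using all[OF that] E[of y] B by (intro mult_mono) auto
    moreover have "0 \<le> B * E y" using B E[of y] by simp
    ultimately show ?thesis by (simp add: algebra_simps)
  qed
  then have "(\<Sum>y\<in>Y. \<bar>(x - y) / t - v\<bar> * E y) \<le> (\<Sum>y\<in>Y. B * E y + exp (- (N * \<delta>)) * D * Z)"
    by (rule sum_mono)
  also have "\<dots> = (B + real (card Y) * exp (- (N * \<delta>)) * D) * Z"
    by (simp add: sum.distrib sum_distrib_left[symmetric] Z_def algebra_simps)
  finally have 1: "(\<Sum>y\<in>Y. \<bar>(x - y) / t - v\<bar> * E y) \<le> (B + real (card Y) * exp (- (N * \<delta>)) * D) * Z" .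
  have "viscous_burgers A N Y x t = (\<Sum>y\<in>Y. (x - y) / t * E y) / Z"
    by (simp add: viscous_burgers_def gibbs_moment_def Z_def E_def)
  then have "viscous_burgers A N Y x t - v = (\<Sum>y\<in>Y. ((x - y) / t - v) * E y) / Z"
    using Z by (simp add: field_simps sum_subtractf sum_distrib_left Z_def)
  also have "\<bar>\<dots>\<bar> \<le> (\<Sum>y\<in>Y. \<bar>(x - y) / t - v\<bar> * E y) / Z"
  proof -
    have "\<bar>\<Sum>y\<in>Y. ((x - y) / t - v) * E y\<bar> \<le> (\<Sum>y\<in>Y. \<bar>(x - y) / t - v\<bar> * E y)"
      by (rule order_trans[OF sum_abs]) (simp add: abs_mult abs_of_pos E)
    then show ?thesis using Z by (simp add: abs_divide divide_right_mono)
  qed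
  also have "\<dots> \<le> B + real (card Y) * exp (- (N * \<delta>)) * D"
    using 1 Z by (simp add: pos_divide_le_eq)
  finally show ?thesis .
qed

text \<open>\<open>C + real (Suc n) * C'\<close> has the shape of the largest velocity error on the
  grid, linear in the range. With the quadratic cardinality this is a cubic polynomial against an
  exponential.\<close>

lemma grid_tail:
  assumes "\<delta> > 0" shows "(\<lambda>n. real (card (grid n)) * exp (- (real (Suc n) * \<delta>)) * (C + real (Suc n) * C')) \<longlonglongrightarrow> 0"
proof (rule Lim_null_comparison)
  let ?f = "\<lambda>k. (2 * k\<^sup>2 + 1) * exp (- (k * \<delta>)) * (\<bar>C\<bar> + k * \<bar>C'\<bar>)"
  show "\<forall>\<^sub>F n in sequentially. norm (real (card (grid n)) * exp (- (real (Suc n) * \<delta>)) * (C + real (Suc n) * C')) \<le> ?f (real (Suc n))"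
  proof (intro always_eventually allI)
    fix n
    have "\<bar>C + real (Suc n) * C'\<bar> \<le> \<bar>C\<bar> + real (Suc n) * \<bar>C'\<bar>"
      by (rule order_trans[OF abs_triangle_ineq]) (simp add: abs_mult)
    then show "norm (real (card (grid n)) * exp (- (real (Suc n) * \<delta>)) * (C + real (Suc n) * C')) \<le> ?f (real (Suc n))"
      unfolding real_norm_def abs_mult using grid_card[of n] by (intro mult_mono) auto
  qed
  have e: "((\<lambda>k. k ^ i * exp (- (k * \<delta>))) \<longlongrightarrow> 0) at_top" for i :: nat
  proof -
    have "filterlim (\<lambda>k. k * \<delta>) at_top at_top"
      using assms by (intro filterlim_at_top_mult_tendsto_pos[OF tendsto_const]) (auto intro: filterlim_ident)
    then have "((\<lambda>k. (k * \<delta>) ^ i / exp (k * \<delta>)) \<longlongrightarrow> 0) at_top"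
      by (rule filterlim_compose[OF tendsto_power_div_exp_0])
    then have "((\<lambda>k. (k * \<delta>) ^ i / exp (k * \<delta>) * (1 / \<delta> ^ i)) \<longlongrightarrow> 0) at_top"
      by (rule tendsto_mult_left_zero)
    moreover have "(k * \<delta>) ^ i / exp (k * \<delta>) * (1 / \<delta> ^ i) = k ^ i * exp (- (k * \<delta>))" for k
      using assms by (simp add: power_mult_distrib exp_minus divide_inverse)
    ultimately show ?thesis by simp
  qed
  have "((\<lambda>k. 2 * \<bar>C\<bar> * (k ^ 2 * exp (- (k * \<delta>))) + \<bar>C\<bar> * (k ^ 0 * exp (- (k * \<delta>)))
      + 2 * \<bar>C'\<bar> * (k ^ 3 * exp (- (k * \<delta>))) + \<bar>C'\<bar> * (k ^ 1 * exp (- (k * \<delta>)))) \<longlongrightarrow>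
      2 * \<bar>C\<bar> * 0 + \<bar>C\<bar> * 0 + 2 * \<bar>C'\<bar> * 0 + \<bar>C'\<bar> * 0) at_top"
    by (intro tendsto_intros e)
  moreover have "2 * \<bar>C\<bar> * (k ^ 2 * exp (- (k * \<delta>))) + \<bar>C\<bar> * (k ^ 0 * exp (- (k * \<delta>)))
      + 2 * \<bar>C'\<bar> * (k ^ 3 * exp (- (k * \<delta>))) + \<bar>C'\<bar> * (k ^ 1 * exp (- (k * \<delta>))) = ?f k" for k
    by (simp add: algebra_simps power2_eq_square power3_eq_cube)
  ultimately have "(?f \<longlongrightarrow> 0) at_top" by simp
  then show "(\<lambda>n. ?f (real (Suc n))) \<longlonglongrightarrow> 0"
    by (rule filterlim_compose) (rule filterlim_compose[OF filterlim_real_sequentially filterlim_Suc])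
qed

text \<open>The minimizer \<open>y0\<close> need not lie on the grid, but by continuity a nearby
  grid point \<open>ys\<close> has a cost within \<delta>/2 of the minimum. Grid points within
  \<delta>/2 of \<open>ys\<close> in cost are then within \<delta> of \<open>y0\<close>, hence close
  to it by \<open>regular_separation\<close>.\<close>

lemma approx_tendsto:
  assumes "t > 0" "regular x t y0" shows "(\<lambda>n. approx n x t) \<longlonglongrightarrow> (x - y0) / t"
proof (rule LIMSEQ_I)
  fix r :: real assume "r > 0"
  \<comment> \<open>|y - y0| < \<eta> then means a velocity error below r/2.\<close>
  define \<eta> where "\<eta> = r * t / 2"
  have "\<eta> > 0" using \<open>r > 0\<close> assms(1) by (simp add: \<eta>_def)
  then obtain \<delta> where \<delta>: "\<delta> > 0" "\<And>y. cost x t y \<le> cost x t y0 + \<delta> \<Longrightarrow> \<bar>y - y0\<bar> < \<eta>"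
    using regular_separation[OF assms] by blast
  have "isCont (cost x t) y0" using cost_continuous by (simp add: continuous_on_eq_continuous_at)
  then obtain s where s: "s > 0" "\<And>y. \<bar>y - y0\<bar> < s \<Longrightarrow> \<bar>cost x t y - cost x t y0\<bar> < \<delta> / 2"
    using \<delta>(1) unfolding continuous_at_eps_delta by (metis dist_real_def half_gt_zero)
  have d2: "\<delta> / 2 > 0" using \<delta>(1) by simp
  obtain n1 where n1: "\<And>n. n \<ge> n1 \<Longrightarrow> \<bar>real (card (grid n)) * exp (- (real (Suc n) * (\<delta> / 2))) * (\<bar>y0\<bar> / t + real (Suc n) * (1 / t))\<bar> < r / 2"
    using LIMSEQ_D[OF grid_tail[OF d2, of "\<bar>y0\<bar> / t" "1 / t"], of "r / 2"] \<open>r > 0\<close> by (auto simp del: of_nat_Suc)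
  obtain n2 where n2: "\<bar>y0\<bar> \<le> real n2" using real_arch_simple by blast
  obtain n3 where n3: "1 / real (Suc n3) < s" using s(1) nat_approx_posE by blast
  show "\<exists>no. \<forall>n\<ge>no. norm (approx n x t - (x - y0) / t) < r"
  proof (intro exI allI impI)
    fix n assume n: "n \<ge> max n1 (max n2 n3)"
    have "\<bar>y0\<bar> \<le> real n" using n2 n by simp
    then obtain ys where ys: "ys \<in> grid n" "\<bar>ys - y0\<bar> \<le> 1 / real (Suc n)" using grid_near by blast
    have "1 / real (Suc n) \<le> 1 / real (Suc n3)" using n by (intro divide_left_mono) auto
    then have "\<bar>ys - y0\<bar> < s" using ys(2) n3 by linarith
    then have cs: "cost x t ys \<le> cost x t y0 + \<delta> / 2" using s(2)[of ys] by linarith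
    have eq: "(x - y) / t - (x - y0) / t = (y0 - y) / t" for y by (simp add: diff_divide_distrib)
    have "\<bar>approx n x t - (x - y0) / t\<bar> \<le> r / 2 + real (card (grid n)) * exp (- (real (Suc n) * (\<delta> / 2))) * (\<bar>y0\<bar> / t + real (Suc n) * (1 / t))"
      unfolding approx_def
    proof (rule gibbs_concentration[OF grid_finite(1) ys(1)])
      fix y assume y: "y \<in> grid n"
      have "\<bar>y0 - y\<bar> / t \<le> (\<bar>y0\<bar> + real (Suc n)) / t"
        using grid_bound[OF y] assms(1) by (intro divide_right_mono) auto
      then show "\<bar>(x - y) / t - (x - y0) / t\<bar> \<le> \<bar>y0\<bar> / t + real (Suc n) * (1 / t)"
        unfolding eq using assms(1) by (simp add: abs_divide add_divide_distrib)
      assume "cost x t y \<le> cost x t ys + \<delta> / 2"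
      then have "\<bar>y - y0\<bar> < \<eta>" using cs by (intro \<delta>(2)) linarith
      then have "\<bar>y0 - y\<bar> / t \<le> \<eta> / t" using assms(1) by (intro divide_right_mono) auto
      then show "\<bar>(x - y) / t - (x - y0) / t\<bar> \<le> r / 2"
        unfolding eq using assms(1) by (simp add: abs_divide \<eta>_def)
    qed (use \<open>r > 0\<close> assms(1) in auto)
    also have "\<dots> < r"
    proof -
      have "n1 \<le> n" using n by simp
      from n1[OF this] show ?thesis by linarith
    qed
    finally show "norm (approx n x t - (x - y0) / t) < r" by simp
  qed
qed

text \<open>\<open>gibbs_concentration\<close> with v = 0, \<delta> = 1 and a grid point within
  distance 1 of x in the role of \<open>ys\<close>. The bound, uniform on compact parts of the
  half-plane, supplies the majorants for the passage to the limit.\<close>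

lemma approx_bounded:
  assumes "0 < t0"
  shows "\<exists>B n0. \<forall>n\<ge>n0. \<forall>x t. \<bar>x\<bar> \<le> R \<longrightarrow> t0 \<le> t \<longrightarrow> t \<le> T \<longrightarrow> \<bar>approx n x t\<bar> \<le> B"
proof -
  \<comment> \<open>The distance from \<open>cost_localized\<close> with e = 1 at the largest time
    T, divided by the smallest time.\<close>
  define B where "B = (4 * T * M + 2 * T + 2) / t0"
  have "(0 :: real) < 1" by simp
  from LIMSEQ_D[OF grid_tail[OF this, of "\<bar>R\<bar> / t0" "1 / t0"], of 1]
  obtain n1 where n1: "\<And>n. n \<ge> n1 \<Longrightarrow> \<bar>real (card (grid n)) * exp (- (real (Suc n) * 1)) * (\<bar>R\<bar> / t0 + real (Suc n) * (1 / t0))\<bar> < 1"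
    by (auto simp del: of_nat_Suc)
  obtain n2 where n2: "\<bar>R\<bar> \<le> real n2" using real_arch_simple by blast
  show ?thesis
  proof (intro exI allI impI)
    fix n x t assume n: "n \<ge> max n1 n2" and x: "\<bar>x\<bar> \<le> R" and t: "t0 \<le> t" "t \<le> T"
    have t0: "t > 0" using assms t by linarith
    have "\<bar>x\<bar> \<le> real n" using x n2 n by simp
    then obtain ys where ys: "ys \<in> grid n" "\<bar>ys - x\<bar> \<le> 1 / real (Suc n)" using grid_near by blast
    have "1 / real (Suc n) \<le> 1" by simp
    then have ys1: "\<bar>x - ys\<bar> \<le> 1" using ys(2) by linarith
    have "\<bar>approx n x t - 0\<bar> \<le> B + real (card (grid n)) * exp (- (real (Suc n) * 1)) * (\<bar>R\<bar> / t0 + real (Suc n) * (1 / t0))"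
      unfolding approx_def
    proof (rule gibbs_concentration[OF grid_finite(1) ys(1)])
      show "0 \<le> B" unfolding B_def using assms t M by (intro divide_nonneg_pos add_nonneg_nonneg mult_nonneg_nonneg) auto
      fix y assume y: "y \<in> grid n"
      have "\<bar>x - y\<bar> / t \<le> (\<bar>R\<bar> + real (Suc n)) / t0"
        using grid_bound[OF y] assms t x by (intro frac_le) auto
      then show "\<bar>(x - y) / t - 0\<bar> \<le> \<bar>R\<bar> / t0 + real (Suc n) * (1 / t0)"
        using t0 by (simp add: abs_divide add_divide_distrib)
      assume "cost x t y \<le> cost x t ys + 1"
      then have "\<bar>x - y\<bar> \<le> 4 * t * M + 2 * t * 1 + 2" by (intro cost_localized[OF t0 ys1]) auto
      also have "\<dots> \<le> 4 * T * M + 2 * T + 2" using t M mult_right_mono[of t T M] by simp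
      finally have "\<bar>x - y\<bar> / t \<le> B" unfolding B_def using assms t by (intro frac_le) auto
      then show "\<bar>(x - y) / t - 0\<bar> \<le> B" using t0 by (simp add: abs_divide)
    qed (use assms in auto)
    moreover have "n1 \<le> n" using n by simp
    ultimately show "\<bar>approx n x t\<bar> \<le> B + 1" using n1[of n] by linarith
  qed
qed

text \<open>Defined as a limit and not through a chosen minimizer, so that joint Borel measurability
  is inherited from the approximations. Where the limit fails to exist, which happens only on a null
  set of the half-plane, the value is whatever \<open>lim\<close> returns.\<close>

definition solution :: "real \<Rightarrow> real \<Rightarrow> real" where
  "solution x t = lim (\<lambda>n. approx n x t)"

lemma solution_eq: "t > 0 \<Longrightarrow> regular x t y \<Longrightarrow> solution x t = (x - y) / t"
  unfolding solution_def by (rule limI[OF approx_tendsto])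

lemma solution_bound: "t > 0 \<Longrightarrow> regular x t y \<Longrightarrow> \<bar>solution x t\<bar> \<le> 2 * M"
  using minimizer_bound[of t x y] by (simp add: solution_eq regular_def abs_divide pos_divide_le_eq)

lemma approx_measurable: "(\<lambda>p. approx n (fst p) (snd p)) \<in> borel_measurable (borel \<Otimes>\<^sub>M borel)"
  unfolding approx_def viscous_burgers_def gibbs_moment_def hl_cost_def by measurable

lemma solution_measurable: "(\<lambda>p. solution (fst p) (snd p)) \<in> borel_measurable (borel \<Otimes>\<^sub>M borel)"
  unfolding solution_def by (rule borel_measurable_lim_metric[OF approx_measurable])

lemma solution_slice_measurable: "(\<lambda>x. solution x t) \<in> borel_measurable borel"
  using measurable_compose[OF measurable_Pair2'[of t borel borel] solution_measurable] by simp

text \<open>For fixed t > 0 convergence fails at most at countably many x. The convergence set is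
  measurable in its Cauchy form, so \<open>AE_half_plane_slices\<close> extends this to the
  plane.\<close>

lemma AE_approx_tendsto:
  "AE p in lborel. p \<in> half_plane \<longrightarrow> (\<lambda>n. approx n (fst p) (snd p)) \<longlonglongrightarrow> solution (fst p) (snd p) \<and> \<bar>solution (fst p) (snd p)\<bar> \<le> 2 * M"
proof -
  have [measurable]: "Measurable.pred (borel \<Otimes>\<^sub>M borel) (\<lambda>p. convergent (\<lambda>n. approx n (fst p) (snd p)))"
    unfolding pred_def Cauchy_convergent_iff[symmetric] by (rule sets_Collect_Cauchy) (rule approx_measurable)
  have [measurable]: "Measurable.pred (borel \<Otimes>\<^sub>M borel) (\<lambda>p. \<bar>solution (fst p) (snd p)\<bar> \<le> 2 * M)"
    unfolding pred_def by (rule borel_measurable_le[OF borel_measurable_abs[OF solution_measurable]]) simp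
  let ?P = "\<lambda>p. convergent (\<lambda>n. approx n (fst p) (snd p)) \<and> \<bar>solution (fst p) (snd p)\<bar> \<le> 2 * M"
  have "AE p in lborel. p \<in> half_plane \<longrightarrow> ?P p"
  proof (rule AE_half_plane_slices)
    show "Measurable.pred (borel \<Otimes>\<^sub>M borel) ?P" by measurable
    show "AE t in lborel. 0 < t \<longrightarrow> (AE x in lborel. ?P (x, t))"
    proof (rule AE_I2, rule impI)
      fix t :: real assume t: "0 < t"
      show "AE x in lborel. ?P (x, t)"
        using AE_regular[OF t]
      proof eventually_elim
        case (elim x)
        then obtain y where "regular x t y" by blast
        from approx_tendsto[OF t this] solution_bound[OF t this] show ?case by (auto simp: convergent_def)
      qed
    qed
  qed
  then show ?thesis
    by eventually_elim (auto simp: solution_def convergent_LIMSEQ_iff)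
qed

lemma solution_ess_bounded: "ess_bounded (lebesgue_on half_plane) (\<lambda>(x, t). solution x t)"
  unfolding ess_bounded_def case_prod_unfold
proof
  show "(\<lambda>p. solution (fst p) (snd p)) \<in> borel_measurable (lebesgue_on half_plane)"
    using solution_measurable unfolding borel_prod by (intro measurable_restrict_space1 measurable_completion) simp
  show "\<exists>C. AE p in lebesgue_on half_plane. \<bar>solution (fst p) (snd p)\<bar> \<le> C"
    unfolding AE_lebesgue_on_iff[OF half_plane_borel] using AE_approx_tendsto by (intro exI[of _ "2 * M"]) (auto elim: eventually_mono)
qed

end

text \<open>The tangent inequalities at x and at y add up to monotonicity of
  \<open>\<psi>'\<close>.\<close>

lemma convex_second_derivative_nonneg:
  assumes "convex_on UNIV \<psi>" "\<And>v. (\<psi> has_real_derivative \<psi>' v) (at v)" "\<And>v. (\<psi>' has_real_derivative \<psi>'' v) (at v)"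
  shows "0 \<le> \<psi>'' v"
proof (rule mono_on_imp_deriv_nonneg[OF _ assms(3)])
  have tangent: "\<psi> y - \<psi> x \<ge> \<psi>' x * (y - x)" for x y
    by (rule convex_on_imp_above_tangent[OF assms(1)]) (use assms(2) in auto)
  show "mono_on UNIV \<psi>'"
  proof (rule mono_onI)
    fix x y :: real assume "x \<le> y"
    have "0 \<le> (\<psi>' y - \<psi>' x) * (y - x)" using tangent[of x y] tangent[of y x] by (simp add: algebra_simps)
    then show "\<psi>' x \<le> \<psi>' y" using \<open>x \<le> y\<close> by (cases "x = y") (auto simp: zero_le_mult_iff)
  qed
qed simp

lemma continuous_bounded_on_interval:
  fixes f :: "real \<Rightarrow> real"
  assumes "continuous_on UNIV f"
  obtains C where "\<And>v. \<bar>v\<bar> \<le> B \<Longrightarrow> \<bar>f v\<bar> \<le> C"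
proof -
  have "compact (f ` {- B..B})" by (intro compact_continuous_image continuous_on_subset[OF assms]) auto
  then obtain C where C: "\<forall>y\<in>f ` {- B..B}. norm y \<le> C" by (meson bounded_iff compact_imp_bounded)
  have "\<bar>f v\<bar> \<le> C" if "\<bar>v\<bar> \<le> B" for v
  proof -
    have "f v \<in> f ` {- B..B}" using that by (intro imageI) auto
    then show ?thesis using C by fastforce
  qed
  then show ?thesis by (rule that)
qed

lemma set_integrable_lebesgue_bounded:
  assumes "f \<in> borel_measurable borel" "AE x in lborel. \<bar>f x\<bar> \<le> C"
  shows "set_integrable lebesgue {- R..R} (f :: real \<Rightarrow> real)"
proof -
  note [measurable] = assms(1)
  have "integrable lborel (\<lambda>x. indicator {- R..R} x *\<^sub>R f x)"
    by (rule integrableI_bounded_set[where A="{- R..R}" and B=C])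
      (use assms(2) in \<open>auto simp: indicator_def emeasure_lborel_Icc_eq elim: eventually_mono\<close>)
  then show ?thesis unfolding set_integrable_def by (subst integrable_completion) auto
qed

lemma L1_loc_dominated_convergence:
  fixes f :: "nat \<Rightarrow> real \<Rightarrow> real"
  assumes "\<And>j. f j \<in> borel_measurable borel" "g \<in> borel_measurable borel"
    "\<And>j. AE x in lborel. \<bar>f j x - g x\<bar> \<le> C" "AE x in lborel. (\<lambda>j. f j x) \<longlonglongrightarrow> g x"
  shows "(\<lambda>j. LINT x:{- R..R}|lebesgue. \<bar>f j x - g x\<bar>) \<longlonglongrightarrow> 0"
proof -
  note [measurable] = assms(1,2)
  have "(\<lambda>j. LINT x|lborel. indicator {- R..R} x *\<^sub>R \<bar>f j x - g x\<bar>) \<longlonglongrightarrow> (LINT x|(lborel :: real measure). 0 :: real)"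
  proof (rule integral_dominated_convergence[where w="\<lambda>x. indicator {- R..R} x * C"])
    show "integrable lborel (\<lambda>x. indicator {- R..R} x * C)"
      by (rule integrable_box[where C="\<bar>C\<bar>" and S="{- R..R}"]) (auto simp: indicator_def)
    show "AE x in lborel. (\<lambda>j. indicator {- R..R} x *\<^sub>R \<bar>f j x - g x\<bar>) \<longlonglongrightarrow> 0"
      using assms(4)
    proof eventually_elim
      case (elim x)
      have "(\<lambda>j. indicator {- R..R} x *\<^sub>R \<bar>f j x - g x\<bar>) \<longlonglongrightarrow> indicator {- R..R} x *\<^sub>R \<bar>g x - g x\<bar>"
        by (intro tendsto_intros elim)
      then show ?case by simp
    qed
    show "AE x in lborel. norm (indicator {- R..R} x *\<^sub>R \<bar>f j x - g x\<bar>) \<le> indicator {- R..R} x * C" for j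
      using assms(3)[of j] by eventually_elim (auto simp: indicator_def)
  qed auto
  then show ?thesis unfolding set_lebesgue_integral_def by (subst integral_completion) auto
qed

lemma AE_lborel_uminus:
  assumes "AE x in lborel. P (x :: real)" shows "AE x in lborel. P (- x)"
proof -
  obtain N where N: "{x. \<not> P x} \<subseteq> N" "N \<in> null_sets lborel"
    using assms by (auto simp: eventually_ae_filter)
  then have "Measurable.pred borel (\<lambda>x. x \<notin> N)" by auto
  from AE_borel_affine[OF _ this AE_not_in[OF N(2)], of "-1" 0]
  have "AE x in lborel. - x \<notin> N" by simp
  then show ?thesis using N(1) by (auto elim: eventually_mono)
qed

context hopf_lax
begin

text \<open>The limit of the viscous entropy inequalities with N = n + 1. The viscous term carries
  1/(2N) and has its derivatives on \<theta>, so the local bounds on \<open>approx\<close> provide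
  an integrable majorant.\<close>

lemma solution_burgers: "burgers_entropy_solution solution"
  unfolding burgers_entropy_solution_def
proof (intro allI impI)
  fix \<psi> \<phi> :: "real \<Rightarrow> real"
  assume conv: "convex_on UNIV \<psi>" and C2: "C2 \<psi>" and \<phi>0: "\<forall>v. (\<phi> has_real_derivative v * deriv \<psi> v) (at v)"
  from C2 obtain \<psi>' \<psi>'' where \<psi>: "\<And>v. (\<psi> has_real_derivative \<psi>' v) (at v)"
    "\<And>v. (\<psi>' has_real_derivative \<psi>'' v) (at v)" "continuous_on UNIV \<psi>''" unfolding C2_def by blast
  have \<phi>: "(\<phi> has_real_derivative v * \<psi>' v) (at v)" for v using \<phi>0 DERIV_imp_deriv[OF \<psi>(1)] by metis
  have \<psi>0: "0 \<le> \<psi>'' v" for v by (rule convex_second_derivative_nonneg[OF conv \<psi>(1,2)])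
  have c\<psi>: "continuous_on UNIV \<psi>" "continuous_on UNIV \<phi>"
    by (rule continuous_at_imp_continuous_on, rule ballI, rule DERIV_isCont, rule \<psi>(1),
        rule continuous_at_imp_continuous_on, rule ballI, rule DERIV_isCont, rule \<phi>)
  show "distr_le_zero (\<lambda>x t. \<psi> (solution x t)) (\<lambda>x t. \<phi> (solution x t))"
    unfolding distr_le_zero_def
  proof (intro allI impI)
    fix \<theta> assume \<theta>: "test_function \<theta>" and nn: "\<forall>p. 0 \<le> \<theta> p"
    obtain \<theta>x \<theta>t \<theta>xx S where S: "compact S" "S \<subseteq> half_plane"
      and dx: "\<And>x t. ((\<lambda>y. \<theta> (y, t)) has_real_derivative \<theta>x (x, t)) (at x)"
      and dxx: "\<And>x t. ((\<lambda>y. \<theta>x (y, t)) has_real_derivative \<theta>xx (x, t)) (at x)"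
      and dt: "\<And>x t. ((\<lambda>s. \<theta> (x, s)) has_real_derivative \<theta>t (x, t)) (at t)"
      and cont: "continuous_on UNIV \<theta>" "continuous_on UNIV \<theta>x" "continuous_on UNIV \<theta>t" "continuous_on UNIV \<theta>xx"
      and zero: "\<And>p. p \<notin> S \<Longrightarrow> \<theta> p = 0 \<and> \<theta>x p = 0 \<and> \<theta>t p = 0 \<and> \<theta>xx p = 0"
      by (rule test_function_partials[OF \<theta>], rule that, assumption+)
    obtain R t0 where Rt: "0 < t0" "\<And>p. p \<in> S \<Longrightarrow> \<bar>fst p\<bar> \<le> R \<and> t0 \<le> snd p \<and> snd p \<le> R"
      using compact_half_plane_bounds[OF S] by blast
    obtain B n0 where B: "\<And>n x t. n \<ge> n0 \<Longrightarrow> \<bar>x\<bar> \<le> R \<Longrightarrow> t0 \<le> t \<Longrightarrow> t \<le> R \<Longrightarrow> \<bar>approx n x t\<bar> \<le> B"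
      using approx_bounded[OF Rt(1)] by blast
    obtain C1 where C1: "\<And>v. \<bar>v\<bar> \<le> B \<Longrightarrow> \<bar>\<psi> v\<bar> \<le> C1" using continuous_bounded_on_interval[OF c\<psi>(1)] by blast
    obtain C2 where C2: "\<And>v. \<bar>v\<bar> \<le> B \<Longrightarrow> \<bar>\<phi> v\<bar> \<le> C2" using continuous_bounded_on_interval[OF c\<psi>(2)] by blast
    let ?u = "\<lambda>p. solution (fst p) (snd p)"
    \<comment> \<open>Shifted by \<open>n0\<close>, as the local bound holds from that index
      on.\<close>
    let ?a = "\<lambda>n p. approx (n + n0) (fst p) (snd p)"
    let ?f = "\<lambda>n p. \<psi> (?a n p) * \<theta>t p + \<phi> (?a n p) * \<theta>x p + 1 / (2 * real (Suc (n + n0))) * \<psi> (?a n p) * \<theta>xx p"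
    let ?g = "\<lambda>p. \<psi> (?u p) * \<theta>t p + \<phi> (?u p) * \<theta>x p"
    let ?w = "\<lambda>p. \<bar>C1\<bar> * \<bar>\<theta>t p\<bar> + \<bar>C2\<bar> * \<bar>\<theta>x p\<bar> + \<bar>C1\<bar> * \<bar>\<theta>xx p\<bar>"
    note [measurable] = borel_measurable_continuous_onI[OF c\<psi>(1)] borel_measurable_continuous_onI[OF c\<psi>(2)]
    have gm: "?g \<in> borel_measurable borel"
      using solution_measurable[unfolded borel_prod]
        borel_measurable_continuous_onI[OF cont(2)] borel_measurable_continuous_onI[OF cont(3)] by measurable
    have "(\<lambda>n. integral\<^sup>L lborel (?f n)) \<longlonglongrightarrow> integral\<^sup>L lborel ?g"
    proof (rule integral_dominated_convergence[where w="?w"])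
      show "integrable lborel ?w"
        by (intro box_bounded_integrable box_bounded_add box_bounded_mult_support[OF _ _ S] continuous_intros cont) (use zero in auto)
      show "?g \<in> borel_measurable lborel" using gm by simp
      have vis: "viscous (grid n)" for n by (rule viscous.intro) (auto simp: grid_finite)
      have "box_bounded (?f n)" for n
        unfolding approx_def
        by (rule viscous.viscous_entropy_inequality(1)[OF vis _ S dx dxx dt cont zero _ \<psi> \<psi>0 \<phi>]) (use nn in auto)
      then show "?f n \<in> borel_measurable lborel" for n unfolding box_bounded_def by simp
      show "AE p in lborel. (\<lambda>n. ?f n p) \<longlonglongrightarrow> ?g p"
        using AE_approx_tendsto
      proof eventually_elim
        case (elim p)
        show ?case
        proof (cases "p \<in> S")
          case True
          then have "(\<lambda>n. approx n (fst p) (snd p)) \<longlonglongrightarrow> ?u p" using elim S(2) by blast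
          then have l: "(\<lambda>n. ?a n p) \<longlonglongrightarrow> ?u p" by (rule LIMSEQ_ignore_initial_segment)
          have c: "(\<lambda>n. f (?a n p)) \<longlonglongrightarrow> f (?u p)" if "continuous_on UNIV f" for f :: "real \<Rightarrow> real"
          proof (rule isCont_tendsto_compose[OF _ l])
            show "isCont f (?u p)" using that by (simp add: continuous_on_eq_continuous_at)
          qed
          have "(\<lambda>n. inverse 2 * inverse (real (Suc n))) \<longlonglongrightarrow> inverse 2 * 0"
            by (rule tendsto_mult[OF tendsto_const LIMSEQ_inverse_real_of_nat])
          then have e: "(\<lambda>n. 1 / (2 * real (Suc n))) \<longlonglongrightarrow> 0"
            by (simp only: divide_inverse inverse_mult_distrib mult_1_left mult_zero_right)
          have "(\<lambda>n. ?f n p) \<longlonglongrightarrow> \<psi> (?u p) * \<theta>t p + \<phi> (?u p) * \<theta>x p + 0 * \<psi> (?u p) * \<theta>xx p"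
            by (intro tendsto_add tendsto_mult tendsto_const c[OF c\<psi>(1)] c[OF c\<psi>(2)] LIMSEQ_ignore_initial_segment[OF e])
          then show ?thesis by simp
        next
          case False
          then show ?thesis using zero[OF False] by simp
        qed
      qed
      show "AE p in lborel. norm (?f n p) \<le> ?w p" for n
      proof (rule AE_I2)
        fix p
        show "norm (?f n p) \<le> ?w p"
        proof (cases "p \<in> S")
          case True
          have "\<bar>?a n p\<bar> \<le> B" using Rt(2)[OF True] by (intro B) auto
          then have b: "\<bar>\<psi> (?a n p)\<bar> \<le> \<bar>C1\<bar>" "\<bar>\<phi> (?a n p)\<bar> \<le> \<bar>C2\<bar>" using C1 C2 by force+
          have "\<bar>1 / (2 * real (Suc (n + n0))) * \<psi> (?a n p)\<bar> \<le> 1 * \<bar>C1\<bar>"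
            unfolding abs_mult using b(1) by (intro mult_mono) auto
          then have "\<bar>1 / (2 * real (Suc (n + n0))) * \<psi> (?a n p) * \<theta>xx p\<bar> \<le> \<bar>C1\<bar> * \<bar>\<theta>xx p\<bar>"
            unfolding abs_mult[of _ "\<theta>xx p"] by (intro mult_right_mono) auto
          moreover have "\<bar>\<psi> (?a n p) * \<theta>t p\<bar> \<le> \<bar>C1\<bar> * \<bar>\<theta>t p\<bar>" "\<bar>\<phi> (?a n p) * \<theta>x p\<bar> \<le> \<bar>C2\<bar> * \<bar>\<theta>x p\<bar>"
            unfolding abs_mult using b by (intro mult_right_mono; simp)+
          ultimately show ?thesis unfolding real_norm_def by linarith
        next
          case False
          then show ?thesis using zero[OF False] by simp
        qed
      qed
    qed
    moreover have "0 \<le> integral\<^sup>L lborel (?f n)" for n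
    proof -
      have vis: "viscous (grid (n + n0))" by (rule viscous.intro) (auto simp: grid_finite)
      show ?thesis
        unfolding approx_def
        by (rule viscous.viscous_entropy_inequality(2)[OF vis _ S dx dxx dt cont zero _ \<psi> \<psi>0 \<phi>]) (use nn in auto)
    qed
    ultimately have "0 \<le> integral\<^sup>L lborel ?g" by (intro LIMSEQ_le_const) auto
    also have "integral\<^sup>L lborel ?g = integral\<^sup>L lebesgue ?g"
      using gm by (intro integral_completion[symmetric]) simp
    also have "?g = (\<lambda>p. indicator half_plane p *\<^sub>R ?g p)"
    proof
      fix p show "?g p = indicator half_plane p *\<^sub>R ?g p"
        using zero[of p] subsetD[OF S(2), of p] by (cases "p \<in> S") auto
    qed
    also have "integral\<^sup>L lebesgue (\<lambda>p. indicator half_plane p *\<^sub>R ?g p) = (\<integral>p. ?g p \<partial>lebesgue_on half_plane)"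
      by (rule integral_restrict_space[symmetric]) auto
    finally show "- (LINT (x, t)|lebesgue_on half_plane. \<psi> (solution x t) * deriv (\<lambda>s. \<theta> (x, s)) t +
        \<phi> (solution x t) * deriv (\<lambda>y. \<theta> (y, t)) x) \<le> 0"
      by (simp add: case_prod_unfold DERIV_imp_deriv[OF dx] DERIV_imp_deriv[OF dt])
  qed
qed

section \<open>Continuity in time and initial values\<close>

lemma AE_regular_sequence:
  assumes "\<And>j::nat. X j > 0"
  shows "AE x in lborel. \<forall>j. \<exists>y. regular x (X j) y"
  unfolding AE_all_countable using AE_regular assms by blast

lemma AE_solution_bound: "t > 0 \<Longrightarrow> AE x in lborel. \<bar>solution x t\<bar> \<le> 2 * M"
  using AE_regular[of t] by (auto elim!: eventually_mono dest: solution_bound)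

text \<open>The costs at the times X j and s differ by (x - y)^2/2 times |1/X j - 1/s|, so a
  minimizer at a time close to s is an almost minimizer at s, and \<open>regular_separation\<close>
  places it close to \<open>y0\<close>.\<close>

lemma minimizers_converge:
  assumes s: "s > 0" "regular x s y0" and X: "\<And>j. X j > 0" "X \<longlonglongrightarrow> s" and Y: "\<And>j. minimizer x (X j) (Y j)"
  shows "Y \<longlonglongrightarrow> y0"
proof (rule LIMSEQ_I)
  fix r :: real assume "r > 0"
  obtain \<delta> where \<delta>: "\<delta> > 0" "\<And>y. cost x s y \<le> cost x s y0 + \<delta> \<Longrightarrow> \<bar>y - y0\<bar> < r"
    using regular_separation[OF s \<open>r > 0\<close>] by blast
  \<comment> \<open>By \<open>minimizer_bound\<close>, all minimizers at times below 2 s lie within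
    Q of x.\<close>
  define Q where "Q = 2 * M * (2 * s)"
  have "(\<lambda>j. Q\<^sup>2 / 2 * \<bar>1 / X j - 1 / s\<bar>) \<longlonglongrightarrow> Q\<^sup>2 / 2 * \<bar>1 / s - 1 / s\<bar>"
    using s(1) by (intro tendsto_intros X) auto
  then have "\<forall>\<^sub>F j in sequentially. Q\<^sup>2 / 2 * \<bar>1 / X j - 1 / s\<bar> < \<delta> / 2"
    using \<delta>(1) by (auto intro: order_tendstoD(2))
  moreover have "\<forall>\<^sub>F j in sequentially. X j < 2 * s" using X(2) s(1) by (auto intro: order_tendstoD(2))
  ultimately have "\<forall>\<^sub>F j in sequentially. norm (Y j - y0) < r"
  proof eventually_elim
    case (elim j)
    have close: "\<bar>cost x (X j) y - cost x s y\<bar> \<le> \<delta> / 2" if "\<bar>x - y\<bar> \<le> Q" for y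
    proof -
      have "\<bar>x - y\<bar> \<le> \<bar>Q\<bar>" using that by linarith
      then have q: "(x - y)\<^sup>2 \<le> Q\<^sup>2" by (simp only: abs_le_square_iff)
      have "cost x (X j) y - cost x s y = (x - y)\<^sup>2 / 2 * (1 / X j - 1 / s)"
        by (simp add: hl_cost_def algebra_simps)
      then have "\<bar>cost x (X j) y - cost x s y\<bar> = \<bar>(x - y)\<^sup>2 / 2\<bar> * \<bar>1 / X j - 1 / s\<bar>" by (simp only: abs_mult)
      also have "\<dots> = (x - y)\<^sup>2 / 2 * \<bar>1 / X j - 1 / s\<bar>" by simp
      also have "\<dots> \<le> Q\<^sup>2 / 2 * \<bar>1 / X j - 1 / s\<bar>" using q by (intro mult_right_mono divide_right_mono) auto
      finally show ?thesis using elim(1) by linarith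
    qed
    have "\<bar>x - Y j\<bar> \<le> 2 * M * X j" by (rule minimizer_bound[OF X(1) Y])
    also have "\<dots> \<le> Q" unfolding Q_def using elim(2) M by (intro mult_left_mono) auto
    finally have 1: "\<bar>x - Y j\<bar> \<le> Q" .
    have "\<bar>x - y0\<bar> \<le> 2 * M * s" using minimizer_bound[OF s(1)] s(2) by (simp add: regular_def)
    also have "\<dots> \<le> Q" unfolding Q_def using s(1) M by (intro mult_left_mono) auto
    finally have 2: "\<bar>x - y0\<bar> \<le> Q" .
    have "cost x (X j) (Y j) \<le> cost x (X j) y0" using Y[of j] by (simp add: minimizer_def)
    then have "cost x s (Y j) \<le> cost x s y0 + \<delta>" using close[OF 1] close[OF 2] by linarith
    then show ?case using \<delta>(2) by simp
  qed
  then show "\<exists>no. \<forall>n\<ge>no. norm (Y n - y0) < r" by (simp add: eventually_sequentially)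
qed

lemma solution_L1_loc_continuous: "L1_loc_continuous solution"
  unfolding L1_loc_continuous_def
proof (intro allI impI conjI)
  fix R s :: real assume "R > 0" "s > 0"
  show "set_integrable lebesgue {- R..R} (\<lambda>x. solution x s)"
    by (rule set_integrable_lebesgue_bounded[OF solution_slice_measurable AE_solution_bound[OF \<open>s > 0\<close>]])
  \<comment> \<open>The limit is taken along sequences because regularity at all the times X j
    simultaneously fails only on a countable union of null sets.\<close>
  have "((\<lambda>t. LINT x:{- R..R}|lebesgue. \<bar>solution x t - solution x s\<bar>) \<longlongrightarrow> 0) (at s within {0<..})"
    unfolding tendsto_at_iff_sequentially comp_def
  proof (intro allI impI)
    fix X :: "nat \<Rightarrow> real" assume "\<forall>i. X i \<in> {0<..} - {s}" "X \<longlonglongrightarrow> s"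
    then have X: "\<And>i. X i > 0" "X \<longlonglongrightarrow> s" by auto
    show "(\<lambda>j. LINT x:{- R..R}|lebesgue. \<bar>solution x (X j) - solution x s\<bar>) \<longlonglongrightarrow> 0"
    proof (rule L1_loc_dominated_convergence[OF solution_slice_measurable solution_slice_measurable])
      show "AE x in lborel. \<bar>solution x (X j) - solution x s\<bar> \<le> 4 * M" for j
        using AE_solution_bound[OF X(1)[of j]] AE_solution_bound[OF \<open>s > 0\<close>] by eventually_elim linarith
      show "AE x in lborel. (\<lambda>j. solution x (X j)) \<longlonglongrightarrow> solution x s"
        using AE_regular_sequence[of X, OF X(1)] AE_regular[OF \<open>s > 0\<close>]
      proof eventually_elim
        case (elim x)
        from elim(1) obtain Y where Y: "\<And>j. regular x (X j) (Y j)" by metis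
        from elim(2) obtain y0 where y0: "regular x s y0" by blast
        have "Y \<longlonglongrightarrow> y0"
          by (rule minimizers_converge[OF \<open>s > 0\<close> y0 X]) (use Y in \<open>simp add: regular_def\<close>)
        then have "(\<lambda>j. (x - Y j) / X j) \<longlonglongrightarrow> (x - y0) / s" using \<open>s > 0\<close> by (intro tendsto_intros X) auto
        then show ?case by (simp add: solution_eq[OF X(1) Y] solution_eq[OF \<open>s > 0\<close> y0])
      qed
    qed
  qed
  then show "((\<lambda>t. LINT x:{- R..R}|lebesgue. \<bar>solution x t - solution x s\<bar>) \<longlongrightarrow> 0) (at s)"
    using \<open>s > 0\<close> by (simp add: at_within_open[of s "{0<..}"])
qed

text \<open>A minimizer \<open>y = x - t p\<close> minimizes \<open>(p - c)\<^sup>2 / 2\<close> up to \<open>o(1)\<close>, where \<open>c\<close> is the derivative of \<open>A\<close> at \<open>x\<close>.\<close>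

lemma initial_limit:
  assumes c: "\<bar>c\<bar> \<le> M" "\<And>\<epsilon>. \<epsilon> > 0 \<Longrightarrow> \<exists>d>0. \<forall>y. \<bar>y - x\<bar> < d \<longrightarrow> \<bar>A y - A x - c * (y - x)\<bar> \<le> \<epsilon> * \<bar>y - x\<bar>"
    and X: "\<And>j. X j > 0" "X \<longlonglongrightarrow> 0" and Y: "\<And>j. minimizer x (X j) (Y j)"
  shows "(\<lambda>j. (x - Y j) / X j) \<longlonglongrightarrow> c"
proof (rule LIMSEQ_I)
  fix r :: real assume "r > 0"
  \<comment> \<open>Since |p| \<le> 2 M and |c| \<le> M, the final error is at most 6 M \<epsilon>,
    which this choice makes smaller than r^2.\<close>
  define \<epsilon> where "\<epsilon> = r\<^sup>2 / (6 * M + 1)"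
  have \<epsilon>: "\<epsilon> > 0" using \<open>r > 0\<close> M by (simp add: \<epsilon>_def)
  obtain d where d: "d > 0" "\<And>y. \<bar>y - x\<bar> < d \<Longrightarrow> \<bar>A y - A x - c * (y - x)\<bar> \<le> \<epsilon> * \<bar>y - x\<bar>" using c(2)[OF \<epsilon>] by blast
  have "(\<lambda>j. 2 * M * X j) \<longlonglongrightarrow> 2 * M * 0" by (intro tendsto_intros X)
  then have "\<forall>\<^sub>F j in sequentially. 2 * M * X j < d" using d(1) by (auto intro: order_tendstoD(2))
  then have "\<forall>\<^sub>F j in sequentially. norm ((x - Y j) / X j - c) < r"
  proof eventually_elim
    case (elim j)
    define t where "t = X j"
    define p where "p = (x - Y j) / t"
    have t: "t > 0" "2 * M * t < d" using X(1) elim by (auto simp: t_def)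
    have Yj: "Y j = x - t * p" using t by (simp add: p_def)
    have tp: "t * \<bar>p\<bar> \<le> 2 * M * t" using minimizer_bound[OF X(1) Y, of j] t by (simp add: Yj abs_mult t_def)
    then have p: "\<bar>p\<bar> \<le> 2 * M" using t by (simp add: mult.commute[of _ t])
    have tc: "t * \<bar>c\<bar> \<le> M * t" using c(1) t by (simp add: mult.commute)
    have Mt: "M * t \<le> 2 * M * t" using M t by simp
    have 1: "\<bar>A (x - t * p) - A x + c * (t * p)\<bar> \<le> \<epsilon> * (t * \<bar>p\<bar>)"
      using d(2)[of "x - t * p"] tp t by (simp add: abs_mult)
    have 2: "\<bar>A (x - t * c) - A x + c * (t * c)\<bar> \<le> \<epsilon> * (t * \<bar>c\<bar>)"
      using d(2)[of "x - t * c"] tc Mt t by (simp add: abs_mult)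
    \<comment> \<open>The competitor x - t c is the point from which a characteristic of speed c
      reaches x at time t.\<close>
    have "cost x t (x - t * p) \<le> cost x t (x - t * c)" using Y[of j] by (simp add: minimizer_def t_def Yj[unfolded t_def])
    moreover have "cost x t (x - t * q) = A (x - t * q) + t * (q\<^sup>2 / 2)" for q
      using t by (simp add: hl_cost_def power2_eq_square)
    ultimately have "A (x - t * p) + t * (p\<^sup>2 / 2) \<le> A (x - t * c) + t * (c\<^sup>2 / 2)" by simp
    then have "t * (p\<^sup>2 / 2) - c * (t * p) \<le> t * (c\<^sup>2 / 2) - c * (t * c) + \<epsilon> * (t * \<bar>p\<bar>) + \<epsilon> * (t * \<bar>c\<bar>)"
      using 1 2 by linarith
    then have "t * ((p - c)\<^sup>2 / 2) \<le> t * (\<epsilon> * (\<bar>p\<bar> + \<bar>c\<bar>))" by (simp add: power2_eq_square algebra_simps)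
    then have "(p - c)\<^sup>2 / 2 \<le> \<epsilon> * (\<bar>p\<bar> + \<bar>c\<bar>)" using t(1) by (rule mult_left_le_imp_le)
    then have "(p - c)\<^sup>2 \<le> 2 * (\<epsilon> * (\<bar>p\<bar> + \<bar>c\<bar>))" by linarith
    also have "\<dots> \<le> 2 * (\<epsilon> * (3 * M))" using p c(1) \<epsilon> by simp
    also have "\<dots> = r\<^sup>2 * (6 * M / (6 * M + 1))" by (simp add: \<epsilon>_def)
    also have "\<dots> < r\<^sup>2 * 1" using M \<open>r > 0\<close> by (intro mult_strict_left_mono) auto
    finally have "(p - c)\<^sup>2 < r\<^sup>2" by simp
    then have "\<bar>p - c\<bar> < r" using \<open>r > 0\<close> power2_less_imp_less[of "\<bar>p - c\<bar>" r] by simp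
    then show ?case by (simp add: p_def t_def)
  qed
  then show "\<exists>no. \<forall>n\<ge>no. norm ((x - Y n) / X n - c) < r" by (simp add: eventually_sequentially)
qed

text \<open>Almost every x is a two-sided Lebesgue point of \<open>v\<close>. There \<open>A\<close>
  has derivative \<open>v x\<close>, and \<open>initial_limit\<close> applies.\<close>

lemma solution_initial_value:
  assumes v: "v \<in> borel_measurable borel" "\<And>x. \<bar>v x\<bar> \<le> M"
    and A: "\<And>x y. x \<le> y \<Longrightarrow> A y - A x = integral {x..y} v"
  shows "has_initial_value solution v"
proof -
  have v_int: "v integrable_on {a..b}" for a b by (rule integral_Ioo_eq(1)[OF v])
  have diff: "AE x in lborel. \<forall>\<epsilon>>0. \<exists>d>0. \<forall>y. \<bar>y - x\<bar> < d \<longrightarrow> \<bar>A y - A x - v x * (y - x)\<bar> \<le> \<epsilon> * \<bar>y - x\<bar>"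
  proof -
    have right: "AE x in lborel. \<forall>\<epsilon>>0. \<exists>d>0. \<forall>h. 0 < h \<and> h < d \<longrightarrow> \<bar>integral {x..x + h} v / h - v x\<bar> < \<epsilon>"
      by (rule lebesgue_point_right[OF v_int])
    \<comment> \<open>Averages to the left of x are averages to the right of -x for the reflected
      function.\<close>
    have "(\<lambda>x. v (- x)) \<in> borel_measurable borel" using v(1) by measurable
    then have "(\<lambda>x. v (- x)) integrable_on {a..b}" for a b by (rule integral_Ioo_eq(1)) (rule v(2))
    from lebesgue_point_right[OF this]
    have "AE x in lborel. \<forall>\<epsilon>>0. \<exists>d>0. \<forall>h. 0 < h \<and> h < d \<longrightarrow> \<bar>integral {x..x + h} (\<lambda>x. v (- x)) / h - v (- x)\<bar> < \<epsilon>" .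
    from AE_lborel_uminus[OF this]
    have "AE x in lborel. \<forall>\<epsilon>>0. \<exists>d>0. \<forall>h. 0 < h \<and> h < d \<longrightarrow> \<bar>integral {- x..- x + h} (\<lambda>x. v (- x)) / h - v x\<bar> < \<epsilon>"
      by (simp only: minus_minus)
    with right show ?thesis
    proof eventually_elim
      case (elim x)
      show ?case
      proof (intro allI impI)
        fix \<epsilon> :: real assume "\<epsilon> > 0"
        obtain d where d: "d > 0" "\<And>h. 0 < h \<Longrightarrow> h < d \<Longrightarrow> \<bar>integral {x..x + h} v / h - v x\<bar> < \<epsilon>"
          using elim(1) \<open>\<epsilon> > 0\<close> by meson
        obtain d' where d': "d' > 0" "\<And>h. 0 < h \<Longrightarrow> h < d' \<Longrightarrow> \<bar>integral {- x..- x + h} (\<lambda>x. v (- x)) / h - v x\<bar> < \<epsilon>"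
          using elim(2) \<open>\<epsilon> > 0\<close> by meson
        have sc: "\<bar>I - c * h\<bar> \<le> \<epsilon> * h" if "\<bar>I / h - c\<bar> < \<epsilon>" "h > 0" for I c h :: real
        proof -
          have "\<bar>I - c * h\<bar> = \<bar>I / h - c\<bar> * h" using that(2) by (simp add: abs_mult[symmetric] field_simps flip: abs_mult_pos)
          also have "\<dots> \<le> \<epsilon> * h" using that by (intro mult_right_mono) auto
          finally show ?thesis .
        qed
        show "\<exists>d>0. \<forall>y. \<bar>y - x\<bar> < d \<longrightarrow> \<bar>A y - A x - v x * (y - x)\<bar> \<le> \<epsilon> * \<bar>y - x\<bar>"
        proof (intro exI[of _ "min d d'"] conjI allI impI)
          fix y assume y: "\<bar>y - x\<bar> < min d d'"
          show "\<bar>A y - A x - v x * (y - x)\<bar> \<le> \<epsilon> * \<bar>y - x\<bar>"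
          proof (cases y x rule: linorder_cases)
            case greater
            have "A y - A x = integral {x..x + (y - x)} v" using A[of x y] greater by simp
            then show ?thesis using sc[OF d(2)[of "y - x"]] greater y by simp
          next
            case less
            have "integral {- x..- x + (x - y)} (\<lambda>x. v (- x)) = integral {y..x} v"
              using integral_reflect_real[of y x v] by simp
            then have "A x - A y = integral {- x..- x + (x - y)} (\<lambda>x. v (- x))" using A[of y x] less by simp
            moreover have "\<bar>integral {- x..- x + (x - y)} (\<lambda>x. v (- x)) - v x * (x - y)\<bar> \<le> \<epsilon> * (x - y)"
              by (rule sc[OF d'(2)]) (use less y in auto)
            moreover have "A y - A x - v x * (y - x) = - (A x - A y - v x * (x - y))" by (simp add: algebra_simps)
            ultimately show ?thesis using less by simp
          qed simp
        qed (use d d' in auto)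
      qed
    qed
  qed
  show ?thesis
    unfolding has_initial_value_def
  proof (intro allI impI)
    fix R \<epsilon> :: real assume "R > 0" "\<epsilon> > 0"
    have "((\<lambda>t. LINT x:{- R..R}|lebesgue. \<bar>solution x t - v x\<bar>) \<longlongrightarrow> 0) (at 0 within {0<..})"
      unfolding tendsto_at_iff_sequentially comp_def
    proof (intro allI impI)
      fix X :: "nat \<Rightarrow> real" assume "\<forall>i. X i \<in> {0<..} - {0}" "X \<longlonglongrightarrow> 0"
      then have X: "\<And>i. X i > 0" "X \<longlonglongrightarrow> 0" by auto
      show "(\<lambda>j. LINT x:{- R..R}|lebesgue. \<bar>solution x (X j) - v x\<bar>) \<longlonglongrightarrow> 0"
      proof (rule L1_loc_dominated_convergence[OF solution_slice_measurable v(1)])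
        show "AE x in lborel. \<bar>solution x (X j) - v x\<bar> \<le> 3 * M" for j
          using AE_solution_bound[OF X(1)[of j]]
        proof eventually_elim
          case (elim x)
          then show ?case using v(2)[of x] by linarith
        qed
        show "AE x in lborel. (\<lambda>j. solution x (X j)) \<longlonglongrightarrow> v x"
          using AE_regular_sequence[of X, OF X(1)] diff
        proof eventually_elim
          case (elim x)
          from elim(1) obtain Y where Y: "\<And>j. regular x (X j) (Y j)" by metis
          have "(\<lambda>j. (x - Y j) / X j) \<longlonglongrightarrow> v x"
            by (rule initial_limit[OF v(2) _ X]) (use elim(2) Y in \<open>auto simp: regular_def\<close>)
          then show ?case by (simp add: solution_eq[OF X(1) Y])
        qed
      qed
    qed
    then have "\<forall>\<^sub>F t in at_right 0. (LINT x:{- R..R}|lebesgue. \<bar>solution x t - v x\<bar>) < \<epsilon>"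
      using \<open>\<epsilon> > 0\<close> by (rule order_tendstoD(2))
    then obtain \<delta> where "\<delta> > 0" "\<forall>t>0. t < \<delta> \<longrightarrow> (LINT x:{- R..R}|lebesgue. \<bar>solution x t - v x\<bar>) < \<epsilon>"
      by (auto simp: eventually_at_right_field)
    then show "\<exists>\<delta>>0. AE t in lebesgue. 0 < t \<and> t < \<delta> \<longrightarrow> (LINT x:{- R..R}|lebesgue. \<bar>solution x t - v x\<bar>) < \<epsilon>"
      by (intro exI[of _ \<delta>] conjI AE_I2) auto
  qed
qed

end

section \<open>Antiderivatives and monotone dependence on the data\<close>

lemma hopf_lax_antiderivative:
  assumes v: "v \<in> borel_measurable borel" "\<And>x. \<bar>v x\<bar> \<le> M"
  obtains A where "hopf_lax A M" "\<And>x y. x \<le> y \<Longrightarrow> A y - A x = integral {x..y} v"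
proof -
  have i: "v integrable_on {a..b}" for a b by (rule integral_Ioo_eq(1)[OF v])
  have M: "0 \<le> M" using v(2)[of 0] by linarith
  \<comment> \<open>Integrals over reversed intervals are 0, so at most one of the two terms is
    present and the signed integral from 0 to x results.\<close>
  define A where "A x = integral {0..x} v - integral {x..0} v" for x
  have A: "A y - A x = integral {x..y} v" if "x \<le> y" for x y
  proof (cases "0 \<le> x")
    case True
    have "integral {0..x} v + integral {x..y} v = integral {0..y} v"
      by (rule Henstock_Kurzweil_Integration.integral_combine[OF True that i])
    moreover have "integral {x..0} v = 0" "integral {y..0} v = 0" using True that by (cases "x = 0"; cases "y = 0"; simp)+
    ultimately show ?thesis by (simp add: A_def)
  next
    case False
    show ?thesis
    proof (cases "0 \<le> y")
      case True
      have "integral {x..0} v + integral {0..y} v = integral {x..y} v"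
        by (rule Henstock_Kurzweil_Integration.integral_combine[OF _ True i]) (use False in simp)
      moreover have "integral {0..x} v = 0" "integral {y..0} v = 0" using True False by (cases "y = 0"; simp)+
      ultimately show ?thesis by (simp add: A_def)
    next
      case y: False
      have "integral {x..y} v + integral {y..0} v = integral {x..0} v"
        by (rule Henstock_Kurzweil_Integration.integral_combine[OF that _ i]) (use y in simp)
      moreover have "integral {0..x} v = 0" "integral {0..y} v = 0" using y False by simp_all
      ultimately show ?thesis by (simp add: A_def)
    qed
  qed
  have bound: "\<bar>A y - A x\<bar> \<le> M * (y - x)" if "x \<le> y" for x y
  proof -
    have "norm (integral {x..y} v) \<le> M * (y - x)"
      using integral_norm_bound_integral[OF i, of "\<lambda>_. M" x y] v(2) that by (simp add: mult.commute integrable_const_ivl)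
    then show ?thesis using A[OF that] by simp
  qed
  have "hopf_lax A M"
  proof
    fix x y show "\<bar>A x - A y\<bar> \<le> M * \<bar>x - y\<bar>"
      using bound[of x y] bound[of y x] by (cases "x \<le> y") (auto simp: abs_minus_commute)
  qed (rule M)
  then show ?thesis using A that by blast
qed

text \<open>Suppose z < y. From z to y the function \<open>A\<close> increases at least as much as
  \<open>B\<close>, so moving from y to z is at least as favourable for \<open>A\<close>, and z
  would be a second minimizer for it. Hence y \<le> z, which lowers the velocity of
  \<open>B\<close>.\<close>

lemma hopf_lax_solution_mono:
  assumes "hopf_lax A M" "hopf_lax B L" and AB: "\<And>x y. x \<le> y \<Longrightarrow> B y - B x \<le> A y - A x"
    and "t > 0" "hopf_lax.regular A x t y" "hopf_lax.regular B x t z"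
  shows "hopf_lax.solution B x t \<le> hopf_lax.solution A x t"
proof -
  interpret a: hopf_lax A M by fact
  interpret b: hopf_lax B L by fact
  have "y \<le> z"
  proof (rule ccontr)
    assume "\<not> y \<le> z"
    have "B z + (x - z)\<^sup>2 / (2 * t) \<le> B y + (x - y)\<^sup>2 / (2 * t)"
      using assms(6) by (simp add: b.regular_def b.minimizer_def hl_cost_def)
    then have "A z + (x - z)\<^sup>2 / (2 * t) \<le> A y + (x - y)\<^sup>2 / (2 * t)"
      using AB[of z y] \<open>\<not> y \<le> z\<close> by simp
    moreover have "A y + (x - y)\<^sup>2 / (2 * t) \<le> A v + (x - v)\<^sup>2 / (2 * t)" for v
      using assms(5) by (simp add: a.regular_def a.minimizer_def hl_cost_def)
    ultimately have "a.minimizer x t z" unfolding a.minimizer_def hl_cost_def by (meson order_trans)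
    then show False using assms(5) \<open>\<not> y \<le> z\<close> by (auto simp: a.regular_def)
  qed
  then show ?thesis
    using assms(4) by (simp add: a.solution_eq[OF assms(4,5)] b.solution_eq[OF assms(4,6)] divide_right_mono)
qed

section \<open>Contraction and uniqueness for the Burgers equation\<close>

lemma set_integral_combine_le:
  fixes f g :: "'a \<Rightarrow> real"
  assumes "set_integrable M S f" "set_integrable M S g"
  shows "(LINT x:S|M. \<bar>a * f x + b * g x\<bar>) \<le> \<bar>a\<bar> * (LINT x:S|M. \<bar>f x\<bar>) + \<bar>b\<bar> * (LINT x:S|M. \<bar>g x\<bar>)"
proof -
  have f: "integrable M (\<lambda>x. indicator S x * f x)" and g: "integrable M (\<lambda>x. indicator S x * g x)"
    using assms by (simp_all add: set_integrable_def)
  have abs: "indicator S x * \<bar>y\<bar> = \<bar>indicator S x * y\<bar>" for x and y :: real by (simp add: indicator_def)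
  have "(\<integral>x. \<bar>indicator S x * (a * f x + b * g x)\<bar> \<partial>M) \<le>
      (\<integral>x. \<bar>a\<bar> * \<bar>indicator S x * f x\<bar> + \<bar>b\<bar> * \<bar>indicator S x * g x\<bar> \<partial>M)"
  proof (rule integral_mono)
    have "integrable M (\<lambda>x. a * (indicator S x * f x) + b * (indicator S x * g x))" using f g by simp
    moreover have "a * (indicator S x * f x) + b * (indicator S x * g x) = indicator S x * (a * f x + b * g x)" for x
      by (simp add: algebra_simps)
    ultimately show "integrable M (\<lambda>x. \<bar>indicator S x * (a * f x + b * g x)\<bar>)" by simp
    show "integrable M (\<lambda>x. \<bar>a\<bar> * \<bar>indicator S x * f x\<bar> + \<bar>b\<bar> * \<bar>indicator S x * g x\<bar>)" using f g by simp
    show "\<bar>indicator S x * (a * f x + b * g x)\<bar> \<le> \<bar>a\<bar> * \<bar>indicator S x * f x\<bar> + \<bar>b\<bar> * \<bar>indicator S x * g x\<bar>" for x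
      using abs_triangle_ineq[of "a * f x" "b * g x"] by (simp add: indicator_def abs_mult)
  qed
  also have "\<dots> = \<bar>a\<bar> * (\<integral>x. \<bar>indicator S x * f x\<bar> \<partial>M) + \<bar>b\<bar> * (\<integral>x. \<bar>indicator S x * g x\<bar> \<partial>M)"
    using f g by (simp del: abs_mult)
  finally show ?thesis unfolding set_lebesgue_integral_def real_scaleR_def abs .
qed

lemma set_integrable_combine:
  fixes f g :: "'a \<Rightarrow> real"
  assumes "set_integrable M S f" "set_integrable M S g"
  shows "set_integrable M S (\<lambda>x. a * f x + b * g x)"
  using assms by (intro set_integral_add set_integrable_mult_right) auto

lemma ess_bounded_combine:
  assumes "ess_bounded M f" "ess_bounded M g" shows "ess_bounded M (\<lambda>x. a * f x + b * g x)"
proof -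
  obtain C D where C: "AE x in M. \<bar>f x\<bar> \<le> C" and D: "AE x in M. \<bar>g x\<bar> \<le> D"
    and m: "f \<in> borel_measurable M" "g \<in> borel_measurable M" using assms unfolding ess_bounded_def by blast
  have "AE x in M. \<bar>a * f x + b * g x\<bar> \<le> \<bar>a\<bar> * C + \<bar>b\<bar> * D"
    using C D
  proof eventually_elim
    case (elim x)
    have "\<bar>a * f x + b * g x\<bar> \<le> \<bar>a\<bar> * \<bar>f x\<bar> + \<bar>b\<bar> * \<bar>g x\<bar>"
      unfolding abs_mult[symmetric] by (rule abs_triangle_ineq)
    also have "\<dots> \<le> \<bar>a\<bar> * C + \<bar>b\<bar> * D" using elim by (intro add_mono mult_left_mono) auto
    finally show ?case .
  qed
  then show ?thesis unfolding ess_bounded_def using m by auto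
qed

lemma ess_bounded_continuous:
  assumes "ess_bounded M f" "continuous_on UNIV \<psi>" shows "ess_bounded M (\<lambda>x. \<psi> (f x))"
proof -
  obtain C where C: "AE x in M. \<bar>f x\<bar> \<le> C" and m: "f \<in> borel_measurable M" using assms unfolding ess_bounded_def by blast
  obtain D where D: "\<And>v. \<bar>v\<bar> \<le> C \<Longrightarrow> \<bar>\<psi> v\<bar> \<le> D" using continuous_bounded_on_interval[OF assms(2)] by blast
  have "AE x in M. \<bar>\<psi> (f x)\<bar> \<le> D" using C by eventually_elim (rule D)
  moreover have "(\<lambda>x. \<psi> (f x)) \<in> borel_measurable M"
    by (rule measurable_compose[OF m borel_measurable_continuous_onI[OF assms(2)]])
  ultimately show ?thesis unfolding ess_bounded_def by blast
qed

lemma lebesgue_indicator_measurable: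
  fixes f :: "real \<Rightarrow> real"
  assumes "f \<in> borel_measurable lebesgue"
  shows "(\<lambda>x. indicator {a..b} x *\<^sub>R f x) \<in> borel_measurable lebesgue"
  by (intro borel_measurable_scaleR borel_measurable_indicator assms) auto

lemma ess_bounded_set_integrable:
  assumes "ess_bounded lebesgue f" shows "set_integrable lebesgue {- R..R} (f :: real \<Rightarrow> real)"
proof -
  obtain C where C: "AE x in lebesgue. \<bar>f x\<bar> \<le> C" and m[measurable]: "f \<in> borel_measurable lebesgue" using assms unfolding ess_bounded_def by blast
  show ?thesis
    unfolding set_integrable_def
  proof (rule integrableI_bounded_set[where A="{- R..R}" and B=C])
    show "(\<lambda>x. indicator {- R..R} x *\<^sub>R f x) \<in> borel_measurable lebesgue"
      by (rule lebesgue_indicator_measurable[OF m])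
  qed (use C in \<open>auto simp: indicator_def emeasure_lborel_Icc_eq elim: eventually_mono\<close>)
qed

lemma ess_bounded_diff_set_integrable:
  "ess_bounded lebesgue f \<Longrightarrow> ess_bounded lebesgue g \<Longrightarrow> set_integrable lebesgue {- R..R} (\<lambda>x :: real. f x - g x)"
  by (intro set_integral_diff(1) ess_bounded_set_integrable)

text \<open>The converse direction of \<open>AE_half_plane_slices\<close>. A measurable null set
  covering the failures of \<open>P\<close> takes their place, so that its slices can be exchanged
  by Fubini's theorem.\<close>

lemma AE_slices_half_plane:
  assumes "AE p in lborel. p \<in> half_plane \<longrightarrow> P p"
  shows "AE t in lborel. 0 < t \<longrightarrow> (AE x in lborel. P (x, t))"
proof -
  obtain N where N: "{p. \<not> (p \<in> half_plane \<longrightarrow> P p)} \<subseteq> N" "N \<in> null_sets lborel"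
    using assms by (auto simp: eventually_ae_filter)
  have N': "N \<in> null_sets (lborel \<Otimes>\<^sub>M lborel)" using N(2) by (simp add: lborel_prod)
  have "AE x in lborel. AE t in lborel. (x, t) \<notin> N"
    using lborel_pair.AE_pair[OF AE_not_in[OF N']] .
  moreover have "{p \<in> space (lborel \<Otimes>\<^sub>M lborel). (fst p, snd p) \<notin> N} \<in> sets (lborel \<Otimes>\<^sub>M lborel)"
  proof -
    have "{p \<in> space (lborel \<Otimes>\<^sub>M lborel). (fst p, snd p) \<notin> N} = space (lborel \<Otimes>\<^sub>M lborel) - N" by auto
    then show ?thesis using sets.compl_sets[OF null_setsD2[OF N']] by simp
  qed
  ultimately have "AE t in lborel. AE x in lborel. (x, t) \<notin> N"
    using lborel_pair.AE_commute[of "\<lambda>x t. (x, t) \<notin> N"] by simp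
  then show ?thesis
  proof eventually_elim
    case (elim t)
    show ?case
    proof
      assume "0 < t"
      show "AE x in lborel. P (x, t)"
        using elim by eventually_elim (use N(1) \<open>0 < t\<close> in \<open>auto simp: half_plane_def\<close>)
    qed
  qed
qed

lemma borel_slice:
  assumes "g \<in> borel_measurable (borel :: (real \<times> real) measure)"
  shows "(\<lambda>x. g (x, t)) \<in> borel_measurable borel"
  using measurable_compose[OF measurable_Pair2'[of t borel borel], of g borel] assms by (simp add: borel_prod)

text \<open>All slices of the Borel version are Borel, and at almost every time the given function
  agrees with them up to a null set in x.\<close>

lemma ess_bounded_slices:
  assumes "ess_bounded (lebesgue_on half_plane) (\<lambda>(x, t). f x t)"
  shows "AE t in lborel. 0 < t \<longrightarrow> ess_bounded lebesgue (\<lambda>x. f x t)"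
proof -
  obtain K g where g: "borel_version f K g" using borel_version_exists[OF assms] by blast
  then have gm: "g \<in> borel_measurable borel" and gK: "\<And>p. \<bar>g p\<bar> \<le> K"
    and eq: "AE p in lborel. p \<in> half_plane \<longrightarrow> g p = f (fst p) (snd p)"
    unfolding borel_version_def by blast+
  show ?thesis
    using AE_slices_half_plane[OF eq]
  proof eventually_elim
    case (elim t)
    show ?case
    proof
      assume "0 < t"
      then have ae: "AE x in lborel. f x t = g (x, t)" using elim by (auto elim: eventually_mono)
      have "(\<lambda>x. f x t) \<in> borel_measurable lebesgue"
        by (rule AE_lebesgue_eq_measurable[OF borel_slice[OF gm] ae])
      moreover have "AE x in lebesgue. \<bar>f x t\<bar> \<le> K"
        by (rule AE_completion) (use ae gK in \<open>auto elim: eventually_mono\<close>)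
      ultimately show "ess_bounded lebesgue (\<lambda>x. f x t)" unfolding ess_bounded_def by blast
    qed
  qed
qed

text \<open>Boundedness makes almost every slice locally integrable. This matters: a non-integrable
  difference would have integral 0 by convention, and the triangle inequality could fail.\<close>

lemma has_initial_value_combine:
  assumes f: "ess_bounded (lebesgue_on half_plane) (\<lambda>(x, t). f x t)" "ess_bounded lebesgue f0" "has_initial_value f f0"
    and g: "ess_bounded (lebesgue_on half_plane) (\<lambda>(x, t). g x t)" "ess_bounded lebesgue g0" "has_initial_value g g0"
  shows "has_initial_value (\<lambda>x t. a * f x t + b * g x t) (\<lambda>x. a * f0 x + b * g0 x)"
  unfolding has_initial_value_def
proof (intro allI impI)
  fix R \<epsilon> :: real assume "R > 0" "\<epsilon> > 0"
  define \<epsilon>' where "\<epsilon>' = \<epsilon> / (\<bar>a\<bar> + \<bar>b\<bar> + 1)"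
  have \<epsilon>': "\<epsilon>' > 0" using \<open>\<epsilon> > 0\<close> by (simp add: \<epsilon>'_def add_nonneg_pos)
  obtain \<delta>1 where \<delta>1: "\<delta>1 > 0" "AE t in lebesgue. 0 < t \<and> t < \<delta>1 \<longrightarrow> (LINT x:{-R..R}|lebesgue. \<bar>f x t - f0 x\<bar>) < \<epsilon>'"
    using f(3) \<open>R > 0\<close> \<epsilon>' unfolding has_initial_value_def by blast
  obtain \<delta>2 where \<delta>2: "\<delta>2 > 0" "AE t in lebesgue. 0 < t \<and> t < \<delta>2 \<longrightarrow> (LINT x:{-R..R}|lebesgue. \<bar>g x t - g0 x\<bar>) < \<epsilon>'"
    using g(3) \<open>R > 0\<close> \<epsilon>' unfolding has_initial_value_def by blast
  show "\<exists>\<delta>>0. AE t in lebesgue. 0 < t \<and> t < \<delta> \<longrightarrow> (LINT x:{-R..R}|lebesgue. \<bar>a * f x t + b * g x t - (a * f0 x + b * g0 x)\<bar>) < \<epsilon>"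
  proof (intro exI[of _ "min \<delta>1 \<delta>2"] conjI)
    show "AE t in lebesgue. 0 < t \<and> t < min \<delta>1 \<delta>2 \<longrightarrow> (LINT x:{-R..R}|lebesgue. \<bar>a * f x t + b * g x t - (a * f0 x + b * g0 x)\<bar>) < \<epsilon>"
      using \<delta>1(2) \<delta>2(2) AE_completion[OF ess_bounded_slices[OF f(1)]] AE_completion[OF ess_bounded_slices[OF g(1)]]
    proof eventually_elim
      case (elim t)
      show ?case
      proof
        assume t: "0 < t \<and> t < min \<delta>1 \<delta>2"
        have i: "set_integrable lebesgue {-R..R} (\<lambda>x. f x t - f0 x)" "set_integrable lebesgue {-R..R} (\<lambda>x. g x t - g0 x)"
          using elim(3,4) t f(2) g(2) by (simp_all add: ess_bounded_diff_set_integrable)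
        have "a * f x t + b * g x t - (a * f0 x + b * g0 x) = a * (f x t - f0 x) + b * (g x t - g0 x)" for x
          by (simp add: algebra_simps)
        then have "(LINT x:{-R..R}|lebesgue. \<bar>a * f x t + b * g x t - (a * f0 x + b * g0 x)\<bar>)
            \<le> \<bar>a\<bar> * (LINT x:{-R..R}|lebesgue. \<bar>f x t - f0 x\<bar>) + \<bar>b\<bar> * (LINT x:{-R..R}|lebesgue. \<bar>g x t - g0 x\<bar>)"
          using set_integral_combine_le[OF i] by simp
        also have "\<dots> \<le> \<bar>a\<bar> * \<epsilon>' + \<bar>b\<bar> * \<epsilon>'" using elim(1,2) t by (intro add_mono mult_left_mono) auto
        also have "\<dots> < (\<bar>a\<bar> + \<bar>b\<bar> + 1) * \<epsilon>'" using \<epsilon>' by (simp add: algebra_simps)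
        also have "\<dots> = \<epsilon>" by (simp add: \<epsilon>'_def add_nonneg_pos less_imp_neq[symmetric] add_nonneg_eq_0_iff)
        finally show "(LINT x:{-R..R}|lebesgue. \<bar>a * f x t + b * g x t - (a * f0 x + b * g0 x)\<bar>) < \<epsilon>" .
      qed
    qed
  qed (use \<delta>1 \<delta>2 in auto)
qed

text \<open>Bridges the Borel data from which solutions are constructed and the given data, which
  agree with them only almost everywhere.\<close>

lemma has_initial_value_cong_AE:
  assumes "has_initial_value f v" "AE x in lborel. v x = w x" "\<And>t. (\<lambda>x. f x t) \<in> borel_measurable lebesgue"
    "v \<in> borel_measurable lebesgue" "w \<in> borel_measurable lebesgue"
  shows "has_initial_value f w"
proof -
  have "(LINT x:{-R..R}|lebesgue. \<bar>f x t - v x\<bar>) = (LINT x:{-R..R}|lebesgue. \<bar>f x t - w x\<bar>)" for R t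
    unfolding set_lebesgue_integral_def
  proof (rule integral_cong_AE)
    note [measurable] = assms(3)[of t] assms(4,5)
    show "AE x in lebesgue. indicator {-R..R} x *\<^sub>R \<bar>f x t - v x\<bar> = indicator {-R..R} x *\<^sub>R \<bar>f x t - w x\<bar>"
      by (rule AE_completion) (use assms(2) in \<open>auto elim: eventually_mono\<close>)
    show "(\<lambda>x. indicator {-R..R} x *\<^sub>R \<bar>f x t - v x\<bar>) \<in> borel_measurable lebesgue"
      "(\<lambda>x. indicator {-R..R} x *\<^sub>R \<bar>f x t - w x\<bar>) \<in> borel_measurable lebesgue"
      by (intro lebesgue_indicator_measurable borel_measurable_abs borel_measurable_diff assms)+
  qed
  then show ?thesis using assms(1) by (simp add: has_initial_value_def)
qed

lemma L1_loc_continuous_combine: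
  assumes "L1_loc_continuous f" "L1_loc_continuous g"
  shows "L1_loc_continuous (\<lambda>x t. a * f x t + b * g x t)"
  unfolding L1_loc_continuous_def
proof (intro allI impI conjI)
  fix R s :: real assume R: "R > 0" and s: "s > 0"
  have if_: "set_integrable lebesgue {-R..R} (\<lambda>x. f x t)" and ig: "set_integrable lebesgue {-R..R} (\<lambda>x. g x t)" if "t > 0" for t
    using assms R that unfolding L1_loc_continuous_def by blast+
  show "set_integrable lebesgue {-R..R} (\<lambda>x. a * f x s + b * g x s)"
    by (rule set_integrable_combine[OF if_[OF s] ig[OF s]])
  have lim: "((\<lambda>t. LINT x:{-R..R}|lebesgue. \<bar>f x t - f x s\<bar>) \<longlongrightarrow> 0) (at s)"
    "((\<lambda>t. LINT x:{-R..R}|lebesgue. \<bar>g x t - g x s\<bar>) \<longlongrightarrow> 0) (at s)"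
    using assms R s unfolding L1_loc_continuous_def by blast+
  show "((\<lambda>t. LINT x:{-R..R}|lebesgue. \<bar>a * f x t + b * g x t - (a * f x s + b * g x s)\<bar>) \<longlongrightarrow> 0) (at s)"
  proof (rule Lim_null_comparison)
    have "((\<lambda>t. \<bar>a\<bar> * (LINT x:{-R..R}|lebesgue. \<bar>f x t - f x s\<bar>) + \<bar>b\<bar> * (LINT x:{-R..R}|lebesgue. \<bar>g x t - g x s\<bar>)) \<longlongrightarrow> \<bar>a\<bar> * 0 + \<bar>b\<bar> * 0) (at s)"
      by (intro tendsto_add tendsto_mult tendsto_const lim)
    then show "((\<lambda>t. \<bar>a\<bar> * (LINT x:{-R..R}|lebesgue. \<bar>f x t - f x s\<bar>) + \<bar>b\<bar> * (LINT x:{-R..R}|lebesgue. \<bar>g x t - g x s\<bar>)) \<longlongrightarrow> 0) (at s)"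
      by simp
    have "\<forall>\<^sub>F t in at s. t \<in> {0<..}" using s by (intro eventually_at_in_open') auto
    then show "\<forall>\<^sub>F t in at s. norm (LINT x:{-R..R}|lebesgue. \<bar>a * f x t + b * g x t - (a * f x s + b * g x s)\<bar>)
        \<le> \<bar>a\<bar> * (LINT x:{-R..R}|lebesgue. \<bar>f x t - f x s\<bar>) + \<bar>b\<bar> * (LINT x:{-R..R}|lebesgue. \<bar>g x t - g x s\<bar>)"
    proof eventually_elim
      case (elim t)
      have i: "set_integrable lebesgue {-R..R} (\<lambda>x. f x t - f x s)" "set_integrable lebesgue {-R..R} (\<lambda>x. g x t - g x s)"
        using set_integral_diff(1)[OF if_[of t] if_[OF s]] set_integral_diff(1)[OF ig[of t] ig[OF s]] elim by simp_all
      have "a * f x t + b * g x t - (a * f x s + b * g x s) = a * (f x t - f x s) + b * (g x t - g x s)" for x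
        by (simp add: algebra_simps)
      moreover have "0 \<le> (LINT x:{-R..R}|lebesgue. \<bar>a * (f x t - f x s) + b * (g x t - g x s)\<bar>)"
        unfolding set_lebesgue_integral_def by (rule Bochner_Integration.integral_nonneg) auto
      ultimately show ?case using set_integral_combine_le[OF i] by simp
    qed
  qed
qed

text \<open>Monotone convergence along the intervals [-n, n].\<close>

lemma integrable_of_local_bounds:
  fixes f :: "real \<Rightarrow> real"
  assumes "\<And>x. 0 \<le> f x" "\<And>n::nat. set_integrable lebesgue {- real n..real n} f"
    "\<And>n::nat. (LINT x:{- real n..real n}|lebesgue. f x) \<le> E"
  shows "integrable lebesgue f \<and> (LINT x|lebesgue. f x) \<le> E"
proof -
  let ?g = "\<lambda>n x. indicator {- real n..real n} x * f x"
  have i: "integrable lebesgue (?g n)" and le: "(LINT x|lebesgue. ?g n x) \<le> E" for n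
    using assms(2,3)[of n] by (simp_all add: set_integrable_def set_lebesgue_integral_def)
  have mono: "?g m x \<le> ?g n x" if "m \<le> n" for m n x using assms(1)[of x] that by (auto simp: indicator_def)
  have lim: "(\<lambda>n. ?g n x) \<longlonglongrightarrow> f x" for x
  proof (rule tendsto_eventually)
    obtain n0 where "\<bar>x\<bar> \<le> real n0" using real_arch_simple by blast
    then show "\<forall>\<^sub>F n in sequentially. ?g n x = f x"
      by (intro eventually_sequentiallyI[of n0]) (auto simp: indicator_def)
  qed
  have inc: "incseq (\<lambda>n. LINT x|lebesgue. ?g n x)"
    by (rule incseq_SucI) (intro integral_mono i mono, simp)
  obtain L where L: "(\<lambda>n. LINT x|lebesgue. ?g n x) \<longlonglongrightarrow> L" "\<And>n. (LINT x|lebesgue. ?g n x) \<le> L"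
    using le by (rule_tac incseq_convergent[OF inc]) auto
  have m: "f \<in> borel_measurable lebesgue"
    by (rule borel_measurable_LIMSEQ_real[OF lim]) (use i in auto)
  have "integrable lebesgue f" "integral\<^sup>L lebesgue f = L"
    using integrable_monotone_convergence[OF i _ _ L(1) m] integral_monotone_convergence[OF i _ _ L(1) m]
      AE_I2[of lebesgue "\<lambda>x. mono (\<lambda>n. ?g n x)"] AE_I2[of lebesgue "\<lambda>x. (\<lambda>n. ?g n x) \<longlonglongrightarrow> f x"] mono lim
    by (simp_all add: mono_def)
  moreover have "L \<le> E" using le by (intro LIMSEQ_le_const2[OF L(1)]) auto
  ultimately show ?thesis by simp
qed

text \<open>The abstract \<open>contraction\<close> with e = |w - v|, bounded by 2 K, and with the
  Kruzhkov flux, for which |F| = e |w + v|/2 \<le> K e.\<close>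

theorem burgers_contraction:
  assumes w: "burgers_entropy_solution w" "ess_bounded (lebesgue_on half_plane) (\<lambda>(x, t). w x t)"
      "ess_bounded lebesgue w0" "has_initial_value w w0"
    and v: "burgers_entropy_solution v" "ess_bounded (lebesgue_on half_plane) (\<lambda>(x, t). v x t)"
      "ess_bounded lebesgue v0" "has_initial_value v v0"
    and int: "integrable lebesgue (\<lambda>x. w0 x - v0 x)"
  shows "AE t in lborel. 0 < t \<longrightarrow> integrable lebesgue (\<lambda>x. w x t - v x t) \<and>
     L1_norm (\<lambda>x. w x t - v x t) \<le> L1_norm (\<lambda>x. w0 x - v0 x)"
proof -
  obtain K1 g where g1: "borel_version w K1 g" using borel_version_exists[OF w(2)] by blast
  obtain K2 f where f1: "borel_version v K2 f" using borel_version_exists[OF v(2)] by blast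
  define K where "K = max K1 K2"
  have g: "borel_version w K g" and f: "borel_version v K f"
    using borel_version_mono[OF g1] borel_version_mono[OF f1] by (auto simp: K_def)
  have gm: "g \<in> borel_measurable borel" "\<And>p. \<bar>g p\<bar> \<le> K" "AE p in lborel. p \<in> half_plane \<longrightarrow> g p = w (fst p) (snd p)"
    and fm: "f \<in> borel_measurable borel" "\<And>p. \<bar>f p\<bar> \<le> K" "AE p in lborel. p \<in> half_plane \<longrightarrow> f p = v (fst p) (snd p)"
    using g f unfolding borel_version_def by blast+
  have K: "0 \<le> K" using gm(2)[of undefined] by linarith
  define e where "e p = \<bar>g p - f p\<bar>" for p
  define F where "F p = kflux (g p) (f p)" for p
  define E0 where "E0 = L1_norm (\<lambda>x. w0 x - v0 x)"
  have em: "e \<in> borel_measurable borel" "F \<in> borel_measurable borel"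
    unfolding e_def[abs_def] F_def[abs_def] using gm(1) fm(1) by measurable
  have eb: "0 \<le> e p" "e p \<le> 2 * K" for p using gm(2)[of p] fm(2)[of p] by (auto simp: e_def)
  have Fb: "\<bar>F p\<bar> \<le> K * e p" for p
  proof -
    have "\<bar>F p\<bar> = \<bar>g p - f p\<bar> * (\<bar>g p + f p\<bar> / 2)" by (simp add: F_def kflux_def abs_mult)
    also have "\<dots> \<le> \<bar>g p - f p\<bar> * K" using gm(2)[of p] fm(2)[of p] by (intro mult_left_mono) auto
    finally show ?thesis by (simp add: e_def mult.commute)
  qed
  have ineq: "0 \<le> (\<integral>p. e p * (a (fst p) * b' (snd p)) + F p * (a' (fst p) * b (snd p)) \<partial>lborel)"
    if "bump_fun UNIV a a'" "bump_fun {0<..} b b'" for a a' b b'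
    unfolding e_def F_def by (rule kruzkov_pair_inequality[OF w(1,2) g v(1,2) f that])
  have slices: "AE t in lborel. 0 < t \<longrightarrow> ess_bounded lebesgue (\<lambda>x. w x t) \<and> ess_bounded lebesgue (\<lambda>x. v x t) \<and>
      (AE x in lborel. e (x, t) = \<bar>w x t - v x t\<bar>)"
    using ess_bounded_slices[OF w(2)] ess_bounded_slices[OF v(2)] AE_slices_half_plane[OF gm(3)] AE_slices_half_plane[OF fm(3)]
  proof eventually_elim
    case (elim t)
    show ?case
    proof
      assume t: "0 < t"
      have "AE x in lborel. g (x, t) = w x t" "AE x in lborel. f (x, t) = v x t" using elim t by auto
      then have "AE x in lborel. e (x, t) = \<bar>w x t - v x t\<bar>" by eventually_elim (simp add: e_def)
      then show "ess_bounded lebesgue (\<lambda>x. w x t) \<and> ess_bounded lebesgue (\<lambda>x. v x t) \<and>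
        (AE x in lborel. e (x, t) = \<bar>w x t - v x t\<bar>)" using elim t by blast
    qed
  qed
  have local_eq: "(LINT x:{-R..R}|lebesgue. \<bar>w x t - v x t\<bar>) = (\<integral>x. indicator {-R..R} x * e (x, t) \<partial>lborel)"
    if "ess_bounded lebesgue (\<lambda>x. w x t)" "ess_bounded lebesgue (\<lambda>x. v x t)" "AE x in lborel. e (x, t) = \<bar>w x t - v x t\<bar>" for R t
  proof -
    have m: "(\<lambda>x. indicator {-R..R} x * e (x, t)) \<in> borel_measurable borel" using borel_slice[OF em(1)] by measurable
    have [measurable]: "(\<lambda>x. w x t) \<in> borel_measurable lebesgue" "(\<lambda>x. v x t) \<in> borel_measurable lebesgue"
      using that by (auto simp: ess_bounded_def)
    have "(LINT x:{-R..R}|lebesgue. \<bar>w x t - v x t\<bar>) = (\<integral>x. indicator {-R..R} x * e (x, t) \<partial>lebesgue)"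
      unfolding set_lebesgue_integral_def
    proof (rule integral_cong_AE)
      show "AE x in lebesgue. indicator {-R..R} x *\<^sub>R \<bar>w x t - v x t\<bar> = indicator {-R..R} x * e (x, t)"
        by (rule AE_completion) (use that(3) in \<open>auto elim: eventually_mono\<close>)
      show "(\<lambda>x. indicator {-R..R} x * e (x, t)) \<in> borel_measurable lebesgue" using m by (intro measurable_completion) simp
      show "(\<lambda>x. indicator {-R..R} x *\<^sub>R \<bar>w x t - v x t\<bar>) \<in> borel_measurable lebesgue"
        using that by (intro lebesgue_indicator_measurable borel_measurable_abs borel_measurable_diff) (auto simp: ess_bounded_def)
    qed
    also have "\<dots> = (\<integral>x. indicator {-R..R} x * e (x, t) \<partial>lborel)" using m by (intro integral_completion) simp
    finally show ?thesis .
  qed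
  have init: "\<exists>\<delta>>0. AE t in lborel. 0 < t \<and> t < \<delta> \<longrightarrow> local_mass e R t \<le> E0 + \<epsilon>" if "R > 0" "\<epsilon> > 0" for R \<epsilon>
  proof -
    \<comment> \<open>\<open>cutoff R\<close> is supported in [-2R, 2R]. There |w - v| is compared
      with |w0 - v0| at the cost of \<epsilon>/2 for each solution.\<close>
    have e2: "\<epsilon> / 2 > 0" "2 * R > 0" using that by simp_all
    obtain \<delta>1 where \<delta>1: "\<delta>1 > 0" "AE t in lebesgue. 0 < t \<and> t < \<delta>1 \<longrightarrow> (LINT x:{-(2 * R)..2 * R}|lebesgue. \<bar>w x t - w0 x\<bar>) < \<epsilon> / 2"
      using w(4) e2 unfolding has_initial_value_def by blast
    obtain \<delta>2 where \<delta>2: "\<delta>2 > 0" "AE t in lebesgue. 0 < t \<and> t < \<delta>2 \<longrightarrow> (LINT x:{-(2 * R)..2 * R}|lebesgue. \<bar>v x t - v0 x\<bar>) < \<epsilon> / 2"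
      using v(4) e2 unfolding has_initial_value_def by blast
    show ?thesis
    proof (intro exI[of _ "min \<delta>1 \<delta>2"] conjI)
      show "AE t in lborel. 0 < t \<and> t < min \<delta>1 \<delta>2 \<longrightarrow> local_mass e R t \<le> E0 + \<epsilon>"
        using \<delta>1(2)[unfolded AE_completion_iff] \<delta>2(2)[unfolded AE_completion_iff] slices
      proof eventually_elim
        case (elim t)
        show ?case
        proof
          assume t: "0 < t \<and> t < min \<delta>1 \<delta>2"
          let ?I = "{-(2 * R)..2 * R}"
          have s: "ess_bounded lebesgue (\<lambda>x. w x t)" "ess_bounded lebesgue (\<lambda>x. v x t)" "AE x in lborel. e (x, t) = \<bar>w x t - v x t\<bar>"
            using elim(3) t by blast+
          have i1: "set_integrable lebesgue ?I (\<lambda>x. w x t - w0 x)" and i2: "set_integrable lebesgue ?I (\<lambda>x. v x t - v0 x)"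
            and i3: "set_integrable lebesgue ?I (\<lambda>x. w0 x - v0 x)"
            using s(1,2) w(3) v(3) by (simp_all add: ess_bounded_diff_set_integrable)
          have "local_mass e R t \<le> (\<integral>x. indicator ?I x * e (x, t) \<partial>lborel)"
            unfolding local_mass_def
          proof (rule integral_mono')
            show "integrable lborel (\<lambda>x. indicator ?I x * e (x, t))"
              by (rule integrable_box[where C="2 * K" and S="?I"])
                (use borel_slice[OF em(1)] eb K in \<open>auto simp: indicator_def abs_of_nonneg\<close>)
            fix x
            show "cutoff R x * e (x, t) \<le> indicator ?I x * e (x, t)"
              using cutoff_outside[OF \<open>R > 0\<close>, of x]
                mult_right_mono[OF cutoff_bounds(2)[OF \<open>R > 0\<close>, of x] eb(1)[of "(x, t)"]]
              by (cases "x \<in> ?I") auto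
            show "0 \<le> indicator ?I x * e (x, t)" using eb(1) by simp
          qed
          also have "\<dots> = (LINT x:?I|lebesgue. \<bar>w x t - v x t\<bar>)" using local_eq[OF s] by simp
          \<comment> \<open>The factors 1 and -1 bring (w - w0) + (w0 - v0) - (v - v0) into the
            shape of \<open>set_integral_combine_le\<close>.\<close>
          also have "\<dots> = (LINT x:?I|lebesgue. \<bar>1 * ((w x t - w0 x)) + 1 * (1 * (w0 x - v0 x) + (-1) * (v x t - v0 x))\<bar>)" by simp
          also have "\<dots> \<le> \<bar>1\<bar> * (LINT x:?I|lebesgue. \<bar>w x t - w0 x\<bar>) + \<bar>1\<bar> * (LINT x:?I|lebesgue. \<bar>1 * (w0 x - v0 x) + (-1) * (v x t - v0 x)\<bar>)"
            by (rule set_integral_combine_le[OF i1 set_integrable_combine[OF i3 i2]])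
          also have "\<dots> \<le> \<bar>1\<bar> * (LINT x:?I|lebesgue. \<bar>w x t - w0 x\<bar>) + \<bar>1\<bar> * (\<bar>1\<bar> * (LINT x:?I|lebesgue. \<bar>w0 x - v0 x\<bar>) + \<bar>-1\<bar> * (LINT x:?I|lebesgue. \<bar>v x t - v0 x\<bar>))"
            by (intro add_mono mult_left_mono order_refl set_integral_combine_le[OF i3 i2]) auto
          also have "(LINT x:?I|lebesgue. \<bar>w0 x - v0 x\<bar>) \<le> E0"
            unfolding E0_def L1_norm_def set_lebesgue_integral_def
            by (rule integral_mono') (use int in \<open>auto simp: indicator_def\<close>)
          finally show "local_mass e R t \<le> E0 + \<epsilon>" using elim(1,2) t by simp
        qed
      qed
    qed (use \<delta>1 \<delta>2 in auto)
  qed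
  have "AE \<tau> in lborel. 0 < \<tau> \<longrightarrow> (\<forall>n::nat. (\<integral>x. indicator {- real n..real n} x * e (x, \<tau>) \<partial>lborel) \<le> E0)"
    by (rule contraction[OF em eb Fb K ineq init])
  with slices show ?thesis
  proof eventually_elim
    case (elim t)
    show ?case
    proof
      assume t: "0 < t"
      then have s: "ess_bounded lebesgue (\<lambda>x. w x t)" "ess_bounded lebesgue (\<lambda>x. v x t)" "AE x in lborel. e (x, t) = \<bar>w x t - v x t\<bar>"
        using elim(1) by blast+
      have i: "set_integrable lebesgue {- real n..real n} (\<lambda>x. w x t - v x t)" for n :: nat
        using s(1,2) by (rule ess_bounded_diff_set_integrable)
      have "integrable lebesgue (\<lambda>x. \<bar>w x t - v x t\<bar>) \<and> (LINT x|lebesgue. \<bar>w x t - v x t\<bar>) \<le> E0"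
      proof (rule integrable_of_local_bounds)
        show "set_integrable lebesgue {- real n..real n} (\<lambda>x. \<bar>w x t - v x t\<bar>)" for n :: nat
          by (rule set_integrable_abs[OF i])
        show "(LINT x:{- real n..real n}|lebesgue. \<bar>w x t - v x t\<bar>) \<le> E0" for n :: nat
          using elim(2) t local_eq[OF s, of "real n"] by simp
      qed simp
      then have a: "integrable lebesgue (\<lambda>x. \<bar>w x t - v x t\<bar>)" and b: "L1_norm (\<lambda>x. w x t - v x t) \<le> E0"
        unfolding L1_norm_def by (rule conjunct1, rule conjunct2)
      have m: "(\<lambda>x. w x t - v x t) \<in> borel_measurable lebesgue" using s(1,2) by (auto simp: ess_bounded_def)
      show "integrable lebesgue (\<lambda>x. w x t - v x t) \<and> L1_norm (\<lambda>x. w x t - v x t) \<le> L1_norm (\<lambda>x. w0 x - v0 x)"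
        by (rule conjI[OF integrable_abs_cancel[OF a m] b[unfolded E0_def]])
    qed
  qed
qed

text \<open>Equal data make the right-hand side of the contraction 0. The equality passes from
  slices to the plane through Borel representatives, for which the set of equality is
  measurable.\<close>

corollary burgers_uniqueness:
  assumes w: "burgers_entropy_solution w" "ess_bounded (lebesgue_on half_plane) (\<lambda>(x, t). w x t)" "has_initial_value w w0"
    and v: "burgers_entropy_solution v" "ess_bounded (lebesgue_on half_plane) (\<lambda>(x, t). v x t)" "has_initial_value v w0"
    and w0: "ess_bounded lebesgue w0"
  shows "AE p in lborel. p \<in> half_plane \<longrightarrow> w (fst p) (snd p) = v (fst p) (snd p)"
proof -
  obtain K1 g where g1: "borel_version w K1 g" using borel_version_exists[OF w(2)] by blast
  obtain K2 f where f1: "borel_version v K2 f" using borel_version_exists[OF v(2)] by blast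
  have gm: "g \<in> borel_measurable borel" "AE p in lborel. p \<in> half_plane \<longrightarrow> g p = w (fst p) (snd p)"
    and fm: "f \<in> borel_measurable borel" "AE p in lborel. p \<in> half_plane \<longrightarrow> f p = v (fst p) (snd p)"
    using g1 f1 unfolding borel_version_def by blast+
  have c: "AE t in lborel. 0 < t \<longrightarrow> integrable lebesgue (\<lambda>x. w x t - v x t) \<and>
     L1_norm (\<lambda>x. w x t - v x t) \<le> L1_norm (\<lambda>x. w0 x - w0 x)"
    by (rule burgers_contraction[OF w(1,2) w0 w(3) v(1,2) w0 v(3)]) simp
  have "AE p in lborel. p \<in> half_plane \<longrightarrow> g p = f p"
  proof (rule AE_half_plane_slices)
    show "Measurable.pred (borel \<Otimes>\<^sub>M borel) (\<lambda>p. g p = f p)"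
      using gm(1) fm(1) unfolding borel_prod by measurable
    show "AE t in lborel. 0 < t \<longrightarrow> (AE x in lborel. g (x, t) = f (x, t))"
      using c AE_slices_half_plane[OF gm(2)] AE_slices_half_plane[OF fm(2)]
    proof eventually_elim
      case (elim t)
      show ?case
      proof
        assume t: "0 < t"
        have i: "integrable lebesgue (\<lambda>x. \<bar>w x t - v x t\<bar>)" and le: "(LINT x|lebesgue. \<bar>w x t - v x t\<bar>) \<le> 0"
          using elim(1) t by (simp_all add: L1_norm_def)
        have "(LINT x|lebesgue. \<bar>w x t - v x t\<bar>) = 0"
          by (rule antisym[OF le]) (rule Bochner_Integration.integral_nonneg, simp)
        then have "AE x in lebesgue. \<bar>w x t - v x t\<bar> = 0" using integral_nonneg_eq_0_iff_AE[OF i] by simp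
        then have a: "AE x in lborel. \<bar>w x t - v x t\<bar> = 0" by (simp only: AE_completion_iff)
        have "AE x in lborel. g (x, t) = w x t" "AE x in lborel. f (x, t) = v x t" using elim(2,3) t by auto
        with a show "AE x in lborel. g (x, t) = f (x, t)" by eventually_elim simp
      qed
    qed
  qed
  then show ?thesis using gm(2) fm(2) by eventually_elim auto
qed

section \<open>The coupled system\<close>

text \<open>The weights \<open>k\<^sub>1\<close> = 1 and \<open>k\<^sub>2\<close> = 0, or the
  reverse, isolate one Riemann invariant. The factor 1 in front of \<open>u\<close> matches the
  lemmas on linear combinations.\<close>

lemma entropy_solution_burgers:
  assumes "entropy_solution \<alpha> \<rho> u"
  shows "burgers_entropy_solution (\<lambda>x t. 1 * u x t + sqrt \<alpha> * \<rho> x t)"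
    and "burgers_entropy_solution (\<lambda>x t. 1 * u x t + (- sqrt \<alpha>) * \<rho> x t)"
proof -
  have pair: "distr_le_zero (\<lambda>x t. \<eta> (\<rho> x t) (u x t)) (\<lambda>x t. q (\<rho> x t) (u x t))" if "entropy_pair \<alpha> \<eta> q" for \<eta> q
    using assms that by (simp add: entropy_solution_def)
  show "burgers_entropy_solution (\<lambda>x t. 1 * u x t + sqrt \<alpha> * \<rho> x t)"
    unfolding burgers_entropy_solution_def
  proof (intro allI impI)
    fix \<psi> \<phi> assume *: "convex_on UNIV \<psi>" "C2 \<psi>" "\<forall>v. (\<phi> has_real_derivative v * deriv \<psi> v) (at v)"
    have "entropy_pair \<alpha> (\<lambda>r v. 1 * \<psi> (v + sqrt \<alpha> * r) + 0 * \<psi> (v - sqrt \<alpha> * r)) (\<lambda>r v. 1 * \<phi> (v + sqrt \<alpha> * r) + 0 * \<phi> (v - sqrt \<alpha> * r))"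
      unfolding entropy_pair_def
      by (rule exI[of _ \<psi>], rule exI[of _ \<psi>], rule exI[of _ \<phi>], rule exI[of _ \<phi>], rule exI[of _ 1], rule exI[of _ 0]) (use * in simp)
    from pair[OF this] show "distr_le_zero (\<lambda>x t. \<psi> (1 * u x t + sqrt \<alpha> * \<rho> x t)) (\<lambda>x t. \<phi> (1 * u x t + sqrt \<alpha> * \<rho> x t))"
      by simp
  qed
  show "burgers_entropy_solution (\<lambda>x t. 1 * u x t + (- sqrt \<alpha>) * \<rho> x t)"
    unfolding burgers_entropy_solution_def
  proof (intro allI impI)
    fix \<psi> \<phi> assume *: "convex_on UNIV \<psi>" "C2 \<psi>" "\<forall>v. (\<phi> has_real_derivative v * deriv \<psi> v) (at v)"
    have "entropy_pair \<alpha> (\<lambda>r v. 0 * \<psi> (v + sqrt \<alpha> * r) + 1 * \<psi> (v - sqrt \<alpha> * r)) (\<lambda>r v. 0 * \<phi> (v + sqrt \<alpha> * r) + 1 * \<phi> (v - sqrt \<alpha> * r))"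
      unfolding entropy_pair_def
      by (rule exI[of _ \<psi>], rule exI[of _ \<psi>], rule exI[of _ \<phi>], rule exI[of _ \<phi>], rule exI[of _ 0], rule exI[of _ 1]) (use * in simp)
    from pair[OF this] show "distr_le_zero (\<lambda>x t. \<psi> (1 * u x t + (- sqrt \<alpha>) * \<rho> x t)) (\<lambda>x t. \<phi> (1 * u x t + (- sqrt \<alpha>) * \<rho> x t))"
      by simp
  qed
qed

lemma ess_bounded_test_integrable:
  assumes "ess_bounded (lebesgue_on half_plane) F" "continuous_on UNIV \<theta>" "compact S" "S \<subseteq> half_plane" "\<And>p. p \<notin> S \<Longrightarrow> \<theta> p = 0"
  shows "integrable (lebesgue_on half_plane) (\<lambda>p. F p * \<theta> p)"
proof -
  obtain C where C: "AE p in lebesgue_on half_plane. \<bar>F p\<bar> \<le> C" and m: "F \<in> borel_measurable (lebesgue_on half_plane)"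
    using assms(1) unfolding ess_bounded_def by blast
  have "box_bounded (\<lambda>p. \<bar>C\<bar> * \<bar>\<theta> p\<bar>)"
    by (intro box_bounded_mult_support[OF _ _ assms(3,4)] continuous_intros assms(2)) (use assms(5) in auto)
  then have i0: "integrable lborel (\<lambda>p. \<bar>C\<bar> * \<bar>\<theta> p\<bar>)" by (rule box_bounded_integrable)
  then have "integrable lebesgue (\<lambda>p. \<bar>C\<bar> * \<bar>\<theta> p\<bar>)"
    by (subst integrable_completion[OF borel_measurable_integrable[OF i0]])
  then have i: "integrable (lebesgue_on half_plane) (\<lambda>p. \<bar>C\<bar> * \<bar>\<theta> p\<bar>)"
    by (subst integrable_restrict_space) (auto intro: integrable_mult_indicator simp del: real_scaleR_def)
  have \<theta>m: "\<theta> \<in> borel_measurable (lebesgue_on half_plane)"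
    using borel_measurable_continuous_onI[OF assms(2)] by (intro measurable_restrict_space1 measurable_completion) simp
  show ?thesis
  proof (rule Bochner_Integration.integrable_bound[OF i])
    show "(\<lambda>p. F p * \<theta> p) \<in> borel_measurable (lebesgue_on half_plane)" using m \<theta>m by simp
    show "AE p in lebesgue_on half_plane. norm (F p * \<theta> p) \<le> norm (\<bar>C\<bar> * \<bar>\<theta> p\<bar>)"
      using C by eventually_elim (auto simp: abs_mult intro!: mult_right_mono)
  qed
qed

text \<open>Essential boundedness makes both integrals genuine, so that the integral of the sum
  splits; nonnegative weights keep the sign.\<close>

lemma distr_le_zero_combine:
  assumes "distr_le_zero F G" "distr_le_zero F' G'" "0 \<le> k" "0 \<le> l"
    and eb: "ess_bounded (lebesgue_on half_plane) (\<lambda>(x, t). F x t)" "ess_bounded (lebesgue_on half_plane) (\<lambda>(x, t). G x t)"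
    "ess_bounded (lebesgue_on half_plane) (\<lambda>(x, t). F' x t)" "ess_bounded (lebesgue_on half_plane) (\<lambda>(x, t). G' x t)"
  shows "distr_le_zero (\<lambda>x t. k * F x t + l * F' x t) (\<lambda>x t. k * G x t + l * G' x t)"
  unfolding distr_le_zero_def
proof (intro allI impI)
  fix \<theta> assume \<theta>: "test_function \<theta>" and nn: "\<forall>p. 0 \<le> \<theta> p"
  obtain \<theta>x \<theta>t \<theta>xx S where S: "compact S" "S \<subseteq> half_plane"
      and dx: "\<And>x t. ((\<lambda>y. \<theta> (y, t)) has_real_derivative \<theta>x (x, t)) (at x)"
      and dxx: "\<And>x t. ((\<lambda>y. \<theta>x (y, t)) has_real_derivative \<theta>xx (x, t)) (at x)"
      and dt: "\<And>x t. ((\<lambda>s. \<theta> (x, s)) has_real_derivative \<theta>t (x, t)) (at t)"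
      and cont: "continuous_on UNIV \<theta>" "continuous_on UNIV \<theta>x" "continuous_on UNIV \<theta>t" "continuous_on UNIV \<theta>xx"
      and zero: "\<And>p. p \<notin> S \<Longrightarrow> \<theta> p = 0 \<and> \<theta>x p = 0 \<and> \<theta>t p = 0 \<and> \<theta>xx p = 0"
      by (rule test_function_partials[OF \<theta>], rule that, assumption+)
  have d: "deriv (\<lambda>s. \<theta> (x, s)) t = \<theta>t (x, t)" "deriv (\<lambda>y. \<theta> (y, t)) x = \<theta>x (x, t)" for x t
    using DERIV_imp_deriv[OF dt] DERIV_imp_deriv[OF dx] by simp_all
  note int = ess_bounded_test_integrable[OF _ cont(3) S] ess_bounded_test_integrable[OF _ cont(2) S]
  have z: "\<theta>t p = 0" "\<theta>x p = 0" if "p \<notin> S" for p using zero[OF that] by simp_all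
  let ?I = "\<lambda>F G. (LINT p|lebesgue_on half_plane. F (fst p) (snd p) * \<theta>t p + G (fst p) (snd p) * \<theta>x p)"
  have i: "integrable (lebesgue_on half_plane) (\<lambda>p. F (fst p) (snd p) * \<theta>t p + G (fst p) (snd p) * \<theta>x p)"
     "integrable (lebesgue_on half_plane) (\<lambda>p. F' (fst p) (snd p) * \<theta>t p + G' (fst p) (snd p) * \<theta>x p)"
    by (rule Bochner_Integration.integrable_add[OF int(1)[OF eb(1)[unfolded case_prod_unfold] z(1)] int(2)[OF eb(2)[unfolded case_prod_unfold] z(2)]],
        assumption, assumption)
      (rule Bochner_Integration.integrable_add[OF int(1)[OF eb(3)[unfolded case_prod_unfold] z(1)] int(2)[OF eb(4)[unfolded case_prod_unfold] z(2)]],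
        assumption, assumption)
  have nn': "0 \<le> ?I F G" "0 \<le> ?I F' G'"
  proof -
    have "- (LINT (x, t)|lebesgue_on half_plane. F x t * deriv (\<lambda>s. \<theta> (x, s)) t + G x t * deriv (\<lambda>y. \<theta> (y, t)) x) \<le> 0"
      "- (LINT (x, t)|lebesgue_on half_plane. F' x t * deriv (\<lambda>s. \<theta> (x, s)) t + G' x t * deriv (\<lambda>y. \<theta> (y, t)) x) \<le> 0"
      using assms(1,2) \<theta> nn unfolding distr_le_zero_def by blast+
    then show "0 \<le> ?I F G" "0 \<le> ?I F' G'" by (simp_all add: d case_prod_unfold)
  qed
  have "?I (\<lambda>x t. k * F x t + l * F' x t) (\<lambda>x t. k * G x t + l * G' x t) =
    (LINT p|lebesgue_on half_plane. k * (F (fst p) (snd p) * \<theta>t p + G (fst p) (snd p) * \<theta>x p) +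
        l * (F' (fst p) (snd p) * \<theta>t p + G' (fst p) (snd p) * \<theta>x p))"
    by (rule Bochner_Integration.integral_cong) (auto simp: algebra_simps)
  also have "\<dots> = k * ?I F G + l * ?I F' G'" using i by simp
  also have "\<dots> \<ge> 0" using nn' assms(3,4) by simp
  finally show "- (LINT (x, t)|lebesgue_on half_plane. (k * F x t + l * F' x t) * deriv (\<lambda>s. \<theta> (x, s)) t +
       (k * G x t + l * G' x t) * deriv (\<lambda>y. \<theta> (y, t)) x) \<le> 0"
    by (simp add: d case_prod_unfold)
qed

text \<open>Inverts the change to Riemann invariants. Every entropy pair of the system is a
  nonnegative combination of one pair for \<open>w\<close> and one for \<open>z\<close>, and z \<le>
  w becomes \<rho> \<ge> 0.\<close>

lemma entropy_solution_of_burgers: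
  assumes "\<alpha> > 0" and w: "burgers_entropy_solution w" "ess_bounded (lebesgue_on half_plane) (\<lambda>(x, t). w x t)"
    and z: "burgers_entropy_solution z" "ess_bounded (lebesgue_on half_plane) (\<lambda>(x, t). z x t)"
    and le: "AE (x, t) in lebesgue_on half_plane. z x t \<le> w x t"
  shows "entropy_solution \<alpha> (\<lambda>x t. 1 / (2 * sqrt \<alpha>) * w x t + (- 1 / (2 * sqrt \<alpha>)) * z x t) (\<lambda>x t. 1 / 2 * w x t + 1 / 2 * z x t)"
  (is "entropy_solution \<alpha> ?\<rho> ?u")
  unfolding entropy_solution_def
proof (intro conjI allI impI)
  have s: "sqrt \<alpha> > 0" using assms(1) by simp
  show "ess_bounded (lebesgue_on half_plane) (\<lambda>(x, t). ?\<rho> x t)" "ess_bounded (lebesgue_on half_plane) (\<lambda>(x, t). ?u x t)"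
    using w(2) z(2) unfolding case_prod_unfold by (rule ess_bounded_combine)+
  show "AE (x, t) in lebesgue_on half_plane. 0 \<le> ?\<rho> x t"
    using le by eventually_elim (use s in \<open>auto simp: field_simps\<close>)
  fix \<eta> q assume "entropy_pair \<alpha> \<eta> q"
  then obtain \<psi>1 \<psi>2 \<phi>1 \<phi>2 k1 k2 where p: "convex_on UNIV \<psi>1" "C2 \<psi>1" "convex_on UNIV \<psi>2" "C2 \<psi>2" "0 \<le> k1" "0 \<le> k2"
      "\<forall>v. (\<phi>1 has_real_derivative v * deriv \<psi>1 v) (at v)"
      "\<forall>v. (\<phi>2 has_real_derivative v * deriv \<psi>2 v) (at v)"
    and \<eta>: "\<eta> = (\<lambda>r v. k1 * \<psi>1 (v + sqrt \<alpha> * r) + k2 * \<psi>2 (v - sqrt \<alpha> * r))"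
    and q: "q = (\<lambda>r v. k1 * \<phi>1 (v + sqrt \<alpha> * r) + k2 * \<phi>2 (v - sqrt \<alpha> * r))"
    unfolding entropy_pair_def by blast
  have wz: "?u x t + sqrt \<alpha> * ?\<rho> x t = w x t" "?u x t - sqrt \<alpha> * ?\<rho> x t = z x t" for x t
    using s by (simp_all add: field_simps)
  have c: "continuous_on UNIV \<psi>1" "continuous_on UNIV \<psi>2" "continuous_on UNIV \<phi>1" "continuous_on UNIV \<phi>2"
    using p(2,4,7,8) unfolding C2_def by (blast intro: continuous_at_imp_continuous_on DERIV_isCont)+
  have "distr_le_zero (\<lambda>x t. k1 * \<psi>1 (w x t) + k2 * \<psi>2 (z x t)) (\<lambda>x t. k1 * \<phi>1 (w x t) + k2 * \<phi>2 (z x t))"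
  proof (rule distr_le_zero_combine)
    show "distr_le_zero (\<lambda>x t. \<psi>1 (w x t)) (\<lambda>x t. \<phi>1 (w x t))" using w(1) p unfolding burgers_entropy_solution_def by blast
    show "distr_le_zero (\<lambda>x t. \<psi>2 (z x t)) (\<lambda>x t. \<phi>2 (z x t))" using z(1) p unfolding burgers_entropy_solution_def by blast
    note ebc = ess_bounded_continuous[OF w(2)[unfolded case_prod_unfold]] ess_bounded_continuous[OF z(2)[unfolded case_prod_unfold]]
    show "ess_bounded (lebesgue_on half_plane) (\<lambda>(x, t). \<psi>1 (w x t))" "ess_bounded (lebesgue_on half_plane) (\<lambda>(x, t). \<phi>1 (w x t))"
      "ess_bounded (lebesgue_on half_plane) (\<lambda>(x, t). \<psi>2 (z x t))" "ess_bounded (lebesgue_on half_plane) (\<lambda>(x, t). \<phi>2 (z x t))"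
      unfolding case_prod_unfold by (rule ebc c)+
  qed (use p in auto)
  then show "distr_le_zero (\<lambda>x t. \<eta> (?\<rho> x t) (?u x t)) (\<lambda>x t. q (?\<rho> x t) (?u x t))"
    unfolding \<eta> q wz .
qed

text \<open>Both solutions are constructed together, since their order rests on comparing the
  increments of the two antiderivatives.\<close>

lemma burgers_existence:
  assumes "ess_bounded lebesgue w0" "ess_bounded lebesgue z0" "AE x in lebesgue. z0 x \<le> w0 x"
  obtains w z where "burgers_entropy_solution w" "ess_bounded (lebesgue_on half_plane) (\<lambda>(x, t). w x t)"
    "has_initial_value w w0" "L1_loc_continuous w"
    "burgers_entropy_solution z" "ess_bounded (lebesgue_on half_plane) (\<lambda>(x, t). z x t)"
    "has_initial_value z z0" "L1_loc_continuous z"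
    "AE (x, t) in lebesgue_on half_plane. z x t \<le> w x t"
proof -
  have ex: "\<exists>K g. g \<in> borel_measurable borel \<and> (\<forall>x. \<bar>g x\<bar> \<le> K) \<and> (AE x in lborel. g x = f x)"
    if f: "ess_bounded lebesgue f" for f :: "real \<Rightarrow> real"
  proof -
    from f obtain C where "f \<in> borel_measurable lebesgue" and C: "AE x in lborel. \<bar>f x\<bar> \<le> C"
      by (auto simp: ess_bounded_def AE_completion_iff)
    then obtain g where g: "g \<in> borel_measurable lborel" "AE x in lborel. f x = g x"
      using completion_ex_borel_measurable_real by blast
    have [measurable]: "g \<in> borel_measurable borel" using g by simp
    have "AE x in lborel. max (- \<bar>C\<bar>) (min \<bar>C\<bar> (g x)) = f x" using g(2) C by eventually_elim auto
    moreover have "(\<lambda>x. max (- \<bar>C\<bar>) (min \<bar>C\<bar> (g x))) \<in> borel_measurable borel" by measurable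
    ultimately show ?thesis by (intro exI[of _ "\<bar>C\<bar>"] exI[of _ "\<lambda>x. max (- \<bar>C\<bar>) (min \<bar>C\<bar> (g x))"]) auto
  qed
  obtain K g where g: "g \<in> borel_measurable borel" "\<And>x. \<bar>g x\<bar> \<le> K" "AE x in lborel. g x = w0 x" using ex[OF assms(1)] by blast
  obtain L f where f: "f \<in> borel_measurable borel" "\<And>x. \<bar>f x\<bar> \<le> L" "AE x in lborel. f x = z0 x" using ex[OF assms(2)] by blast
  \<comment> \<open>The minimum changes \<open>f\<close> only on a null set and makes the order of
    the data hold at every point, so that the integrals can be compared.\<close>
  define h where "h x = min (g x) (f x)" for x
  have h: "h \<in> borel_measurable borel" unfolding h_def[abs_def] using g(1) f(1) by measurable
  have hK: "\<bar>h x\<bar> \<le> K + L" for x using g(2)[of x] f(2)[of x] by (auto simp: h_def min_def)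
  have hz: "AE x in lborel. h x = z0 x"
    using g(3) f(3) assms(3)[unfolded AE_completion_iff] by eventually_elim (auto simp: h_def)
  obtain A where A: "hopf_lax A K" "\<And>x y. x \<le> y \<Longrightarrow> A y - A x = integral {x..y} g"
    using hopf_lax_antiderivative[OF g(1,2)] by blast
  obtain B where B: "hopf_lax B (K + L)" "\<And>x y. x \<le> y \<Longrightarrow> B y - B x = integral {x..y} h"
    using hopf_lax_antiderivative[OF h hK] by blast
  interpret a: hopf_lax A K by fact
  interpret b: hopf_lax B "K + L" by fact
  have slice: "(\<lambda>x. a.solution x t) \<in> borel_measurable lebesgue" "(\<lambda>x. b.solution x t) \<in> borel_measurable lebesgue" for t
    using a.solution_slice_measurable b.solution_slice_measurable by (auto intro: measurable_completion)
  have gh: "g \<in> borel_measurable lebesgue" "h \<in> borel_measurable lebesgue" using g(1) h by (auto intro: measurable_completion)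
  show ?thesis
  proof (rule that[OF a.solution_burgers a.solution_ess_bounded _ a.solution_L1_loc_continuous
        b.solution_burgers b.solution_ess_bounded _ b.solution_L1_loc_continuous])
    show "has_initial_value a.solution w0"
      by (rule has_initial_value_cong_AE[OF a.solution_initial_value[OF g(1,2) A(2)] g(3) slice(1) gh(1)])
        (use assms in \<open>auto simp: ess_bounded_def\<close>)
    show "has_initial_value b.solution z0"
      by (rule has_initial_value_cong_AE[OF b.solution_initial_value[OF h hK B(2)] hz slice(2) gh(2)])
        (use assms in \<open>auto simp: ess_bounded_def\<close>)
    have AB: "B y - B x \<le> A y - A x" if "x \<le> y" for x y
      unfolding A(2)[OF that] B(2)[OF that]
      by (rule integral_le[OF integral_Ioo_eq(1)[OF h hK] integral_Ioo_eq(1)[OF g(1,2)]]) (simp add: h_def)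
    have "AE p in lborel. p \<in> half_plane \<longrightarrow> b.solution (fst p) (snd p) \<le> a.solution (fst p) (snd p)"
    proof (rule AE_half_plane_slices)
      show "Measurable.pred (borel \<Otimes>\<^sub>M borel) (\<lambda>p. b.solution (fst p) (snd p) \<le> a.solution (fst p) (snd p))"
        unfolding pred_def by (rule borel_measurable_le[OF b.solution_measurable a.solution_measurable])
      show "AE t in lborel. 0 < t \<longrightarrow> (AE x in lborel. b.solution (fst (x, t)) (snd (x, t)) \<le> a.solution (fst (x, t)) (snd (x, t)))"
      proof (rule AE_I2, rule impI)
        fix t :: real assume t: "0 < t"
        show "AE x in lborel. b.solution (fst (x, t)) (snd (x, t)) \<le> a.solution (fst (x, t)) (snd (x, t))"
          using a.AE_regular[OF t] b.AE_regular[OF t]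
        proof eventually_elim
          case (elim x)
          then obtain y z where "a.regular x t y" "b.regular x t z" by blast
          from hopf_lax_solution_mono[OF A(1) B(1) AB t this] show ?case by simp
        qed
      qed
    qed
    then show "AE (x, t) in lebesgue_on half_plane. b.solution x t \<le> a.solution x t"
      unfolding AE_lebesgue_on_iff[OF half_plane_borel] case_prod_unfold .
  qed
qed

section \<open>Contraction for the system and its extension to every time\<close>

lemma L1_norm_combine_le:
  assumes "integrable lebesgue f" "integrable lebesgue g"
  shows "L1_norm (\<lambda>x. a * f x + b * g x) \<le> \<bar>a\<bar> * L1_norm f + \<bar>b\<bar> * L1_norm g"
  using set_integral_combine_le[of lebesgue UNIV f g a b] assms
  by (simp add: set_integrable_def set_lebesgue_integral_def L1_norm_def)

text \<open>The Riemann invariants \<open>u + \<surd>\<alpha> \<rho>\<close> and \<open>u - \<surd>\<alpha> \<rho>\<close> each contract in \<open>L\<^sup>1\<close>; the factor 2 comes from changing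
  variables back and forth.\<close>

lemma system_contraction:
  assumes "\<alpha> > 0"
    and s: "entropy_solution \<alpha> \<rho> u" "has_initial_value \<rho> \<rho>0" "has_initial_value u u0" "ess_bounded lebesgue \<rho>0" "ess_bounded lebesgue u0"
    and s': "entropy_solution \<alpha> \<rho>' u'" "has_initial_value \<rho>' \<rho>0'" "has_initial_value u' u0'" "ess_bounded lebesgue \<rho>0'" "ess_bounded lebesgue u0'"
    and int: "integrable lebesgue (\<lambda>x. u0 x - u0' x)" "integrable lebesgue (\<lambda>x. \<rho>0 x - \<rho>0' x)"
  shows "AE t in lborel. 0 < t \<longrightarrow> integrable lebesgue (\<lambda>x. u x t - u' x t) \<and> integrable lebesgue (\<lambda>x. \<rho> x t - \<rho>' x t) \<and>
     sqrt \<alpha> * L1_norm (\<lambda>x. \<rho> x t - \<rho>' x t) + L1_norm (\<lambda>x. u x t - u' x t)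
       \<le> 2 * (sqrt \<alpha> * L1_norm (\<lambda>x. \<rho>0 x - \<rho>0' x) + L1_norm (\<lambda>x. u0 x - u0' x))"
proof -
  define c where "c = sqrt \<alpha>"
  have c: "c > 0" using assms(1) by (simp add: c_def)
  have eb: "ess_bounded (lebesgue_on half_plane) (\<lambda>(x, t). \<rho> x t)" "ess_bounded (lebesgue_on half_plane) (\<lambda>(x, t). u x t)"
    "ess_bounded (lebesgue_on half_plane) (\<lambda>(x, t). \<rho>' x t)" "ess_bounded (lebesgue_on half_plane) (\<lambda>(x, t). u' x t)"
    using s(1) s'(1) by (auto simp: entropy_solution_def)
  have main: "AE t in lborel. 0 < t \<longrightarrow> integrable lebesgue (\<lambda>x. (1 * u x t + k * \<rho> x t) - (1 * u' x t + k * \<rho>' x t)) \<and>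
     L1_norm (\<lambda>x. (1 * u x t + k * \<rho> x t) - (1 * u' x t + k * \<rho>' x t)) \<le> L1_norm (\<lambda>x. (1 * u0 x + k * \<rho>0 x) - (1 * u0' x + k * \<rho>0' x))"
    if "burgers_entropy_solution (\<lambda>x t. 1 * u x t + k * \<rho> x t)" "burgers_entropy_solution (\<lambda>x t. 1 * u' x t + k * \<rho>' x t)" for k
  proof (rule burgers_contraction[OF that(1) _ _ _ that(2)])
    show "ess_bounded (lebesgue_on half_plane) (\<lambda>(x, t). 1 * u x t + k * \<rho> x t)"
      using ess_bounded_combine[OF eb(2,1)[unfolded case_prod_unfold]] by (simp only: case_prod_unfold)
    show "ess_bounded (lebesgue_on half_plane) (\<lambda>(x, t). 1 * u' x t + k * \<rho>' x t)"
      using ess_bounded_combine[OF eb(4,3)[unfolded case_prod_unfold]] by (simp only: case_prod_unfold)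
    show "has_initial_value (\<lambda>x t. 1 * u x t + k * \<rho> x t) (\<lambda>x. 1 * u0 x + k * \<rho>0 x)"
      by (rule has_initial_value_combine[OF eb(2) s(5,3) eb(1) s(4,2)])
    show "has_initial_value (\<lambda>x t. 1 * u' x t + k * \<rho>' x t) (\<lambda>x. 1 * u0' x + k * \<rho>0' x)"
      by (rule has_initial_value_combine[OF eb(4) s'(5,3) eb(3) s'(4,2)])
    have "integrable lebesgue (\<lambda>x. (u0 x - u0' x) + k * (\<rho>0 x - \<rho>0' x))" using int by simp
    moreover have "(u0 x - u0' x) + k * (\<rho>0 x - \<rho>0' x) = (1 * u0 x + k * \<rho>0 x) - (1 * u0' x + k * \<rho>0' x)" for x
      by (simp add: algebra_simps)
    ultimately show "integrable lebesgue (\<lambda>x. (1 * u0 x + k * \<rho>0 x) - (1 * u0' x + k * \<rho>0' x))" by simp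
    show "ess_bounded lebesgue (\<lambda>x. 1 * u0 x + k * \<rho>0 x)" "ess_bounded lebesgue (\<lambda>x. 1 * u0' x + k * \<rho>0' x)"
      by (rule ess_bounded_combine[OF s(5,4)], rule ess_bounded_combine[OF s'(5,4)])
  qed
  have init: "L1_norm (\<lambda>x. (1 * u0 x + k * \<rho>0 x) - (1 * u0' x + k * \<rho>0' x)) \<le> c * L1_norm (\<lambda>x. \<rho>0 x - \<rho>0' x) + L1_norm (\<lambda>x. u0 x - u0' x)"
    if "\<bar>k\<bar> = c" for k
  proof -
    have eq: "(1 * u0 x + k * \<rho>0 x) - (1 * u0' x + k * \<rho>0' x) = 1 * (u0 x - u0' x) + k * (\<rho>0 x - \<rho>0' x)" for x
      by (simp add: algebra_simps)
    show ?thesis unfolding eq using L1_norm_combine_le[OF int, of 1 k] that by simp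
  qed
  show ?thesis
    using main[OF entropy_solution_burgers(1)[OF s(1)] entropy_solution_burgers(1)[OF s'(1)]]
      main[OF entropy_solution_burgers(2)[OF s(1)] entropy_solution_burgers(2)[OF s'(1)]]
    unfolding c_def[symmetric]
  proof eventually_elim
    case (elim t)
    show ?case
    proof
      assume t: "0 < t"
      define P where "P x = (1 * u x t + c * \<rho> x t) - (1 * u' x t + c * \<rho>' x t)" for x
      define Q where "Q x = (1 * u x t + (- c) * \<rho> x t) - (1 * u' x t + (- c) * \<rho>' x t)" for x
      have PQ: "integrable lebesgue P" "integrable lebesgue Q"
        and le: "L1_norm P \<le> c * L1_norm (\<lambda>x. \<rho>0 x - \<rho>0' x) + L1_norm (\<lambda>x. u0 x - u0' x)"
          "L1_norm Q \<le> c * L1_norm (\<lambda>x. \<rho>0 x - \<rho>0' x) + L1_norm (\<lambda>x. u0 x - u0' x)"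
        using elim t init[of c] init[of "- c"] c unfolding P_def[abs_def] Q_def[abs_def] by auto
      have du: "u x t - u' x t = 1 / 2 * P x + 1 / 2 * Q x" for x by (simp add: P_def Q_def field_simps)
      \<comment> \<open>The coefficients 1/(2 c) become 1/2 after multiplication by c, so both norms
        obey the same bound by the mean of the norms of \<open>P\<close> and
        \<open>Q\<close>.\<close>
      have dr: "\<rho> x t - \<rho>' x t = 1 / (2 * c) * P x + (- (1 / (2 * c))) * Q x" for x using c by (simp add: P_def Q_def field_simps)
      have i: "integrable lebesgue (\<lambda>x. u x t - u' x t)" "integrable lebesgue (\<lambda>x. \<rho> x t - \<rho>' x t)"
        unfolding du dr using PQ by simp_all
      have "L1_norm (\<lambda>x. u x t - u' x t) \<le> 1 / 2 * L1_norm P + 1 / 2 * L1_norm Q"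
        using L1_norm_combine_le[OF PQ, of "1 / 2" "1 / 2"] unfolding du by simp
      moreover have "c * L1_norm (\<lambda>x. \<rho> x t - \<rho>' x t) \<le> 1 / 2 * L1_norm P + 1 / 2 * L1_norm Q"
      proof -
        have "c * L1_norm (\<lambda>x. \<rho> x t - \<rho>' x t) \<le> c * (1 / (2 * c) * L1_norm P + 1 / (2 * c) * L1_norm Q)"
          using L1_norm_combine_le[OF PQ, of "1 / (2 * c)" "- (1 / (2 * c))"] c unfolding dr by (intro mult_left_mono) auto
        also have "\<dots> = 1 / 2 * L1_norm P + 1 / 2 * L1_norm Q" using c by (simp add: field_simps)
        finally show ?thesis .
      qed
      ultimately show "integrable lebesgue (\<lambda>x. u x t - u' x t) \<and> integrable lebesgue (\<lambda>x. \<rho> x t - \<rho>' x t) \<and>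
        c * L1_norm (\<lambda>x. \<rho> x t - \<rho>' x t) + L1_norm (\<lambda>x. u x t - u' x t)
          \<le> 2 * (c * L1_norm (\<lambda>x. \<rho>0 x - \<rho>0' x) + L1_norm (\<lambda>x. u0 x - u0' x))"
        using i le by auto
    qed
  qed
qed

text \<open>The bound holds at times arbitrarily close to t. Continuity in L^1 on [-R, R] carries it
  over to t on that interval, and letting R grow gives integrability together with the
  bound.\<close>

lemma L1_bound_all_times:
  assumes c: "c \<ge> 0"
    and ae: "AE t in lborel. 0 < t \<longrightarrow> integrable lebesgue (\<lambda>x. u x t) \<and> integrable lebesgue (\<lambda>x. \<rho> x t) \<and>
     c * L1_norm (\<lambda>x. \<rho> x t) + L1_norm (\<lambda>x. u x t) \<le> E"
    and cont: "L1_loc_continuous \<rho>" "L1_loc_continuous u" and t: "t > 0" and cpos: "c > 0"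
  shows "integrable lebesgue (\<lambda>x. u x t) \<and> integrable lebesgue (\<lambda>x. \<rho> x t) \<and>
     c * L1_norm (\<lambda>x. \<rho> x t) + L1_norm (\<lambda>x. u x t) \<le> E"
proof -
  have si: "set_integrable lebesgue {-R..R} (\<lambda>x. u x s)" "set_integrable lebesgue {-R..R} (\<lambda>x. \<rho> x s)" if "s > 0" for R s
  proof -
    \<comment> \<open>\<open>L1_loc_continuous\<close> speaks of positive radii only; a larger
      interval covers all other R.\<close>
    have "set_integrable lebesgue {-max R 1..max R 1} (\<lambda>x. u x s)" "set_integrable lebesgue {-max R 1..max R 1} (\<lambda>x. \<rho> x s)"
      using cont that unfolding L1_loc_continuous_def by (meson less_max_iff_disj zero_less_one)+
    moreover have "{-R..R} \<in> sets lebesgue" "{-R..R} \<subseteq> {-max R 1..max R 1}" by auto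
    ultimately show "set_integrable lebesgue {-R..R} (\<lambda>x. u x s)" "set_integrable lebesgue {-R..R} (\<lambda>x. \<rho> x s)"
      using set_integrable_subset by blast+
  qed
  have loc: "c * (LINT x:{-R..R}|lebesgue. \<bar>\<rho> x t\<bar>) + (LINT x:{-R..R}|lebesgue. \<bar>u x t\<bar>) \<le> E" if "R > 0" for R
  proof (rule field_le_epsilon)
    fix \<epsilon> :: real assume "\<epsilon> > 0"
    \<comment> \<open>The two errors then add up to c \<epsilon>' + \<epsilon>' =
      \<epsilon>.\<close>
    define \<epsilon>' where "\<epsilon>' = \<epsilon> / (c + 1)"
    have \<epsilon>': "\<epsilon>' > 0" using \<open>\<epsilon> > 0\<close> c by (simp add: \<epsilon>'_def)
    have "\<forall>\<^sub>F s in at t. (LINT x:{-R..R}|lebesgue. \<bar>\<rho> x s - \<rho> x t\<bar>) < \<epsilon>'"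
      "\<forall>\<^sub>F s in at t. (LINT x:{-R..R}|lebesgue. \<bar>u x s - u x t\<bar>) < \<epsilon>'"
    proof -
      have "((\<lambda>s. LINT x:{-R..R}|lebesgue. \<bar>\<rho> x s - \<rho> x t\<bar>) \<longlongrightarrow> 0) (at t)"
        "((\<lambda>s. LINT x:{-R..R}|lebesgue. \<bar>u x s - u x t\<bar>) \<longlongrightarrow> 0) (at t)"
        using cont t \<open>R > 0\<close> unfolding L1_loc_continuous_def by blast+
      from order_tendstoD(2)[OF this(1) \<epsilon>'] order_tendstoD(2)[OF this(2) \<epsilon>']
      show "\<forall>\<^sub>F s in at t. (LINT x:{-R..R}|lebesgue. \<bar>\<rho> x s - \<rho> x t\<bar>) < \<epsilon>'"
        "\<forall>\<^sub>F s in at t. (LINT x:{-R..R}|lebesgue. \<bar>u x s - u x t\<bar>) < \<epsilon>'" .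
    qed
    then have "\<forall>\<^sub>F s in at t. (LINT x:{-R..R}|lebesgue. \<bar>\<rho> x s - \<rho> x t\<bar>) < \<epsilon>' \<and> (LINT x:{-R..R}|lebesgue. \<bar>u x s - u x t\<bar>) < \<epsilon>'"
      by (rule eventually_conj)
    then obtain d where d: "d > 0" "\<And>s. s \<noteq> t \<Longrightarrow> dist s t < d \<Longrightarrow> (LINT x:{-R..R}|lebesgue. \<bar>\<rho> x s - \<rho> x t\<bar>) < \<epsilon>' \<and> (LINT x:{-R..R}|lebesgue. \<bar>u x s - u x t\<bar>) < \<epsilon>'"
      unfolding eventually_at by auto
    \<comment> \<open>An open interval of times has positive measure, so it contains a time at which
      the bound is known.\<close>
    have "\<exists>s. s \<in> {t<..<t + d} \<and> (integrable lebesgue (\<lambda>x. u x s) \<and> integrable lebesgue (\<lambda>x. \<rho> x s) \<and>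
       c * L1_norm (\<lambda>x. \<rho> x s) + L1_norm (\<lambda>x. u x s) \<le> E)"
    proof (rule ccontr)
      assume "\<not> ?thesis"
      then have "AE s in lborel. s \<notin> {t<..<t + d}"
        using ae by (auto elim!: eventually_mono) (use t in force)
      then have "{t<..<t + d} \<in> null_sets lborel" by (simp add: AE_iff_null_sets)
      then show False using d(1) by (simp add: null_sets_def)
    qed
    then obtain s where s: "s \<in> {t<..<t + d}" "integrable lebesgue (\<lambda>x. u x s)" "integrable lebesgue (\<lambda>x. \<rho> x s)"
       "c * L1_norm (\<lambda>x. \<rho> x s) + L1_norm (\<lambda>x. u x s) \<le> E" by blast
    have ds: "(LINT x:{-R..R}|lebesgue. \<bar>\<rho> x s - \<rho> x t\<bar>) < \<epsilon>'" "(LINT x:{-R..R}|lebesgue. \<bar>u x s - u x t\<bar>) < \<epsilon>'"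
      using d(2)[of s] s(1) by (auto simp: dist_real_def)
    have s0: "s > 0" using s(1) t by auto
    have tri: "(LINT x:{-R..R}|lebesgue. \<bar>f x t\<bar>) \<le> L1_norm (\<lambda>x. f x s) + (LINT x:{-R..R}|lebesgue. \<bar>f x s - f x t\<bar>)"
      if "set_integrable lebesgue {-R..R} (\<lambda>x. f x s)" "set_integrable lebesgue {-R..R} (\<lambda>x. f x t)" "integrable lebesgue (\<lambda>x. f x s)" for f :: "real \<Rightarrow> real \<Rightarrow> real"
    proof -
      have "(LINT x:{-R..R}|lebesgue. \<bar>f x t\<bar>) = (LINT x:{-R..R}|lebesgue. \<bar>1 * f x s + (-1) * (f x s - f x t)\<bar>)" by simp
      also have "\<dots> \<le> \<bar>1\<bar> * (LINT x:{-R..R}|lebesgue. \<bar>f x s\<bar>) + \<bar>-1\<bar> * (LINT x:{-R..R}|lebesgue. \<bar>f x s - f x t\<bar>)"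
        by (rule set_integral_combine_le[OF that(1) set_integral_diff(1)[OF that(1,2)]])
      also have "(LINT x:{-R..R}|lebesgue. \<bar>f x s\<bar>) \<le> L1_norm (\<lambda>x. f x s)"
        unfolding L1_norm_def set_lebesgue_integral_def
        by (rule integral_mono') (use that(3) in \<open>auto simp: indicator_def\<close>)
      finally show ?thesis by simp
    qed
    have "c * (LINT x:{-R..R}|lebesgue. \<bar>\<rho> x t\<bar>) \<le> c * (L1_norm (\<lambda>x. \<rho> x s) + \<epsilon>')"
      using tri[OF si(2)[OF s0] si(2)[OF t] s(3)] ds(1) c by (intro mult_left_mono) auto
    moreover have "(LINT x:{-R..R}|lebesgue. \<bar>u x t\<bar>) \<le> L1_norm (\<lambda>x. u x s) + \<epsilon>'"
      using tri[OF si(1)[OF s0] si(1)[OF t] s(2)] ds(2) by simp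
    moreover have "(c + 1) * \<epsilon>' = \<epsilon>" using c by (simp add: \<epsilon>'_def)
    ultimately show "c * (LINT x:{-R..R}|lebesgue. \<bar>\<rho> x t\<bar>) + (LINT x:{-R..R}|lebesgue. \<bar>u x t\<bar>) \<le> E + \<epsilon>"
      using s(4) by (simp add: algebra_simps)
  qed
  have E: "0 \<le> E"
  proof -
    have "0 \<le> (LINT x:{-1..1}|lebesgue. \<bar>\<rho> x t\<bar>)" "0 \<le> (LINT x:{-1..1}|lebesgue. \<bar>u x t\<bar>)"
      unfolding set_lebesgue_integral_def by (rule Bochner_Integration.integral_nonneg, simp)+
    then show ?thesis using loc[of 1] c mult_nonneg_nonneg[of c "LINT x:{-1..1}|lebesgue. \<bar>\<rho> x t\<bar>"] by linarith
  qed
  have f: "integrable lebesgue (\<lambda>x. c * \<bar>\<rho> x t\<bar> + \<bar>u x t\<bar>) \<and> (LINT x|lebesgue. c * \<bar>\<rho> x t\<bar> + \<bar>u x t\<bar>) \<le> E"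
  proof (rule integrable_of_local_bounds)
    fix n :: nat
    have i: "set_integrable lebesgue {- real n..real n} (\<lambda>x. c * \<bar>\<rho> x t\<bar>)" "set_integrable lebesgue {- real n..real n} (\<lambda>x. \<bar>u x t\<bar>)"
      using si[OF t] by (auto intro!: set_integrable_abs set_integrable_mult_right)
    then show "set_integrable lebesgue {- real n..real n} (\<lambda>x. c * \<bar>\<rho> x t\<bar> + \<bar>u x t\<bar>)" by (rule set_integral_add(1))
    have "(LINT x:{- real n..real n}|lebesgue. c * \<bar>\<rho> x t\<bar> + \<bar>u x t\<bar>) =
        c * (LINT x:{- real n..real n}|lebesgue. \<bar>\<rho> x t\<bar>) + (LINT x:{- real n..real n}|lebesgue. \<bar>u x t\<bar>)"
      by (simp add: set_integral_add(2)[OF i])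
    also have "\<dots> \<le> E"
    \<comment> \<open>\<open>loc\<close> requires a positive radius; for n = 0 the integral is over
      a single point.\<close>
    proof (cases "n = 0")
      case True
      have z: "(LINT x:{0..0::real}|lebesgue. g x) = 0" for g :: "real \<Rightarrow> real"
        unfolding set_lebesgue_integral_def 
        by (rule integral_eq_zero_AE, rule eventually_mono[OF AE_completion[OF AE_lborel_singleton[of 0]]]) simp
      show ?thesis using True E by (simp add: z del: atLeastAtMost_singleton)
    next
      case False
      then show ?thesis using loc[of "real n"] by simp
    qed
    finally show "(LINT x:{- real n..real n}|lebesgue. c * \<bar>\<rho> x t\<bar> + \<bar>u x t\<bar>) \<le> E" .
  qed (use c in simp)
  have m: "(\<lambda>x. g x) \<in> borel_measurable lebesgue" if "\<And>n::nat. set_integrable lebesgue {- real n..real n} g" for g :: "real \<Rightarrow> real"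
  proof (rule borel_measurable_LIMSEQ_real)
    show "(\<lambda>n. indicator {- real n..real n} x *\<^sub>R g x) \<longlonglongrightarrow> g x" for x
    proof (rule tendsto_eventually)
      obtain n0 where "\<bar>x\<bar> \<le> real n0" using real_arch_simple by blast
      then show "\<forall>\<^sub>F n in sequentially. indicator {- real n..real n} x *\<^sub>R g x = g x"
        by (intro eventually_sequentiallyI[of n0]) (auto simp: indicator_def)
    qed
    show "(\<lambda>x. indicator {- real n..real n} x *\<^sub>R g x) \<in> borel_measurable lebesgue" for n :: nat
      using that[of n] by (auto simp: set_integrable_def)
  qed
  have iu: "integrable lebesgue (\<lambda>x. u x t)"
    by (rule Bochner_Integration.integrable_bound[OF conjunct1[OF f] m[OF si(1)[OF t]]]) (use c in \<open>auto simp: abs_of_nonneg\<close>)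
  have "integrable lebesgue (\<lambda>x. c * \<rho> x t)"
    by (rule Bochner_Integration.integrable_bound[OF conjunct1[OF f]]) (use c m[OF si(2)[OF t]] in \<open>auto simp: abs_mult\<close>)
  then have ir: "integrable lebesgue (\<lambda>x. \<rho> x t)" using cpos by simp
  have "c * L1_norm (\<lambda>x. \<rho> x t) + L1_norm (\<lambda>x. u x t) = (LINT x|lebesgue. c * \<bar>\<rho> x t\<bar> + \<bar>u x t\<bar>)"
    using iu ir by (simp add: L1_norm_def)
  then show ?thesis using iu ir f by simp
qed

theorem theorem4p1:
  fixes \<alpha> :: real and \<rho>\<^sub>0 u\<^sub>0 :: "real \<Rightarrow> real"
  assumes "\<alpha> > 0"
    and "ess_bounded lebesgue \<rho>\<^sub>0" and "ess_bounded lebesgue u\<^sub>0"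
    and "AE x in lebesgue. 0 \<le> \<rho>\<^sub>0 x"
  shows
    "(\<exists>\<rho> u. entropy_solution \<alpha> \<rho> u \<and> has_initial_value \<rho> \<rho>\<^sub>0 \<and> has_initial_value u u\<^sub>0 \<and>
        L1_loc_continuous \<rho> \<and> L1_loc_continuous u \<and>
        (\<forall>\<rho>' u'. entropy_solution \<alpha> \<rho>' u' \<and> has_initial_value \<rho>' \<rho>\<^sub>0 \<and> has_initial_value u' u\<^sub>0 \<longrightarrow>
          (AE (x, t) in lebesgue_on half_plane. \<rho>' x t = \<rho> x t \<and> u' x t = u x t))) \<and>
     (\<forall>\<rho> u \<rho>' u' \<rho>\<^sub>0' u\<^sub>0'.
        entropy_solution \<alpha> \<rho> u \<and> has_initial_value \<rho> \<rho>\<^sub>0 \<and> has_initial_value u u\<^sub>0 \<and>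
        ess_bounded lebesgue \<rho>\<^sub>0' \<and> ess_bounded lebesgue u\<^sub>0' \<and> (AE x in lebesgue. 0 \<le> \<rho>\<^sub>0' x) \<and>
        entropy_solution \<alpha> \<rho>' u' \<and> has_initial_value \<rho>' \<rho>\<^sub>0' \<and> has_initial_value u' u\<^sub>0' \<and>
        integrable lebesgue (\<lambda>x. u\<^sub>0 x - u\<^sub>0' x) \<and> integrable lebesgue (\<lambda>x. \<rho>\<^sub>0 x - \<rho>\<^sub>0' x) \<longrightarrow>
        (\<exists>N. N \<in> null_sets lebesgue \<and>
          (L1_loc_continuous \<rho> \<and> L1_loc_continuous u \<and>
           L1_loc_continuous \<rho>' \<and> L1_loc_continuous u' \<longrightarrow> N = {}) \<and>
          (\<forall>t\<in>{0<..} - N.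
            integrable lebesgue (\<lambda>x. u x t - u' x t) \<and>
            integrable lebesgue (\<lambda>x. \<rho> x t - \<rho>' x t) \<and>
            sqrt \<alpha> * L1_norm (\<lambda>x. \<rho> x t - \<rho>' x t) + L1_norm (\<lambda>x. u x t - u' x t)
              \<le> 2 * (sqrt \<alpha> * L1_norm (\<lambda>x. \<rho>\<^sub>0 x - \<rho>\<^sub>0' x) + L1_norm (\<lambda>x. u\<^sub>0 x - u\<^sub>0' x)))))"
proof -
  let ?c = "sqrt \<alpha>"
  have c: "?c > 0" using assms(1) by simp
  have exist: "\<exists>\<rho> u. entropy_solution \<alpha> \<rho> u \<and> has_initial_value \<rho> \<rho>\<^sub>0 \<and> has_initial_value u u\<^sub>0 \<and>
        L1_loc_continuous \<rho> \<and> L1_loc_continuous u"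
  proof -
    have eb: "ess_bounded lebesgue (\<lambda>x. 1 * u\<^sub>0 x + ?c * \<rho>\<^sub>0 x)" "ess_bounded lebesgue (\<lambda>x. 1 * u\<^sub>0 x + (- ?c) * \<rho>\<^sub>0 x)"
      by (rule ess_bounded_combine[OF assms(3,2)])+
    have le: "AE x in lebesgue. 1 * u\<^sub>0 x + (- ?c) * \<rho>\<^sub>0 x \<le> 1 * u\<^sub>0 x + ?c * \<rho>\<^sub>0 x"
      using assms(4)
    proof eventually_elim
      case (elim x)
      have "0 \<le> ?c * \<rho>\<^sub>0 x" using elim c by simp
      then show ?case by simp
    qed
    obtain w z where w: "burgers_entropy_solution w" "ess_bounded (lebesgue_on half_plane) (\<lambda>(x, t). w x t)"
        "has_initial_value w (\<lambda>x. 1 * u\<^sub>0 x + ?c * \<rho>\<^sub>0 x)" "L1_loc_continuous w"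
      and z: "burgers_entropy_solution z" "ess_bounded (lebesgue_on half_plane) (\<lambda>(x, t). z x t)"
        "has_initial_value z (\<lambda>x. 1 * u\<^sub>0 x + (- ?c) * \<rho>\<^sub>0 x)" "L1_loc_continuous z"
      and wz: "AE (x, t) in lebesgue_on half_plane. z x t \<le> w x t"
      by (rule burgers_existence[OF eb le])
    \<comment> \<open>The inverse of the change to Riemann invariants, applied to solutions with
      data u + sqrt \<alpha> \<rho> and u - sqrt \<alpha> \<rho>.\<close>
    let ?\<rho> = "\<lambda>x t. 1 / (2 * ?c) * w x t + (- 1 / (2 * ?c)) * z x t" and ?u = "\<lambda>x t. 1 / 2 * w x t + 1 / 2 * z x t"
    have "entropy_solution \<alpha> ?\<rho> ?u" by (rule entropy_solution_of_burgers[OF assms(1) w(1,2) z(1,2) wz])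
    moreover have "has_initial_value ?\<rho> \<rho>\<^sub>0"
    proof -
      have "(\<lambda>x. 1 / (2 * ?c) * (1 * u\<^sub>0 x + ?c * \<rho>\<^sub>0 x) + (- 1 / (2 * ?c)) * (1 * u\<^sub>0 x + (- ?c) * \<rho>\<^sub>0 x)) = \<rho>\<^sub>0"
        using c by (auto simp: field_simps)
      then show ?thesis using has_initial_value_combine[OF w(2) eb(1) w(3) z(2) eb(2) z(3), of "1 / (2 * ?c)" "- 1 / (2 * ?c)"] by (simp only:)
    qed
    moreover have "has_initial_value ?u u\<^sub>0"
    proof -
      have "(\<lambda>x. 1 / 2 * (1 * u\<^sub>0 x + ?c * \<rho>\<^sub>0 x) + 1 / 2 * (1 * u\<^sub>0 x + (- ?c) * \<rho>\<^sub>0 x)) = u\<^sub>0"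
        by (auto simp: field_simps)
      then show ?thesis using has_initial_value_combine[OF w(2) eb(1) w(3) z(2) eb(2) z(3), of "1 / 2" "1 / 2"] by (simp only:)
    qed
    moreover have "L1_loc_continuous ?\<rho>" "L1_loc_continuous ?u" by (rule L1_loc_continuous_combine[OF w(4) z(4)])+
    ultimately show ?thesis by blast
  qed
  have unique: "AE (x, t) in lebesgue_on half_plane. \<rho>' x t = \<rho> x t \<and> u' x t = u x t"
    if s: "entropy_solution \<alpha> \<rho> u" "has_initial_value \<rho> \<rho>\<^sub>0" "has_initial_value u u\<^sub>0"
      and s': "entropy_solution \<alpha> \<rho>' u'" "has_initial_value \<rho>' \<rho>\<^sub>0" "has_initial_value u' u\<^sub>0" for \<rho> u \<rho>' u'
  proof -
    have eb: "ess_bounded (lebesgue_on half_plane) (\<lambda>(x, t). \<rho> x t)" "ess_bounded (lebesgue_on half_plane) (\<lambda>(x, t). u x t)"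
      "ess_bounded (lebesgue_on half_plane) (\<lambda>(x, t). \<rho>' x t)" "ess_bounded (lebesgue_on half_plane) (\<lambda>(x, t). u' x t)"
      using s(1) s'(1) by (auto simp: entropy_solution_def)
    have main: "AE p in lborel. p \<in> half_plane \<longrightarrow> 1 * u (fst p) (snd p) + k * \<rho> (fst p) (snd p) = 1 * u' (fst p) (snd p) + k * \<rho>' (fst p) (snd p)"
      if "burgers_entropy_solution (\<lambda>x t. 1 * u x t + k * \<rho> x t)" "burgers_entropy_solution (\<lambda>x t. 1 * u' x t + k * \<rho>' x t)" for k
    proof (rule burgers_uniqueness[OF that(1) _ _ that(2)])
      show "ess_bounded (lebesgue_on half_plane) (\<lambda>(x, t). 1 * u x t + k * \<rho> x t)"
        using ess_bounded_combine[OF eb(2,1)[unfolded case_prod_unfold]] by (simp only: case_prod_unfold)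
      show "ess_bounded (lebesgue_on half_plane) (\<lambda>(x, t). 1 * u' x t + k * \<rho>' x t)"
        using ess_bounded_combine[OF eb(4,3)[unfolded case_prod_unfold]] by (simp only: case_prod_unfold)
      show "has_initial_value (\<lambda>x t. 1 * u x t + k * \<rho> x t) (\<lambda>x. 1 * u\<^sub>0 x + k * \<rho>\<^sub>0 x)"
        by (rule has_initial_value_combine[OF eb(2) assms(3) s(3) eb(1) assms(2) s(2)])
      show "has_initial_value (\<lambda>x t. 1 * u' x t + k * \<rho>' x t) (\<lambda>x. 1 * u\<^sub>0 x + k * \<rho>\<^sub>0 x)"
        by (rule has_initial_value_combine[OF eb(4) assms(3) s'(3) eb(3) assms(2) s'(2)])
      show "ess_bounded lebesgue (\<lambda>x. 1 * u\<^sub>0 x + k * \<rho>\<^sub>0 x)" by (rule ess_bounded_combine[OF assms(3,2)])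
    qed
    show ?thesis
      unfolding AE_lebesgue_on_iff[OF half_plane_borel] case_prod_unfold
      using main[OF entropy_solution_burgers(1)[OF s(1)] entropy_solution_burgers(1)[OF s'(1)]]
        main[OF entropy_solution_burgers(2)[OF s(1)] entropy_solution_burgers(2)[OF s'(1)]]
    proof eventually_elim
      case (elim p)
      show ?case
      proof
        assume "p \<in> half_plane"
        then have e: "u (fst p) (snd p) + ?c * \<rho> (fst p) (snd p) = u' (fst p) (snd p) + ?c * \<rho>' (fst p) (snd p)"
          "u (fst p) (snd p) - ?c * \<rho> (fst p) (snd p) = u' (fst p) (snd p) - ?c * \<rho>' (fst p) (snd p)"
          using elim by simp_all
        then have "?c * \<rho>' (fst p) (snd p) = ?c * \<rho> (fst p) (snd p)" "u' (fst p) (snd p) = u (fst p) (snd p)" by linarith+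
        then show "\<rho>' (fst p) (snd p) = \<rho> (fst p) (snd p) \<and> u' (fst p) (snd p) = u (fst p) (snd p)" using c by simp
      qed
    qed
  qed
  show ?thesis
  proof (intro conjI allI impI, goal_cases)
    case 1
    then show ?case using exist unique by blast
  next
    case (2 \<rho> u \<rho>' u' \<rho>0' u0')
    then have s: "entropy_solution \<alpha> \<rho> u" "has_initial_value \<rho> \<rho>\<^sub>0" "has_initial_value u u\<^sub>0" "ess_bounded lebesgue \<rho>0'" "ess_bounded lebesgue u0'"
      "entropy_solution \<alpha> \<rho>' u'" "has_initial_value \<rho>' \<rho>0'" "has_initial_value u' u0'"
      "integrable lebesgue (\<lambda>x. u\<^sub>0 x - u0' x)" "integrable lebesgue (\<lambda>x. \<rho>\<^sub>0 x - \<rho>0' x)" by blast+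
    let ?E = "2 * (?c * L1_norm (\<lambda>x. \<rho>\<^sub>0 x - \<rho>0' x) + L1_norm (\<lambda>x. u\<^sub>0 x - u0' x))"
    let ?P = "\<lambda>t. integrable lebesgue (\<lambda>x. u x t - u' x t) \<and> integrable lebesgue (\<lambda>x. \<rho> x t - \<rho>' x t) \<and>
      ?c * L1_norm (\<lambda>x. \<rho> x t - \<rho>' x t) + L1_norm (\<lambda>x. u x t - u' x t) \<le> ?E"
    have ae: "AE t in lborel. 0 < t \<longrightarrow> ?P t"
      by (rule system_contraction[OF assms(1) s(1-3) assms(2,3) s(6-8) s(4,5,9,10)])
    show ?case
    \<comment> \<open>If all four functions are continuous in time, the estimate extends to every t
      > 0 and the exceptional set is empty. Otherwise a null set covers the exceptional times, and
      the clause about \<open>N = {}\<close> is vacuous.\<close>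
    proof (cases "L1_loc_continuous \<rho> \<and> L1_loc_continuous u \<and> L1_loc_continuous \<rho>' \<and> L1_loc_continuous u'")
      case True
      have "L1_loc_continuous (\<lambda>x t. \<rho> x t - \<rho>' x t)" "L1_loc_continuous (\<lambda>x t. u x t - u' x t)"
        using True L1_loc_continuous_combine[of _ _ 1 "-1"] by (simp_all)
      then have "?P t" if "t > 0" for t
        using L1_bound_all_times[OF less_imp_le[OF c] ae _ _ that c] by blast
      then show ?thesis by (intro exI[of _ "{}"]) auto
    next
      case False
      obtain N where N: "{t. \<not> (0 < t \<longrightarrow> ?P t)} \<subseteq> N" "N \<in> null_sets lborel"
        using ae by (auto simp: eventually_ae_filter)
      have "N \<in> null_sets lebesgue" using N(2) by (rule null_sets_completionI)
      moreover have "?P t" if "t \<in> {0<..} - N" for t using that N(1) by blast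
      ultimately show ?thesis using False by (intro exI[of _ N]) blast
    qed
  qed
qed

end
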